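(* Let $\lambda\in(0,\infty)$ and let $\alpha$ be a random variable with values in $(0,1)$ having a probability density function of the form $\psi(x)(1-x)^{\beta}$, $x\in(0,1)$, where $\psi$ is an integrable function on $(0,1)$ having a limit $\lim_{x\uparrow 1}\psi(x)=\psi_1\in(0,\infty)$. Let $(\alpha^{(j)},(X^{(j)}_k)_{k\in\mathbb{Z}_+})$, $j\in\mathbb{N}$, be independent copies of $(\alpha,(X_k)_{k\in\mathbb{Z}_+})$, where $(X_k)_{k\in\mathbb{Z}_+}$ is the randomized INAR(1) process with random thinning parameter $\alpha$ and Poisson innovations with parameter $\lambda$, and for $N,n\in\mathbb{N}$ put $$\widetilde S^{(N,n)}_t:=\sum_{j=1}^N\sum_{k=1}^{\lfloor nt\rfloor}\bigl(X^{(j)}_k-\mathbb{E}(X^{(j)}_k\mid\alpha^{(j)})\bigr),\qquad t\in\mathbb{R}_+ .$$ If $\beta=1$, then $$\mathcal{D}_{\mathrm f}\text{-}\lim_{n\to\infty}\ \mathcal{D}_{\mathrm f}\text{-}\lim_{N\to\infty}\ (n\log n)^{-\frac12}N^{-\frac12}\,\widetilde S^{(N,n)}=\sqrt{2\lambda\psi_1}\,B,$$ where $B=(B_t)_{t\in\mathbb{R}_+}$ is a standard Wiener process.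
   Context: $\mathbb{Z}_+$, $\mathbb{N}$, $\mathbb{R}_+$ denote the non-negative integers, the positive integers and the non-negative real numbers. Randomized INAR(1) process: conditionally on $\alpha$, $(X_k)_{k\in\mathbb{Z}_+}$ is a strictly stationary INAR(1) process with thinning parameter $\alpha$, that is, $$X_k=\sum_{i=1}^{X_{k-1}}\xi_{k,i}+\varepsilon_k,\qquad k\in\mathbb{N},$$ where, conditionally on $\alpha$: $(\xi_{k,i})_{k,i\in\mathbb{N}}$ are i.i.d. Bernoulli random variables with mean $\alpha$; $(\varepsilon_k)_{k\in\mathbb{N}}$ are i.i.d. Poisson random variables with parameter $\lambda$; $X_0$ has the unique stationary distribution, namely the Poisson distribution with parameter $\lambda/(1-\alpha)$; and $X_0$, $(\xi_{k,i})_{k,i\in\mathbb{N}}$ and $(\varepsilon_k)_{k\in\mathbb{N}}$ are independent. In particular $\mathbb{E}(X_k\mid\alpha)=\lambda/(1-\alpha)$. The innovations are idiosyncratic: the innovation sequences belonging to different copies $j$ are independent. $\mathcal{D}_{\mathrm f}\text{-}\lim$ denotes weak convergence of the finite-dimensional distributions of stochastic processes indexed by $t\in\mathbb{R}_+$. In the iterated limit, one first takes $N\to\infty$ for fixed $n$ (inner limit), and then lets $n\to\infty$ in the resulting limit process (outer limit). *)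

theory Defs
  imports "HOL-Probability.Probability"
begin

abbreviation sigma_rv :: "'a measure \<Rightarrow> ('a \<Rightarrow> real) \<Rightarrow> 'a measure" where
  "sigma_rv M a \<equiv> vimage_algebra (space M) a borel"

(* K is a regular conditional distribution on N of the random element Z given the real random
   variable a. *)
definition cond_distribution ::
  "'a measure \<Rightarrow> ('a \<Rightarrow> real) \<Rightarrow> 'b measure \<Rightarrow> ('a \<Rightarrow> 'b) \<Rightarrow> (real \<Rightarrow> 'b measure) \<Rightarrow> bool" where
  "cond_distribution M a N Z K \<longleftrightarrow>
     Z \<in> measurable M N \<and>
     (\<forall>E\<in>sets N. AE \<omega> in M.
        real_cond_exp M (sigma_rv M a) (indicator (Z -` E \<inter> space M)) \<omega> = measure (K (a \<omega>)) E)"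

type_synonym inar_input = "nat \<times> (nat \<times> nat \<Rightarrow> nat) \<times> (nat \<Rightarrow> nat)"

(* The values of (X_0, (xi_{k,i})_{k,i >= 1}, (eps_k)_{k >= 1}). *)
definition inar_input_space :: "inar_input measure" where
  "inar_input_space =
     count_space UNIV \<Otimes>\<^sub>M
     (PiM ({1..} \<times> {1..}) (\<lambda>_. count_space UNIV) \<Otimes>\<^sub>M PiM {1..} (\<lambda>_. count_space UNIV))"

(* For thinning parameter a: the product measure says that X_0 is Poisson(l / (1 - a)), the
   xi_{k,i} are i.i.d. Bernoulli(a), the eps_k are i.i.d. Poisson(l), and the three blocks
   are independent. *)
definition inar_input_law :: "real \<Rightarrow> real \<Rightarrow> inar_input measure" where
  "inar_input_law l a =
     measure_pmf (poisson_pmf (l / (1 - a))) \<Otimes>\<^sub>M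
     (PiM ({1..} \<times> {1..}) (\<lambda>_. measure_pmf (map_pmf of_bool (bernoulli_pmf a))) \<Otimes>\<^sub>M
      PiM {1..} (\<lambda>_. measure_pmf (poisson_pmf l)))"

definition randomized_INAR1 ::
  "'a measure \<Rightarrow> real \<Rightarrow> ('a \<Rightarrow> real) \<Rightarrow> (nat \<Rightarrow> nat \<Rightarrow> 'a \<Rightarrow> nat) \<Rightarrow> (nat \<Rightarrow> 'a \<Rightarrow> nat)
     \<Rightarrow> (nat \<Rightarrow> 'a \<Rightarrow> nat) \<Rightarrow> bool" where
  "randomized_INAR1 M l a \<xi> \<epsilon> X \<longleftrightarrow>
     a \<in> borel_measurable M \<and>
     (\<forall>\<omega>\<in>space M. 0 < a \<omega> \<and> a \<omega> < 1) \<and>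
     cond_distribution M a inar_input_space
       (\<lambda>\<omega>. (X 0 \<omega>, (\<lambda>(k, i)\<in>{1..} \<times> {1..}. \<xi> k i \<omega>), (\<lambda>k\<in>{1..}. \<epsilon> k \<omega>)))
       (inar_input_law l) \<and>
     (\<forall>\<omega>\<in>space M. \<forall>k\<ge>1. X k \<omega> = (\<Sum>i = 1..X (k - 1) \<omega>. \<xi> k i \<omega>) + \<epsilon> k \<omega>)"

definition pair_path_space :: "(real \<times> (nat \<Rightarrow> nat)) measure" where
  "pair_path_space = borel \<Otimes>\<^sub>M PiM UNIV (\<lambda>_. count_space UNIV)"

(* The pairs (A j, X j), j >= 1, on M are independent copies of the pair (a, X0) on M0; they may
   live on a different probability space. Measurability is part of prob_space.indep_vars. *)
definition independent_copies ::
  "'b measure \<Rightarrow> (nat \<Rightarrow> 'b \<Rightarrow> real) \<Rightarrow> (nat \<Rightarrow> nat \<Rightarrow> 'b \<Rightarrow> nat)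
     \<Rightarrow> 'a measure \<Rightarrow> ('a \<Rightarrow> real) \<Rightarrow> (nat \<Rightarrow> 'a \<Rightarrow> nat) \<Rightarrow> bool" where
  "independent_copies M A X M0 a X0 \<longleftrightarrow>
     prob_space.indep_vars M (\<lambda>_. pair_path_space) (\<lambda>j \<omega>. (A j \<omega>, \<lambda>k. X j k \<omega>)) {1..} \<and>
     (\<forall>j\<ge>1. distr M pair_path_space (\<lambda>\<omega>. (A j \<omega>, \<lambda>k. X j k \<omega>)) =
             distr M0 pair_path_space (\<lambda>\<omega>. (a \<omega>, \<lambda>k. X0 k \<omega>)))"

definition S_tilde ::
  "'b measure \<Rightarrow> (nat \<Rightarrow> 'b \<Rightarrow> real) \<Rightarrow> (nat \<Rightarrow> nat \<Rightarrow> 'b \<Rightarrow> nat) \<Rightarrow> nat \<Rightarrow> nat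
     \<Rightarrow> real \<Rightarrow> 'b \<Rightarrow> real" where
  "S_tilde M A X N n t \<omega> =
     (\<Sum>j = 1..N. \<Sum>k = 1..nat \<lfloor>real n * t\<rfloor>.
        real (X j k \<omega>) - real_cond_exp M (sigma_rv M (A j)) (\<lambda>\<omega>'. real (X j k \<omega>')) \<omega>)"

(* Weak convergence of the finite-dimensional distributions of the processes Y m on M m to those
   of Z on L. For finite T, bounded continuous functions on R^T are exactly the restrictions of
   bounded continuous functions f on the product space R^R along the embedding that fixes the
   coordinates outside T (here to undefined). *)
definition fdd_converges ::
  "(nat \<Rightarrow> 'a measure) \<Rightarrow> (nat \<Rightarrow> real \<Rightarrow> 'a \<Rightarrow> real) \<Rightarrow> 'b measure \<Rightarrow> (real \<Rightarrow> 'b \<Rightarrow> real) \<Rightarrow> bool" where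
  "fdd_converges M Y L Z \<longleftrightarrow>
     (\<forall>T (f :: (real \<Rightarrow> real) \<Rightarrow> real).
        finite T \<and> T \<subseteq> {0..} \<and> continuous_on UNIV f \<and> bounded (range f) \<longrightarrow>
        (\<lambda>m. \<integral>\<omega>. f (\<lambda>t\<in>T. Y m t \<omega>) \<partial>M m) \<longlonglongrightarrow> (\<integral>\<omega>. f (\<lambda>t\<in>T. Z t \<omega>) \<partial>L))"

definition standard_wiener :: "'a measure \<Rightarrow> (real \<Rightarrow> 'a \<Rightarrow> real) \<Rightarrow> bool" where
  "standard_wiener M B \<longleftrightarrow>
     prob_space M \<and>
     (\<forall>t\<ge>0. B t \<in> borel_measurable M) \<and>
     (AE \<omega> in M. B 0 \<omega> = 0) \<and>
     (AE \<omega> in M. continuous_on {0..} (\<lambda>t. B t \<omega>)) \<and>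
     (\<forall>s t. 0 \<le> s \<and> s < t \<longrightarrow>
        distributed M lborel (\<lambda>\<omega>. B t \<omega> - B s \<omega>) (normal_density 0 (sqrt (t - s)))) \<and>
     (\<forall>(m :: nat) \<tau>. 0 \<le> \<tau> 0 \<and> (\<forall>i<m. \<tau> i \<le> \<tau> (Suc i)) \<longrightarrow>
        prob_space.indep_vars M (\<lambda>_. borel) (\<lambda>i \<omega>. B (\<tau> (Suc i)) \<omega> - B (\<tau> i) \<omega>) {..<m})"

end

theory Submission
  imports Defs "HOL-Real_Asymp.Real_Asymp"
begin

text \<open>
Conditionally on \<open>\<alpha>\<close>, the deviations \<open>Y k = X k - l / (1 - \<alpha>)\<close> of a stationary INAR(1) process have mean zero and
covariances \<open>\<alpha> ^ \<bar>k - j\<bar> * l / (1 - \<alpha>)\<close>. When \<open>\<alpha>\<close> has density \<open>\<psi> x * (1 - x)\<close>, averaging cancels the singular factor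
and leaves the finite autocovariance \<open>r h\<close>, the integral of \<open>l * \<psi> x * x ^ h\<close> over the unit interval.

For fixed \<open>n\<close>, the process is therefore a sum of \<open>N\<close> independent identically distributed processes whose
finite-dimensional distributions have mean zero and finite variance. By the central limit theorem its limit is the
centred Gaussian process of partial sums of a stationary Gaussian sequence with autocovariance \<open>r\<close>, divided by
\<open>sqrt (n * ln n)\<close>. Only second moments of \<open>Y\<close> enter (\<open>deviation_covariance\<close>, \<open>aggregated_char_limit\<close>); the Gaussian
sequence itself is built from independent normal variables by a Cholesky factorisation (\<open>gaussian_sequence_exists\<close>).

For the limit in \<open>n\<close> only covariances have to be followed. Since \<open>x ^ h\<close> concentrates near \<open>1\<close>, where \<open>\<psi>\<close> tends to
\<open>\<psi>1\<close>, one has \<open>h * r h \<longlonglongrightarrow> l * \<psi>1\<close> (\<open>moment_asymptotics\<close>). This decay is at the border of summability, so the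
variance of the sum of the first \<open>m\<close> terms grows like \<open>2 * l * \<psi>1 * m * ln m\<close>, which explains both the normalisation and
the constant. Polarization turns the variances into the covariances \<open>2 * l * \<psi>1 * min s t\<close> of the limit
(\<open>cov_sum_scaled_limit\<close>), and these are the covariances of \<open>sqrt (2 * l * \<psi>1) * B\<close> (\<open>wiener_char\<close>).

Both limits are proved through characteristic functions of linear combinations; that these control the
finite-dimensional distributions is the multidimensional continuity theorem (\<open>fdd_converges_charI\<close>).
\<close>

section \<open>Characteristic functions and finite-dimensional convergence\<close>

lemma iexp_measurable: "f \<in> borel_measurable M \<Longrightarrow> (\<lambda>\<omega>. iexp (f \<omega>)) \<in> borel_measurable M"
  by (rule measurable_compose[where g = iexp and L = borel and N = borel]) simp_all

text \<open>
Products of characters are characters, so these complex linear combinations form an algebra; this is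
what lets Stone-Weierstrass be applied to functions whose expectations are known to converge.
\<close>

inductive_set trig_polys :: "'i set \<Rightarrow> (('i \<Rightarrow> real) \<Rightarrow> complex) set" for T where
  monomial: "(\<lambda>x. c * iexp (\<Sum>t\<in>T. u t * x t)) \<in> trig_polys T"
| add: "p \<in> trig_polys T \<Longrightarrow> q \<in> trig_polys T \<Longrightarrow> (\<lambda>x. p x + q x) \<in> trig_polys T"

lemma trig_polys_mult:
  assumes "p \<in> trig_polys T" "q \<in> trig_polys T"
  shows "(\<lambda>x. p x * q x) \<in> trig_polys T"
  using assms
proof (induction p)
  case (monomial c u)
  from monomial.prems show ?case
  proof (induction q)
    case (monomial c' u')
    have "(\<lambda>x. c * iexp (\<Sum>t\<in>T. u t * x t) * (c' * iexp (\<Sum>t\<in>T. u' t * x t)))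
      = (\<lambda>x. (c * c') * iexp (\<Sum>t\<in>T. (u t + u' t) * x t))"
      by (simp add: fun_eq_iff exp_add[symmetric] algebra_simps sum.distrib)
    then show ?case using trig_polys.monomial[where c = "c * c'" and T = T and u = "\<lambda>t. u t + u' t"] by simp
  next
    case (add p q)
    then show ?case using trig_polys.add[OF add.IH] by (simp add: distrib_left)
  qed
next
  case (add p1 p2)
  then show ?case using trig_polys.add[OF add.IH(1) add.IH(2)] by (simp add: distrib_right)
qed

lemma trig_polys_const: "(\<lambda>_. c) \<in> trig_polys T"
  using trig_polys.monomial[where c = c and T = T and u = "\<lambda>_. 0"] by simp

lemma trig_polys_sin:
  assumes "finite T" "t \<in> T"
  shows "(\<lambda>x. complex_of_real (sin (c * x t))) \<in> trig_polys T"
proof -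
  have *: "(\<Sum>s\<in>T. (if s = t then d else 0) * x s) = d * x t" for d :: real and x
    using assms by (simp add: if_distrib[of "\<lambda>z. z * _"] cong: if_cong)
  have "(\<lambda>x. - \<i> / 2 * iexp (c * x t) + \<i> / 2 * iexp (- c * x t)) \<in> trig_polys T"
    using trig_polys.add[OF trig_polys.monomial[where c = "- \<i> / 2" and T = T and u = "\<lambda>s. if s = t then c else 0"]
      trig_polys.monomial[where c = "\<i> / 2" and T = T and u = "\<lambda>s. if s = t then - c else 0"]]
    unfolding * by simp
  also have "(\<lambda>x. - \<i> / 2 * iexp (c * x t) + \<i> / 2 * iexp (- c * x t)) =
      (\<lambda>x. complex_of_real (sin (c * x t)))"
    by (auto simp: fun_eq_iff sin_of_real[symmetric] sin_exp_eq field_simps)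
  finally show ?thesis .
qed

lemma trig_polys_bounded:
  assumes "p \<in> trig_polys T" shows "\<exists>B. \<forall>x. norm (p x) \<le> B"
  using assms
proof induction
  case (monomial c u) then show ?case by (intro exI[of _ "norm c"]) (simp add: norm_mult)
next
  case (add p q)
  then obtain B C where "\<forall>x. norm (p x) \<le> B" "\<forall>x. norm (q x) \<le> C" by blast
  then show ?case by (intro exI[of _ "B + C"]) (meson add_mono norm_triangle_le)
qed

lemma trig_polys_measurable:
  assumes "p \<in> trig_polys T" "\<And>t. t \<in> T \<Longrightarrow> Y t \<in> borel_measurable M"
  shows "(\<lambda>\<omega>. p (\<lambda>t. Y t \<omega>)) \<in> borel_measurable M"
  using assms
proof induction
  case (monomial c u)
  then have "(\<lambda>\<omega>. \<Sum>t\<in>T. u t * Y t \<omega>) \<in> borel_measurable M" by (intro borel_measurable_sum) auto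
  from measurable_compose[OF this, of "\<lambda>x. c * iexp x" borel] show ?case by simp
next
  case (add p q) then show ?case by (intro borel_measurable_add) auto
qed

lemma trig_polys_integral_tendsto:
  assumes "p \<in> trig_polys T"
    and M: "\<And>m. prob_space (M m)" and L: "prob_space L"
    and Y: "\<And>m t. t \<in> T \<Longrightarrow> Y m t \<in> borel_measurable (M m)"
    and Z: "\<And>t. t \<in> T \<Longrightarrow> Z t \<in> borel_measurable L"
    and char: "\<And>u. (\<lambda>m. \<integral>\<omega>. iexp (\<Sum>t\<in>T. u t * Y m t \<omega>) \<partial>M m) \<longlonglongrightarrow>
                (\<integral>\<omega>. iexp (\<Sum>t\<in>T. u t * Z t \<omega>) \<partial>L)"
  shows "(\<lambda>m. \<integral>\<omega>. p (\<lambda>t. Y m t \<omega>) \<partial>M m) \<longlonglongrightarrow> (\<integral>\<omega>. p (\<lambda>t. Z t \<omega>) \<partial>L)"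
  using assms(1)
proof induction
  case (monomial c u)
  show ?case using tendsto_mult[OF tendsto_const[of c] char[of u]] by simp
next
  case (add p q)
  have int: "integrable N (\<lambda>\<omega>. h (\<lambda>t. V t \<omega>))"
    if h: "h \<in> trig_polys T" and N: "prob_space N" and V: "\<And>t. t \<in> T \<Longrightarrow> V t \<in> borel_measurable N"
    for h V and N :: "'z measure"
  proof -
    interpret prob_space N by fact
    from trig_polys_bounded[OF h] obtain C where "\<forall>x. norm (h x) \<le> C" ..
    then show ?thesis
      by (intro integrable_const_bound[where B=C] trig_polys_measurable[OF h V]) auto
  qed
  show ?case
    using tendsto_add[OF add.IH]
    by (simp add: Bochner_Integration.integral_add[OF int[OF add(1) M Y] int[OF add(2) M Y]]
        Bochner_Integration.integral_add[OF int[OF add(1) L Z] int[OF add(2) L Z]])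
qed

text \<open>
The periodic function that is the identity on \<open>[-R, R]\<close>. Because it factors through \<open>sin\<close>, replacing
every coordinate by its triangle wave turns a continuous function into one that trigonometric polynomials
approximate uniformly on the whole space, not just on a compact set.
\<close>

definition triangle_wave :: "real \<Rightarrow> real \<Rightarrow> real" where
  "triangle_wave R x = 2 * R / pi * arcsin (sin (pi / (2 * R) * x))"

lemma triangle_wave_id:
  assumes "0 < R" "\<bar>x\<bar> \<le> R" shows "triangle_wave R x = x"
proof -
  have "pi / (2 * R) * \<bar>x\<bar> \<le> pi / (2 * R) * R"
    using assms by (intro mult_left_mono) auto
  also have "\<dots> = pi / 2" using assms by simp
  finally have "\<bar>pi / (2 * R) * x\<bar> \<le> pi / 2"
    using assms by (simp only: abs_mult) simp
  then have "arcsin (sin (pi / (2 * R) * x)) = pi / (2 * R) * x"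
    by (intro arcsin_sin) (simp_all only: abs_le_iff, simp_all)
  then show ?thesis using assms by (simp add: triangle_wave_def)
qed

text \<open>
Substituting \<open>x t = (2 R / pi) * arcsin (s t)\<close> reduces the claim to Stone-Weierstrass on the compact cube
\<open>[-1, 1]\<close>, for the algebra of functions that become trigonometric polynomials at \<open>s t = sin (pi x t / (2 R))\<close>.
Numbering the coordinates places the cube in a function type with countable index type, an instance of the Hausdorff
class.
\<close>

lemma trig_poly_approximation:
  fixes f :: "('i \<Rightarrow> real) \<Rightarrow> real"
  assumes "finite T" and f: "continuous_on UNIV f" and "0 < e"
  shows "\<exists>p\<in>trig_polys T. \<forall>x. norm (p x - f (\<lambda>t\<in>T. triangle_wave R (x t))) < e"
proof -
  obtain idx :: "'i \<Rightarrow> nat" where idx: "inj_on idx T"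
    using finite_imp_inj_to_nat_seg[OF \<open>finite T\<close>] by blast
  define K where "K = PiE UNIV (\<lambda>k. if k \<in> idx ` T then {-1..1::real} else {undefined})"
  define S where "S x = (\<lambda>k\<in>idx ` T. sin (pi / (2 * R) * x (inv_into T idx k)))"
    for x :: "'i \<Rightarrow> real"
  have S_eq: "(\<lambda>x. complex_of_real (S x (idx t))) = (\<lambda>x. complex_of_real (sin (pi / (2 * R) * x t)))" if "t \<in> T" for t
    using that idx by (simp add: S_def)
  define \<A> where "\<A> = {h. continuous_on K h \<and> (\<lambda>x. complex_of_real (h (S x))) \<in> trig_polys T}"
  have coord: "(\<lambda>x. x (idx t)) \<in> \<A>" if "t \<in> T" for t
    using that trig_polys_sin[OF assms(1) that, of "pi / (2 * R)"]
    by (simp add: \<A>_def S_eq[OF that] continuous_on_product_then_coordinatewise[OF continuous_on_id])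
  interpret function_ring_on \<A> K
  proof
    have "compactin (product_topology (\<lambda>_. euclidean) UNIV) K"
      unfolding K_def compactin_PiE by auto
    then show "compact K"
      by (simp add: euclidean_product_topology)
  next
    fix h g assume h: "h \<in> \<A>" and g: "g \<in> \<A>"
    show "(\<lambda>x. h x + g x) \<in> \<A>" "(\<lambda>x. h x * g x) \<in> \<A>"
      using h g trig_polys.add[of "\<lambda>x. complex_of_real (h (S x))" T "\<lambda>x. complex_of_real (g (S x))"]
        trig_polys_mult[of "\<lambda>x. complex_of_real (h (S x))" T "\<lambda>x. complex_of_real (g (S x))"]
      by (simp_all add: \<A>_def continuous_on_add continuous_on_mult)
  next
    fix x y assume xy: "x \<in> K" "y \<in> K" "x \<noteq> y"
    then obtain k where k: "x k \<noteq> y k" by auto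
    moreover have "x k = y k" if "k \<notin> idx ` T"
      using that PiE_mem[OF xy(1)[unfolded K_def], of k] PiE_mem[OF xy(2)[unfolded K_def], of k]
      by simp
    ultimately obtain t where "t \<in> T" "k = idx t" by blast
    with k coord show "\<exists>h\<in>\<A>. h x \<noteq> h y" by (intro bexI[of _ "\<lambda>x. x (idx t)"]) auto
  qed (simp_all add: \<A>_def trig_polys_const)
  define g where "g x = f (\<lambda>t\<in>T. 2 * R / pi * arcsin (x (idx t)))" for x
  have "continuous_on K (\<lambda>x. \<lambda>t\<in>T. 2 * R / pi * arcsin (x (idx t)))"
  proof (rule continuous_on_coordinatewise_then_product)
    fix t
    show "continuous_on K (\<lambda>x. (\<lambda>t\<in>T. 2 * R / pi * arcsin (x (idx t))) t)"
    proof (cases "t \<in> T")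
      case True
      then have "x (idx t) \<in> {-1..1}" if "x \<in> K" for x
        using True PiE_mem[OF that[unfolded K_def], of "idx t"] by simp
      then have "continuous_on K (\<lambda>x. arcsin (x (idx t)))"
        by (intro continuous_on_arcsin continuous_on_product_then_coordinatewise[OF continuous_on_id])
          auto
      with True show ?thesis by (auto intro!: continuous_on_mult_left continuous_on_divide)
    qed simp
  qed
  then have "continuous_on K g"
    unfolding g_def by (rule continuous_on_compose2[OF f]) auto
  from Stone_Weierstrass_basic[OF this \<open>0 < e\<close>]
  obtain h where h: "h \<in> \<A>" "\<And>x. x \<in> K \<Longrightarrow> \<bar>g x - h x\<bar> < e" by auto
  show ?thesis
  proof (rule bexI[of _ "\<lambda>x. complex_of_real (h (S x))"], rule allI)
    fix x
    have "S x \<in> K" by (auto simp: S_def K_def PiE_iff)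
    moreover have "g (S x) = f (\<lambda>t\<in>T. triangle_wave R (x t))"
      using idx by (auto simp: g_def S_def triangle_wave_def intro!: arg_cong[of _ _ f])
    ultimately show "norm (complex_of_real (h (S x)) - f (\<lambda>t\<in>T. triangle_wave R (x t))) < e"
      using h(2)[of "S x"]
      by (simp only: of_real_diff[symmetric] norm_of_real) (simp add: abs_minus_commute)
  qed (use h in \<open>simp add: \<A>_def\<close>)
qed


text \<open>
A continuous function on an uncountable product need not be measurable a priori; restricted to finitely many
coordinates it is a pointwise limit of trigonometric polynomials.
\<close>

lemma fdd_integrand_measurable:
  fixes f :: "('i \<Rightarrow> real) \<Rightarrow> real"
  assumes T: "finite T" and f: "continuous_on UNIV f"
    and Y: "\<And>t. t \<in> T \<Longrightarrow> Y t \<in> borel_measurable M"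
  shows "(\<lambda>\<omega>. f (\<lambda>t\<in>T. triangle_wave R (Y t \<omega>))) \<in> borel_measurable M"
    and "(\<lambda>\<omega>. f (\<lambda>t\<in>T. Y t \<omega>)) \<in> borel_measurable M" (is ?second)
proof -
  show *: "(\<lambda>\<omega>. f (\<lambda>t\<in>T. triangle_wave R (Y t \<omega>))) \<in> borel_measurable M" for R
  proof -
    have "\<exists>p\<in>trig_polys T. \<forall>x. norm (p x - f (\<lambda>t\<in>T. triangle_wave R (x t))) < inverse (real (Suc k))"
      for k by (intro trig_poly_approximation[OF T f]) auto
    then have "\<forall>k. \<exists>p. p \<in> trig_polys T \<and>
        (\<forall>x. norm (p x - f (\<lambda>t\<in>T. triangle_wave R (x t))) < inverse (real (Suc k)))" by blast
    from choice[OF this] obtain p where p: "\<And>k. p k \<in> trig_polys T"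
      "\<And>k x. norm (p k x - f (\<lambda>t\<in>T. triangle_wave R (x t))) < inverse (real (Suc k))" by blast
    have "(\<lambda>\<omega>. complex_of_real (f (\<lambda>t\<in>T. triangle_wave R (Y t \<omega>)))) \<in> borel_measurable M"
    proof (rule borel_measurable_LIMSEQ_metric)
      show "(\<lambda>\<omega>. p k (\<lambda>t. Y t \<omega>)) \<in> borel_measurable M" for k
        by (rule trig_polys_measurable[OF p(1) Y])
      show "(\<lambda>k. p k (\<lambda>t. Y t \<omega>)) \<longlonglongrightarrow> complex_of_real (f (\<lambda>t\<in>T. triangle_wave R (Y t \<omega>)))" for \<omega>
        by (rule LIM_zero_cancel, rule Lim_null_comparison[OF _ LIMSEQ_inverse_real_of_nat],
            rule always_eventually, rule allI, rule less_imp_le, rule p(2))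
    qed
    from measurable_compose[OF this, of Re borel] show ?thesis by simp
  qed
  show ?second
  proof (rule borel_measurable_LIMSEQ_metric)
    show "(\<lambda>\<omega>. f (\<lambda>t\<in>T. triangle_wave (real (Suc k)) (Y t \<omega>))) \<in> borel_measurable M" for k
      by (rule *)
    fix \<omega>
    obtain K :: nat where K: "(\<Sum>t\<in>T. \<bar>Y t \<omega>\<bar>) \<le> real K" using real_arch_simple by blast
    have "triangle_wave (real (Suc k)) (Y t \<omega>) = Y t \<omega>" if "k \<ge> K" "t \<in> T" for k t
      using member_le_sum[OF \<open>t \<in> T\<close>, of "\<lambda>t. \<bar>Y t \<omega>\<bar>"] T K that
      by (intro triangle_wave_id) auto
    then have "eventually (\<lambda>k. f (\<lambda>t\<in>T. triangle_wave (real (Suc k)) (Y t \<omega>)) = f (\<lambda>t\<in>T. Y t \<omega>)) sequentially"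
      by (intro eventually_sequentiallyI[of K] arg_cong[of _ _ f] restrict_ext) auto
    then show "(\<lambda>k. f (\<lambda>t\<in>T. triangle_wave (real (Suc k)) (Y t \<omega>))) \<longlonglongrightarrow> f (\<lambda>t\<in>T. Y t \<omega>)"
      by (rule tendsto_eventually)
  qed
qed

text \<open>
A continuous stand-in for the indicator of \<open>{x. R < \<bar>x\<bar>}\<close>, so that one-dimensional weak convergence
controls tails directly.
\<close>

definition tail_ramp :: "real \<Rightarrow> real \<Rightarrow> real" where
  "tail_ramp R x = max 0 (min 1 (\<bar>x\<bar> - R))"

lemma tail_ramp_measurable [measurable]: "tail_ramp R \<in> borel_measurable borel"
  unfolding tail_ramp_def by measurable

lemma tail_ramp_bounds: "0 \<le> tail_ramp R x" "tail_ramp R x \<le> 1" "\<bar>tail_ramp R x\<bar> \<le> 1"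
  by (auto simp: tail_ramp_def)

lemma tail_ramp_isCont: "isCont (tail_ramp R) x"
proof -
  have "continuous_on UNIV (\<lambda>x. max 0 (min 1 (\<bar>x\<bar> - R)))" by (intro continuous_intros)
  then show ?thesis
    by (simp add: tail_ramp_def[abs_def] continuous_on_eq_continuous_at)
qed

lemma tail_ramp_integral_small:
  assumes "prob_space L" and Z: "Z \<in> borel_measurable L" and "0 < e"
  shows "eventually (\<lambda>k. (\<integral>\<omega>. tail_ramp (real k) (Z \<omega>) \<partial>L) < e) sequentially"
proof -
  interpret prob_space L by fact
  have "(\<lambda>k. \<integral>\<omega>. tail_ramp (real k) (Z \<omega>) \<partial>L) \<longlonglongrightarrow> (\<integral>\<omega>. 0 \<partial>L)"
  proof (rule integral_dominated_convergence[where w = "\<lambda>_. 1"])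
    show "AE \<omega> in L. (\<lambda>k. tail_ramp (real k) (Z \<omega>)) \<longlonglongrightarrow> 0"
    proof (rule AE_I2)
      fix \<omega>
      obtain K :: nat where "\<bar>Z \<omega>\<bar> \<le> real K" using real_arch_simple by blast
      then have "eventually (\<lambda>k. tail_ramp (real k) (Z \<omega>) = 0) sequentially"
        by (intro eventually_sequentiallyI[of K]) (auto simp: tail_ramp_def)
      then show "(\<lambda>k. tail_ramp (real k) (Z \<omega>)) \<longlonglongrightarrow> 0" by (rule tendsto_eventually)
    qed
  qed (use Z in \<open>auto simp: tail_ramp_bounds\<close>)
  from order_tendstoD(2)[OF this, of e] show ?thesis using \<open>0 < e\<close> by simp
qed

lemma char_tendsto_imp_tail_ramp_tendsto:
  assumes M: "\<And>m. prob_space (M m)" and L: "prob_space L"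
    and Y: "\<And>m. Y m \<in> borel_measurable (M m)" and Z: "Z \<in> borel_measurable L"
    and char: "\<And>u. (\<lambda>m. \<integral>\<omega>. iexp (u * Y m \<omega>) \<partial>M m) \<longlonglongrightarrow> (\<integral>\<omega>. iexp (u * Z \<omega>) \<partial>L)"
  shows "(\<lambda>m. \<integral>\<omega>. tail_ramp R (Y m \<omega>) \<partial>M m) \<longlonglongrightarrow> (\<integral>\<omega>. tail_ramp R (Z \<omega>) \<partial>L)"
proof -
  have real_distr: "real_distribution (distr N borel V)"
    if "prob_space N" "V \<in> borel_measurable N" for N :: "'z measure" and V
    using that by (rule prob_space.real_distribution_distr)
  have weak: "weak_conv_m (\<lambda>m. distr (M m) borel (Y m)) (distr L borel Z)"
    using char by (intro levy_continuity real_distr M L Y Z)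
      (simp add: char_def integral_distr Y Z)
  have "(\<lambda>m. integral\<^sup>L (distr (M m) borel (Y m)) (tail_ramp R)) \<longlonglongrightarrow>
      integral\<^sup>L (distr L borel Z) (tail_ramp R)"
    by (intro weak_conv_imp_integral_bdd_continuous_conv[where B = 1] real_distr M L Y Z weak)
      (auto simp: tail_ramp_bounds tail_ramp_isCont)
  then show ?thesis by (simp add: integral_distr Y Z)
qed

text \<open>
Levy's continuity theorem in finitely many dimensions. Replacing the coordinates by triangle waves changes the
expectation of \<open>f\<close> by at most a multiple of the tail masses, and those are uniformly small in the limit by the
one-dimensional theorem; for the periodised function, uniform approximation by trigonometric polynomials reduces
the claim to the assumed convergence of characteristic functions.
\<close>

proposition char_tendsto_imp_integral_tendsto:
  fixes f :: "('i \<Rightarrow> real) \<Rightarrow> real"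
  assumes T: "finite T" and f: "continuous_on UNIV f" "bounded (range f)"
    and M: "\<And>m. prob_space (M m)" and L: "prob_space L"
    and Y: "\<And>m t. t \<in> T \<Longrightarrow> Y m t \<in> borel_measurable (M m)"
    and Z: "\<And>t. t \<in> T \<Longrightarrow> Z t \<in> borel_measurable L"
    and char: "\<And>u. (\<lambda>m. \<integral>\<omega>. iexp (\<Sum>t\<in>T. u t * Y m t \<omega>) \<partial>M m) \<longlonglongrightarrow>
                (\<integral>\<omega>. iexp (\<Sum>t\<in>T. u t * Z t \<omega>) \<partial>L)"
  shows "(\<lambda>m. \<integral>\<omega>. f (\<lambda>t\<in>T. Y m t \<omega>) \<partial>M m) \<longlonglongrightarrow> (\<integral>\<omega>. f (\<lambda>t\<in>T. Z t \<omega>) \<partial>L)"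
proof (rule LIMSEQ_I)
  fix r :: real assume "0 < r"
  obtain C where C: "\<And>x. \<bar>f x\<bar> \<le> C" using f(2) by (auto simp: bounded_iff)
  have "0 \<le> C" using C[of undefined] by simp
  \<comment> \<open>With this bound on each tail mass of the limit, the error bound \<open>G\<close> below has a limit of at most \<open>r / 2\<close>.\<close>
  define d where "d = r / (8 * ((C + 1) * (real (card T) + 1)))"
  have "0 < d" using \<open>0 < r\<close> \<open>0 \<le> C\<close> by (simp add: d_def)
  have "eventually (\<lambda>k. \<forall>t\<in>T. (\<integral>\<omega>. tail_ramp (real k) (Z t \<omega>) \<partial>L) < d) sequentially"
    using T tail_ramp_integral_small[OF L Z \<open>0 < d\<close>] by (simp add: eventually_ball_finite)
  then obtain k where k: "\<And>t. t \<in> T \<Longrightarrow> (\<integral>\<omega>. tail_ramp (real k) (Z t \<omega>) \<partial>L) < d"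
    by (auto simp: eventually_sequentially)
  define F where "F x = f (\<lambda>t\<in>T. triangle_wave (real (Suc k)) (x t))" for x
  let ?ramp = "\<lambda>x. \<Sum>t\<in>T. tail_ramp (real k) (x t)"
  have tail: "\<bar>f (\<lambda>t\<in>T. x t) - F x\<bar> \<le> 2 * C * ?ramp x" for x
  proof (cases "\<forall>t\<in>T. \<bar>x t\<bar> \<le> real (Suc k)")
    case True
    then have "F x = f (\<lambda>t\<in>T. x t)"
      unfolding F_def by (intro arg_cong[of _ _ f] restrict_ext triangle_wave_id) auto
    then show ?thesis using \<open>0 \<le> C\<close> by (simp add: sum_nonneg tail_ramp_bounds)
  next
    case False
    then obtain t where t: "t \<in> T" "real (Suc k) < \<bar>x t\<bar>" by auto
    then have "1 = tail_ramp (real k) (x t)" by (simp add: tail_ramp_def)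
    also have "\<dots> \<le> ?ramp x"
      by (rule member_le_sum) (use t T in \<open>auto simp: tail_ramp_bounds\<close>)
    finally have "2 * C * 1 \<le> 2 * C * ?ramp x"
      using \<open>0 \<le> C\<close> by (intro mult_left_mono) auto
    moreover have "\<bar>f (\<lambda>t\<in>T. x t) - F x\<bar> \<le> 2 * C"
      using C[of "\<lambda>t\<in>T. x t"] C[of "\<lambda>t\<in>T. triangle_wave (real (Suc k)) (x t)"]
      by (simp add: F_def)
    ultimately show ?thesis by simp
  qed
  have cut: "\<bar>(\<integral>\<omega>. f (\<lambda>t\<in>T. V t \<omega>) \<partial>N) - (\<integral>\<omega>. F (\<lambda>t. V t \<omega>) \<partial>N)\<bar>
      \<le> 2 * C * (\<Sum>t\<in>T. \<integral>\<omega>. tail_ramp (real k) (V t \<omega>) \<partial>N)"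
    if N: "prob_space N" and V: "\<And>t. t \<in> T \<Longrightarrow> V t \<in> borel_measurable N"
    for N :: "'z measure" and V
  proof -
    interpret prob_space N by fact
    have int: "integrable N (\<lambda>\<omega>. f (\<lambda>t\<in>T. V t \<omega>))" "integrable N (\<lambda>\<omega>. F (\<lambda>t. V t \<omega>))"
      using fdd_integrand_measurable(1)[OF T f(1) V, where R = "real (Suc k)"]
        fdd_integrand_measurable(2)[OF T f(1) V] C
      by (auto simp: F_def intro!: integrable_const_bound[where B = C])
    have int_ramp: "integrable N (\<lambda>\<omega>. tail_ramp (real k) (V t \<omega>))" if "t \<in> T" for t
      using V[OF that] by (intro integrable_const_bound[where B = 1]) (auto simp: tail_ramp_bounds)
    have "\<bar>(\<integral>\<omega>. f (\<lambda>t\<in>T. V t \<omega>) \<partial>N) - (\<integral>\<omega>. F (\<lambda>t. V t \<omega>) \<partial>N)\<bar>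
        = \<bar>\<integral>\<omega>. f (\<lambda>t\<in>T. V t \<omega>) - F (\<lambda>t. V t \<omega>) \<partial>N\<bar>"
      using int by simp
    also have "\<dots> \<le> (\<integral>\<omega>. \<bar>f (\<lambda>t\<in>T. V t \<omega>) - F (\<lambda>t. V t \<omega>)\<bar> \<partial>N)"
      by (rule integral_abs_bound)
    also have "\<dots> \<le> (\<integral>\<omega>. 2 * C * ?ramp (\<lambda>t. V t \<omega>) \<partial>N)"
      using int int_ramp tail[of "\<lambda>t. V t _"] by (intro integral_mono) auto
    also have "\<dots> = 2 * C * (\<Sum>t\<in>T. \<integral>\<omega>. tail_ramp (real k) (V t \<omega>) \<partial>N)"
      using int_ramp by simp
    finally show ?thesis .
  qed
  let ?FY = "\<lambda>m. \<integral>\<omega>. F (\<lambda>t. Y m t \<omega>) \<partial>M m" and ?FZ = "\<integral>\<omega>. F (\<lambda>t. Z t \<omega>) \<partial>L"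
  let ?tailY = "\<lambda>m. \<Sum>t\<in>T. \<integral>\<omega>. tail_ramp (real k) (Y m t \<omega>) \<partial>M m"
  let ?tailZ = "\<Sum>t\<in>T. \<integral>\<omega>. tail_ramp (real k) (Z t \<omega>) \<partial>L"
  have F_lim: "?FY \<longlonglongrightarrow> ?FZ"
  proof (rule LIMSEQ_I)
    fix s :: real assume "0 < s"
    then obtain p where p: "p \<in> trig_polys T" "\<And>x. norm (p x - F x) < s / 3"
      using trig_poly_approximation[OF T f(1), of "s / 3" "real (Suc k)"] by (auto simp: F_def)
    let ?pY = "\<lambda>m. \<integral>\<omega>. p (\<lambda>t. Y m t \<omega>) \<partial>M m" and ?pZ = "\<integral>\<omega>. p (\<lambda>t. Z t \<omega>) \<partial>L"
    have near: "norm ((\<integral>\<omega>. p (\<lambda>t. V t \<omega>) \<partial>N) - complex_of_real (\<integral>\<omega>. F (\<lambda>t. V t \<omega>) \<partial>N)) \<le> s / 3"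
      if N: "prob_space N" and V: "\<And>t. t \<in> T \<Longrightarrow> V t \<in> borel_measurable N"
      for N :: "'z measure" and V
    proof -
      interpret prob_space N by fact
      have meas: "(\<lambda>\<omega>. F (\<lambda>t. V t \<omega>)) \<in> borel_measurable N"
        using fdd_integrand_measurable(1)[OF T f(1) V] by (simp add: F_def)
      obtain D where D: "\<forall>x. norm (p x) \<le> D" using trig_polys_bounded[OF p(1)] by blast
      have int: "integrable N (\<lambda>\<omega>. p (\<lambda>t. V t \<omega>))"
        using D trig_polys_measurable[OF p(1) V] by (intro integrable_const_bound[where B = D]) auto
      have int': "integrable N (\<lambda>\<omega>. complex_of_real (F (\<lambda>t. V t \<omega>)))"
        using C meas by (intro integrable_const_bound[where B = C]) (auto simp: F_def)
      have "norm ((\<integral>\<omega>. p (\<lambda>t. V t \<omega>) \<partial>N) - complex_of_real (\<integral>\<omega>. F (\<lambda>t. V t \<omega>) \<partial>N))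
        = norm (\<integral>\<omega>. p (\<lambda>t. V t \<omega>) - complex_of_real (F (\<lambda>t. V t \<omega>)) \<partial>N)"
        using int int' by (subst Bochner_Integration.integral_diff) auto
      also have "\<dots> \<le> (\<integral>\<omega>. norm (p (\<lambda>t. V t \<omega>) - complex_of_real (F (\<lambda>t. V t \<omega>))) \<partial>N)"
        by (rule integral_norm_bound)
      also have "\<dots> \<le> (\<integral>\<omega>. s / 3 \<partial>N)"
        using int int' less_imp_le[OF p(2)] by (intro integral_mono) auto
      finally show ?thesis by (simp add: prob_space)
    qed
    have "?pY \<longlonglongrightarrow> ?pZ"
      by (rule trig_polys_integral_tendsto[OF p(1) M L Y Z char])
    from LIMSEQ_D[OF this, of "s / 3"] \<open>0 < s\<close> obtain m0 where m0:
      "\<And>m. m \<ge> m0 \<Longrightarrow> norm (?pY m - ?pZ) < s / 3"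
      by auto
    have triangle: "norm (a - b) \<le> norm (x - a) + norm (x - y) + norm (y - b)" for a b x y :: complex
      by norm
    show "\<exists>m0. \<forall>m\<ge>m0. norm (?FY m - ?FZ) < s"
    proof (intro exI[of _ m0] allI impI)
      fix m assume "m0 \<le> m"
      have "norm (complex_of_real (?FY m) - complex_of_real ?FZ) < s"
        using near[of "M m" "Y m", OF M Y] near[of L Z, OF L Z] m0[OF \<open>m0 \<le> m\<close>]
          triangle[of "complex_of_real (?FY m)" "complex_of_real ?FZ"
            "?pY m" "?pZ"] by linarith
      then show "norm (?FY m - ?FZ) < s"
        by (simp only: of_real_diff[symmetric] norm_of_real real_norm_def)
    qed
  qed
  have ramp_lim: "(\<lambda>m. \<integral>\<omega>. tail_ramp (real k) (Y m t \<omega>) \<partial>M m) \<longlonglongrightarrow> (\<integral>\<omega>. tail_ramp (real k) (Z t \<omega>) \<partial>L)"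
    if "t \<in> T" for t
  proof (rule char_tendsto_imp_tail_ramp_tendsto[OF M L Y[OF that] Z[OF that]])
    fix u
    have *: "(\<Sum>s\<in>T. (if s = t then u else 0) * x s) = u * x t" for x :: "_ \<Rightarrow> real"
      using T that by (simp add: if_distrib[of "\<lambda>z. z * _"] cong: if_cong)
    show "(\<lambda>m. \<integral>\<omega>. iexp (u * Y m t \<omega>) \<partial>M m) \<longlonglongrightarrow> (\<integral>\<omega>. iexp (u * Z t \<omega>) \<partial>L)"
      using char[of "\<lambda>s. if s = t then u else 0"] unfolding * .
  qed
  define G where "G m = \<bar>?FY m - ?FZ\<bar>
      + 2 * C * ?tailY m
      + 2 * C * ?tailZ" for m
  have "G \<longlonglongrightarrow> \<bar>?FZ - ?FZ\<bar>
      + 2 * C * ?tailZ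
      + 2 * C * ?tailZ"
    unfolding G_def by (intro tendsto_intros F_lim ramp_lim)
  moreover have "?tailZ \<le> real (card T) * d"
    using less_imp_le[OF k] by (intro sum_bounded_above) auto
  then have "4 * C * ?tailZ \<le> 4 * C * (real (card T) * d)"
    using \<open>0 \<le> C\<close> by (intro mult_left_mono) auto
  moreover have "4 * C * (real (card T) * d) < r"
  proof -
    have "C * real (card T) \<le> (C + 1) * (real (card T) + 1)"
      using \<open>0 \<le> C\<close> by (intro mult_mono) auto
    then have "4 * (C * real (card T)) * d \<le> 4 * ((C + 1) * (real (card T) + 1)) * d"
      using \<open>0 < d\<close> by (intro mult_right_mono mult_left_mono) auto
    also have "\<dots> = r / 2"
    proof -
      have "4 * D * (r / (8 * D)) = r / 2" if "D \<noteq> 0" for D :: real using that by simp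
      from this[of "(C + 1) * (real (card T) + 1)"] show ?thesis
        using \<open>0 \<le> C\<close> unfolding d_def by (simp add: add_nonneg_eq_0_iff)
    qed
    finally show ?thesis using \<open>0 < r\<close> by (simp add: mult_ac)
  qed
  ultimately have "eventually (\<lambda>m. G m < r) sequentially"
    by (elim order_tendstoD(2)) simp
  then obtain m0 where m0: "\<And>m. m \<ge> m0 \<Longrightarrow> G m < r" by (auto simp: eventually_sequentially)
  show "\<exists>m0. \<forall>m\<ge>m0. norm ((\<integral>\<omega>. f (\<lambda>t\<in>T. Y m t \<omega>) \<partial>M m) - (\<integral>\<omega>. f (\<lambda>t\<in>T. Z t \<omega>) \<partial>L)) < r"
  proof (intro exI[of _ m0] allI impI)
    fix m assume "m0 \<le> m"
    with m0 have "G m < r" by blast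
    with cut[of "M m" "Y m", OF M Y] cut[of L Z, OF L Z]
    show "norm ((\<integral>\<omega>. f (\<lambda>t\<in>T. Y m t \<omega>) \<partial>M m) - (\<integral>\<omega>. f (\<lambda>t\<in>T. Z t \<omega>) \<partial>L)) < r"
      unfolding G_def real_norm_def by linarith
  qed
qed

corollary fdd_converges_charI:
  assumes M: "\<And>m. prob_space (M m)" and L: "prob_space L"
    and Y: "\<And>m t. 0 \<le> t \<Longrightarrow> Y m t \<in> borel_measurable (M m)"
    and Z: "\<And>t. 0 \<le> t \<Longrightarrow> Z t \<in> borel_measurable L"
    and char: "\<And>T u. finite T \<Longrightarrow> T \<subseteq> {0..} \<Longrightarrow>
        (\<lambda>m. \<integral>\<omega>. iexp (\<Sum>t\<in>T. u t * Y m t \<omega>) \<partial>M m) \<longlonglongrightarrow>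
          (\<integral>\<omega>. iexp (\<Sum>t\<in>T. u t * Z t \<omega>) \<partial>L)"
  shows "fdd_converges M Y L Z"
  unfolding fdd_converges_def
proof (intro allI impI, elim conjE)
  fix T :: "real set" and f :: "(real \<Rightarrow> real) \<Rightarrow> real"
  assume T: "finite T" "T \<subseteq> {0..}" and f: "continuous_on UNIV f" "bounded (range f)"
  show "(\<lambda>m. \<integral>\<omega>. f (\<lambda>t\<in>T. Y m t \<omega>) \<partial>M m) \<longlonglongrightarrow> (\<integral>\<omega>. f (\<lambda>t\<in>T. Z t \<omega>) \<partial>L)"
    using T by (intro char_tendsto_imp_integral_tendsto f M L Y Z char) auto
qed

section \<open>Gaussian sequences and the Wiener process\<close>

lemma char_indep_normal_sum:
  assumes "prob_space M" and "finite I"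
    and indep: "prob_space.indep_vars M (\<lambda>_. borel) X I"
    and normal: "\<And>i. i \<in> I \<Longrightarrow> distributed M lborel (X i) (normal_density 0 (\<sigma> i))"
    and pos: "\<And>i. i \<in> I \<Longrightarrow> 0 < \<sigma> i"
  shows "(\<integral>\<omega>. iexp (\<Sum>i\<in>I. v i * X i \<omega>) \<partial>M) =
    complex_of_real (exp (- (\<Sum>i\<in>I. (v i)\<^sup>2 * (\<sigma> i)\<^sup>2) / 2))"
proof -
  interpret prob_space M by fact
  have rv: "X i \<in> borel_measurable M" if "i \<in> I" for i
    using indep that by (auto simp: indep_vars_def)
  have char_one: "(\<integral>\<omega>. iexp (u * X i \<omega>) \<partial>M) = complex_of_real (exp (- (u\<^sup>2 * (\<sigma> i)\<^sup>2) / 2))"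
    if i: "i \<in> I" for i u
  proof -
    have "distributed M lborel (\<lambda>\<omega>. (X i \<omega> - 0) / \<sigma> i) std_normal_density"
      using normal_standard_normal_convert[OF pos[OF i], of "X i" 0] normal[OF i] by simp
    from distributed_distr_eq_density[OF this]
    have std: "distr M borel (\<lambda>\<omega>. X i \<omega> / \<sigma> i) = std_normal_distribution"
      using distr_cong[of M M borel lborel "\<lambda>\<omega>. X i \<omega> / \<sigma> i"] by simp
    have "(\<integral>\<omega>. iexp (u * X i \<omega>) \<partial>M) = char (distr M borel (\<lambda>\<omega>. X i \<omega> / \<sigma> i)) (u * \<sigma> i)"
      using rv[OF i] pos[OF i] by (simp add: char_def integral_distr)
    also have "\<dots> = complex_of_real (exp (- (u\<^sup>2 * (\<sigma> i)\<^sup>2) / 2))"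
      by (simp add: std char_std_normal_distribution power_mult_distrib)
    finally show ?thesis .
  qed
  have "indep_vars (\<lambda>_. borel) (\<lambda>i \<omega>. v i * X i \<omega>) I"
    by (rule indep_vars_compose2[OF indep, where Y = "\<lambda>i x. v i * x"]) auto
  from char_distr_sum[OF this, of 1]
  have "(\<integral>\<omega>. iexp (\<Sum>i\<in>I. v i * X i \<omega>) \<partial>M) = (\<Prod>i\<in>I. \<integral>\<omega>. iexp (v i * X i \<omega>) \<partial>M)"
    using rv by (simp add: char_def integral_distr cong: prod.cong)
  also have "\<dots> = (\<Prod>i\<in>I. complex_of_real (exp (- ((v i)\<^sup>2 * (\<sigma> i)\<^sup>2) / 2)))"
    by (intro prod.cong refl char_one)
  also have "\<dots> = complex_of_real (exp (- (\<Sum>i\<in>I. (v i)\<^sup>2 * (\<sigma> i)\<^sup>2) / 2))"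
    using \<open>finite I\<close> by (simp add: of_real_prod[symmetric] exp_sum[symmetric] sum_negf sum_divide_distrib del: of_real_prod)
  finally show ?thesis .
qed

definition pos_semidef :: "(nat \<Rightarrow> nat \<Rightarrow> real) \<Rightarrow> bool" where
  "pos_semidef r \<longleftrightarrow> (\<forall>k l. r k l = r l k) \<and>
     (\<forall>m v. 0 \<le> (\<Sum>k<m. \<Sum>l<m. v k * v l * r k l))"

text \<open>
One elimination step of the Cholesky algorithm. If the pivot \<open>r i i\<close> vanishes, division by zero makes the
correction vanish too, which is right because then the whole row is zero by positive semidefiniteness.
\<close>

definition schur :: "nat \<Rightarrow> (nat \<Rightarrow> nat \<Rightarrow> real) \<Rightarrow> nat \<Rightarrow> nat \<Rightarrow> real" where
  "schur i r k l = r k l - r k i * r l i / r i i"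

text \<open>
The quadratic form at \<open>v + s * e_i\<close>, as a quadratic polynomial in \<open>s\<close>.
\<close>

lemma pos_semidef_shift:
  assumes "pos_semidef r" "i < m"
  shows "0 \<le> (\<Sum>k<m. \<Sum>l<m. v k * v l * r k l) + 2 * s * (\<Sum>k<m. v k * r k i) + s\<^sup>2 * r i i"
proof -
  have sym: "r k l = r l k" for k l using assms by (simp add: pos_semidef_def)
  let ?d = "\<lambda>k. if k = i then s else 0"
  have "0 \<le> (\<Sum>k<m. \<Sum>l<m. (v k + ?d k) * (v l + ?d l) * r k l)"
    using assms by (simp add: pos_semidef_def)
  also have "\<dots> = (\<Sum>k<m. \<Sum>l<m. v k * v l * r k l) + (\<Sum>k<m. \<Sum>l<m. ?d l * (v k * r k l))
      + (\<Sum>k<m. ?d k * (\<Sum>l<m. v l * r k l)) + (\<Sum>k<m. ?d k * (\<Sum>l<m. ?d l * r k l))"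
    by (simp add: sum.distrib[symmetric] sum_distrib_left algebra_simps)
  also have "(\<Sum>k<m. \<Sum>l<m. ?d l * (v k * r k l)) = s * (\<Sum>k<m. v k * r k i)"
    using assms(2) by (simp add: sum_distrib_left if_distrib[of "\<lambda>z. z * _"] cong: if_cong)
  also have "(\<Sum>k<m. ?d k * (\<Sum>l<m. v l * r k l)) = s * (\<Sum>k<m. v k * r k i)"
    using assms(2) sym[of i] by (simp add: if_distrib[of "\<lambda>z. z * _"] cong: if_cong)
  also have "(\<Sum>k<m. ?d k * (\<Sum>l<m. ?d l * r k l)) = s\<^sup>2 * r i i"
    using assms(2) by (simp add: power2_eq_square if_distrib[of "\<lambda>z. z * _"] cong: if_cong)
  finally show ?thesis by (simp add: algebra_simps)
qed

lemma pos_semidef_diag: assumes "pos_semidef r" shows "0 \<le> r i i"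
  using pos_semidef_shift[OF assms, of i "Suc i" "\<lambda>_. 0" 1] by simp

lemma pos_semidef_zero_diag:
  assumes "pos_semidef r" "r i i = 0" shows "r k i = 0"
proof (rule ccontr)
  assume nz: "r k i \<noteq> 0"
  let ?v = "\<lambda>j. if j = k then 1 else 0 :: real"
  obtain m where m: "i < m" "k < m" by (meson lessI less_Suc_eq_le max.bounded_iff order_refl)
  have q: "(\<Sum>a<m. \<Sum>b<m. ?v a * ?v b * r a b) = r k k"
  proof -
    have "(\<Sum>b<m. ?v a * ?v b * r a b) = (if a = k then r k k else 0)" for a
      using m by (cases "a = k") (simp_all add: if_distrib[of "\<lambda>z. z * _"] cong: if_cong)
    then show ?thesis using m by simp
  qed
  have l: "(\<Sum>a<m. ?v a * r a i) = r k i"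
    using m by (simp add: if_distrib[of "\<lambda>z. z * _"] cong: if_cong)
  \<comment> \<open>The shift is chosen so that the form, which is affine in it because \<open>r i i = 0\<close>, takes the value -1.\<close>
  have "0 \<le> r k k + 2 * (- (r k k + 1) / (2 * r k i)) * r k i"
    using pos_semidef_shift[OF assms(1) m(1), of ?v "- (r k k + 1) / (2 * r k i)"] assms(2)
    by (simp only: q l)
  also have "\<dots> = -1" using nz by (simp add: field_simps)
  finally show False by simp
qed

text \<open>
Minimising the quadratic form over the \<open>i\<close>-th coordinate gives exactly the form of the Schur complement.
\<close>

lemma pos_semidef_schur:
  assumes "pos_semidef r" shows "pos_semidef (schur i r)"
  unfolding pos_semidef_def
proof (intro conjI allI)
  show "schur i r k l = schur i r l k" for k l
    using assms by (simp add: schur_def pos_semidef_def mult.commute)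
next
  fix m :: nat and v :: "nat \<Rightarrow> real"
  \<comment> \<open>The vector is padded by zeros so that the index \<open>i\<close> lies in its range.\<close>
  define w where "w k = (if k < m then v k else 0)" for k
  define n where "n = Suc (max i m)"
  have "i < n" by (simp add: n_def)
  have w: "(\<Sum>k<n. w k * g k) = (\<Sum>k<m. v k * g k)" for g
    by (rule sum.mono_neutral_cong_right) (auto simp: w_def n_def)
  have ww: "(\<Sum>k<n. \<Sum>l<n. w k * w l * g k l) = (\<Sum>k<m. \<Sum>l<m. v k * v l * g k l)" for g
    using w[of "\<lambda>k. \<Sum>l<n. w l * g k l"] by (simp add: w sum_distrib_left[symmetric] mult.assoc)
  let ?S = "\<Sum>k<n. w k * r k i"
  have "(\<Sum>k<m. \<Sum>l<m. v k * v l * schur i r k l) = (\<Sum>k<n. \<Sum>l<n. w k * w l * schur i r k l)"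
    by (simp add: ww)
  also have "\<dots> = (\<Sum>k<n. \<Sum>l<n. w k * w l * r k l) - ?S * ?S / r i i"
    by (simp add: schur_def sum_product sum_divide_distrib sum_subtractf[symmetric] algebra_simps)
  also have "0 \<le> \<dots>"
  proof (cases "r i i = 0")
    case True
    then show ?thesis using assms by (simp add: pos_semidef_def)
  next
    case False
    show ?thesis
    proof -
      have *: "2 * (- S / q) * S + (- S / q)\<^sup>2 * q = - (S * S / q)" if "q \<noteq> 0" for S q :: real
        using that by (simp add: power2_eq_square field_simps)
      show ?thesis
        using pos_semidef_shift[OF assms, of i n w "- ?S / r i i"] *[OF False, of ?S] \<open>i < n\<close>
        by linarith
    qed
  qed
  finally show "0 \<le> (\<Sum>k<m. \<Sum>l<m. v k * v l * schur i r k l)" .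
qed

fun schur_iter :: "(nat \<Rightarrow> nat \<Rightarrow> real) \<Rightarrow> nat \<Rightarrow> nat \<Rightarrow> nat \<Rightarrow> real" where
  "schur_iter r 0 = r"
| "schur_iter r (Suc i) = schur i (schur_iter r i)"

lemma pos_semidef_schur_iter: "pos_semidef r \<Longrightarrow> pos_semidef (schur_iter r i)"
  by (induction i) (auto intro: pos_semidef_schur)

lemma schur_iter_zero:
  assumes "pos_semidef r" "k < i" shows "schur_iter r i k l = 0"
  using assms(2)
proof (induction i arbitrary: k l)
  case (Suc i)
  let ?q = "schur_iter r i"
  have psd: "pos_semidef ?q" using assms(1) by (rule pos_semidef_schur_iter)
  then have sym: "?q a b = ?q b a" for a b by (simp add: pos_semidef_def)
  show ?case
  proof (cases "k = i")
    case True
    then show ?thesis using pos_semidef_zero_diag[OF psd, of i l] sym[of i l]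
      by (cases "?q i i = 0") (auto simp: schur_def)
  next
    case False
    then have "k < i" using Suc.prems by simp
    then show ?thesis by (simp add: schur_def Suc.IH)
  qed
qed simp

text \<open>
After \<open>k + 1\<close> elimination steps the \<open>k\<close>-th row is exhausted, and the corrections subtracted so far add up to
\<open>r k l\<close>. The factor is lower triangular and does not depend on how many rows are considered, which makes a
single factorisation serve the infinite matrix.
\<close>

proposition cholesky:
  assumes "pos_semidef r"
  shows "\<exists>c :: nat \<Rightarrow> nat \<Rightarrow> real. (\<forall>k i. k < i \<longrightarrow> c k i = 0) \<and>
    (\<forall>m k l. k < m \<longrightarrow> r k l = (\<Sum>i<m. c k i * c l i))"
proof -
  define c where "c k i = schur_iter r i k i / sqrt (schur_iter r i i i)" for k i
  have cc: "c k i * c l i = schur_iter r i k i * schur_iter r i l i / schur_iter r i i i" for k l i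
    using pos_semidef_diag[OF pos_semidef_schur_iter[OF assms, of i], of i] by (simp add: c_def)
  have *: "r k l = (\<Sum>i<m. c k i * c l i) + schur_iter r m k l" for k l m
    by (induction m) (simp_all add: cc schur_def)
  have "r k l = (\<Sum>i<m. c k i * c l i)" if "k < m" for k l m
    using *[of k l m] schur_iter_zero[OF assms that, of l] by simp
  moreover have "c k i = 0" if "k < i" for k i
    using schur_iter_zero[OF assms that] by (simp add: c_def)
  ultimately show ?thesis by blast
qed

text \<open>
Applying the Cholesky factor to independent standard normal variables.
\<close>

proposition gaussian_sequence_exists:
  assumes "pos_semidef r"
  shows "\<exists>(P :: (nat \<Rightarrow> real) measure) G. prob_space P \<and> (\<forall>k. G k \<in> borel_measurable P) \<and>
    (\<forall>m v. (\<integral>\<omega>. iexp (\<Sum>k<m. v k * G k \<omega>) \<partial>P) =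
       complex_of_real (exp (- (\<Sum>k<m. \<Sum>l<m. v k * v l * r k l) / 2)))"
proof -
  obtain c where c0: "\<And>k i. k < i \<Longrightarrow> c k i = 0"
    and c: "\<And>m k l. k < m \<Longrightarrow> r k l = (\<Sum>i<m. c k i * c l i)"
    using cholesky[OF assms] by blast
  define P :: "(nat \<Rightarrow> real) measure" where "P = PiM UNIV (\<lambda>_. std_normal_distribution)"
  define G where "G k \<omega> = (\<Sum>i<Suc k. c k i * \<omega> i)" for k and \<omega> :: "nat \<Rightarrow> real"
  interpret N: prob_space std_normal_distribution
    by (rule prob_space_normal_density) simp
  interpret P: product_prob_space "\<lambda>_. std_normal_distribution" UNIV ..
  have prob: "prob_space P" unfolding P_def by (rule P.prob_space_axioms)
  have comp [measurable]: "(\<lambda>\<omega>. \<omega> i) \<in> borel_measurable P" for i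
    unfolding P_def by measurable
  have distr_comp: "distr P borel (\<lambda>\<omega>. \<omega> i) = std_normal_distribution" for i
    using P.PiM_component[of i] unfolding P_def
    by (simp cong: distr_cong)
  have "prob_space.indep_vars P (\<lambda>_. borel) (\<lambda>i \<omega>. \<omega> i) UNIV"
  proof (subst prob_space.indep_vars_iff_distr_eq_PiM[OF prob])
    have "distr P (PiM UNIV (\<lambda>_. borel)) (\<lambda>x. x) = P"
      unfolding P_def by (intro distr_id2 sets_PiM_cong) simp_all
    then show "distr P (PiM UNIV (\<lambda>_. borel)) (\<lambda>x. \<lambda>i\<in>UNIV. x i) =
        PiM UNIV (\<lambda>i. distr P borel (\<lambda>\<omega>. \<omega> i))"
      by (simp add: distr_comp restrict_def) (simp add: P_def)
  qed auto
  then have indep: "prob_space.indep_vars P (\<lambda>_. borel) (\<lambda>i \<omega>. \<omega> i) I" for I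
    by (rule prob_space.indep_vars_subset[OF prob]) auto
  have normal: "distributed P lborel (\<lambda>\<omega>. \<omega> i) std_normal_density" for i
    using distr_comp[of i] distr_cong[of P P borel lborel "\<lambda>\<omega>. \<omega> i"]
    by (auto simp: distributed_def)
  have "(\<integral>\<omega>. iexp (\<Sum>k<m. v k * G k \<omega>) \<partial>P) =
       complex_of_real (exp (- (\<Sum>k<m. \<Sum>l<m. v k * v l * r k l) / 2))" for m v
  proof -
    have G: "G k \<omega> = (\<Sum>i<m. c k i * \<omega> i)" if "k < m" for k \<omega>
      unfolding G_def using that by (intro sum.mono_neutral_left) (auto simp: c0)
    have "(\<Sum>k<m. v k * G k \<omega>) = (\<Sum>i<m. (\<Sum>k<m. v k * c k i) * \<omega> i)" for \<omega>
      by (simp add: G sum_distrib_left sum_distrib_right mult.assoc) (rule sum.swap)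
    then have "(\<integral>\<omega>. iexp (\<Sum>k<m. v k * G k \<omega>) \<partial>P) =
      complex_of_real (exp (- (\<Sum>i<m. (\<Sum>k<m. v k * c k i)\<^sup>2 * 1\<^sup>2) / 2))"
      using char_indep_normal_sum[OF prob _ indep, of "{..<m}" "\<lambda>_. 1" "\<lambda>i. \<Sum>k<m. v k * c k i"] normal
      by simp
    also have "(\<Sum>i<m. (\<Sum>k<m. v k * c k i)\<^sup>2 * 1\<^sup>2) = (\<Sum>i<m. \<Sum>k<m. \<Sum>l<m. v k * v l * (c k i * c l i))"
      by (simp add: power2_eq_square sum_product mult_ac)
    also have "\<dots> = (\<Sum>k<m. \<Sum>l<m. \<Sum>i<m. v k * v l * (c k i * c l i))"
      by (subst sum.swap, intro sum.cong refl sum.swap)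
    also have "\<dots> = (\<Sum>k<m. \<Sum>l<m. v k * v l * r k l)"
      by (intro sum.cong refl) (simp add: c[of _ m] sum_distrib_left)
    finally show ?thesis .
  qed
  moreover have "G k \<in> borel_measurable P" for k unfolding G_def by measurable
  ultimately show ?thesis using prob by blast
qed

text \<open>
Both \<open>B t\<close> and \<open>min s t\<close> telescope over the increments between consecutive points of \<open>T\<close> together with \<open>0\<close>:
an increment contributes to time \<open>t\<close> exactly if its right endpoint is at most \<open>t\<close>.
\<close>

proposition wiener_char:
  assumes W: "standard_wiener W B" and T: "finite T" "T \<subseteq> {0..}"
  shows "(\<integral>\<omega>. iexp (\<Sum>t\<in>T. u t * B t \<omega>) \<partial>W) =
    complex_of_real (exp (- (\<Sum>s\<in>T. \<Sum>t\<in>T. u s * u t * min s t) / 2))"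
proof -
  interpret prob_space W using W by (simp add: standard_wiener_def)
  define xs where "xs = sorted_list_of_set (insert 0 T)"
  define \<tau> where "\<tau> i = xs ! i" for i
  define m where "m = length xs - 1"
  have set_xs: "set xs = insert 0 T" unfolding xs_def using T(1) by (intro set_sorted_list_of_set) simp
  then have "xs \<noteq> []" by auto
  then have len: "length xs = Suc m" by (simp add: m_def)
  have "sorted_wrt (<) xs" unfolding xs_def by simp
  then have mono: "\<tau> i < \<tau> j" if "i < j" "j \<le> m" for i j
    using that len by (simp add: \<tau>_def sorted_wrt_nth_less)
  have \<tau>_le_iff: "\<tau> i \<le> \<tau> j \<longleftrightarrow> i \<le> j" if "i \<le> m" "j \<le> m" for i j
    using mono[of i j] mono[of j i] that by (cases i j rule: linorder_cases) auto
  have \<tau>_nonneg: "0 \<le> \<tau> i" if "i \<le> m" for i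
    using nth_mem[of i xs] that len set_xs T(2) by (auto simp: \<tau>_def)
  have ex_index: "\<exists>j\<le>m. t = \<tau> j" if "t \<in> insert 0 T" for t
  proof -
    from that have "t \<in> set xs" by (simp only: set_xs)
    then obtain j where "j < length xs" "xs ! j = t" by (auto simp: in_set_conv_nth)
    then show ?thesis using len by (auto simp: \<tau>_def intro!: exI[of _ j])
  qed
  obtain i0 where "i0 \<le> m" "\<tau> i0 = 0" using ex_index[of 0] by auto
  with mono[of 0 i0] \<tau>_nonneg[of 0] have \<tau>_0: "\<tau> 0 = 0" by (cases "i0 = 0") auto
  have telescope: "(\<Sum>i<m. of_bool (\<tau> (Suc i) \<le> t) * (g (\<tau> (Suc i)) - g (\<tau> i))) = g t - g 0"
    if "t \<in> T" for t and g :: "real \<Rightarrow> real"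
  proof -
    from ex_index[OF insertI2[OF that]] obtain j where "j \<le> m \<and> t = \<tau> j" ..
    then have j: "j \<le> m" "t = \<tau> j" by simp_all
    have "(\<Sum>i<m. of_bool (\<tau> (Suc i) \<le> t) * (g (\<tau> (Suc i)) - g (\<tau> i))) =
        (\<Sum>i<j. g (\<tau> (Suc i)) - g (\<tau> i))"
    proof (rule sum.mono_neutral_cong_right)
      show "\<forall>i\<in>{..<m} - {..<j}. of_bool (\<tau> (Suc i) \<le> t) * (g (\<tau> (Suc i)) - g (\<tau> i)) = 0"
        using j \<tau>_le_iff[OF _ j(1)] by simp
      show "of_bool (\<tau> (Suc i) \<le> t) * (g (\<tau> (Suc i)) - g (\<tau> i)) = g (\<tau> (Suc i)) - g (\<tau> i)"
        if "i \<in> {..<j}" for i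
        using that j \<tau>_le_iff[OF _ j(1), of "Suc i"] by simp
    qed (use j in simp_all)
    also have "\<dots> = g (\<tau> j) - g (\<tau> 0)" by (rule sum_lessThan_telescope)
    also have "\<dots> = g t - g 0" by (simp only: j \<tau>_0)
    finally show ?thesis .
  qed
  define I where "I i \<omega> = B (\<tau> (Suc i)) \<omega> - B (\<tau> i) \<omega>" for i \<omega>
  define v where "v i = (\<Sum>t\<in>T. u t * of_bool (\<tau> (Suc i) \<le> t))" for i
  have meas [measurable]: "B t \<in> borel_measurable W" if "0 \<le> t" for t
    using W that by (simp add: standard_wiener_def)
  have meas_sum: "(\<lambda>\<omega>. \<Sum>t\<in>T. u t * B t \<omega>) \<in> borel_measurable W"
    using T(2) by (intro borel_measurable_sum borel_measurable_times borel_measurable_const meas) auto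
  have meas_I: "(\<lambda>\<omega>. \<Sum>i<m. v i * I i \<omega>) \<in> borel_measurable W"
    unfolding I_def
    by (intro borel_measurable_sum borel_measurable_times borel_measurable_const
        borel_measurable_diff meas \<tau>_nonneg) auto
  have "AE \<omega> in W. B 0 \<omega> = 0" using W by (simp add: standard_wiener_def)
  then have ae: "AE \<omega> in W. (\<Sum>t\<in>T. u t * B t \<omega>) = (\<Sum>i<m. v i * I i \<omega>)"
  proof (rule AE_mp, intro AE_I2 impI)
    fix \<omega> assume "B 0 \<omega> = 0"
    then have "(\<Sum>t\<in>T. u t * B t \<omega>) = (\<Sum>t\<in>T. u t * (\<Sum>i<m. of_bool (\<tau> (Suc i) \<le> t) * I i \<omega>))"
      unfolding I_def using telescope[of _ "\<lambda>t. B t \<omega>"] by (intro sum.cong refl) simp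
    also have "\<dots> = (\<Sum>i<m. v i * I i \<omega>)"
      by (simp only: v_def sum_distrib_left sum_distrib_right mult.assoc) (rule sum.swap)
    finally show "(\<Sum>t\<in>T. u t * B t \<omega>) = (\<Sum>i<m. v i * I i \<omega>)" .
  qed
  have "(\<integral>\<omega>. iexp (\<Sum>t\<in>T. u t * B t \<omega>) \<partial>W) = (\<integral>\<omega>. iexp (\<Sum>i<m. v i * I i \<omega>) \<partial>W)"
  proof (rule integral_cong_AE)
    show "(\<lambda>\<omega>. iexp (\<Sum>t\<in>T. u t * B t \<omega>)) \<in> borel_measurable W"
      by (rule iexp_measurable[OF meas_sum])
    show "(\<lambda>\<omega>. iexp (\<Sum>i<m. v i * I i \<omega>)) \<in> borel_measurable W"
      by (rule iexp_measurable[OF meas_I])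
    show "AE \<omega> in W. iexp (\<Sum>t\<in>T. u t * B t \<omega>) = iexp (\<Sum>i<m. v i * I i \<omega>)"
      using ae by eventually_elim simp
  qed
  also have "\<dots> = complex_of_real (exp (- (\<Sum>i<m. (v i)\<^sup>2 * (sqrt (\<tau> (Suc i) - \<tau> i))\<^sup>2) / 2))"
  proof (rule char_indep_normal_sum)
    show "indep_vars (\<lambda>_. borel) I {..<m}"
    proof -
      have "0 \<le> \<tau> 0 \<and> (\<forall>i<m. \<tau> i \<le> \<tau> (Suc i))"
        using \<tau>_0 less_imp_le[OF mono[OF lessI]] by simp
      with W show ?thesis unfolding standard_wiener_def I_def[abs_def] by blast
    qed
    fix i assume "i \<in> {..<m}"
    then have "0 \<le> \<tau> i \<and> \<tau> i < \<tau> (Suc i)" using mono[of i "Suc i"] \<tau>_nonneg[of i] by simp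
    with W show "distributed W lborel (I i) (normal_density 0 (sqrt (\<tau> (Suc i) - \<tau> i)))"
      "0 < sqrt (\<tau> (Suc i) - \<tau> i)"
      unfolding standard_wiener_def I_def[abs_def] by (blast, simp)
  qed (simp_all add: prob_space_axioms)
  also have "(\<Sum>i<m. (v i)\<^sup>2 * (sqrt (\<tau> (Suc i) - \<tau> i))\<^sup>2) =
      (\<Sum>i<m. \<Sum>s\<in>T. \<Sum>t\<in>T. u s * u t * (of_bool (\<tau> (Suc i) \<le> min s t) * (\<tau> (Suc i) - \<tau> i)))"
  proof (rule sum.cong[OF refl])
    fix i assume "i \<in> {..<m}"
    then have "(sqrt (\<tau> (Suc i) - \<tau> i))\<^sup>2 = \<tau> (Suc i) - \<tau> i"
      using mono[of i "Suc i"] by simp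
    moreover have "(v i)\<^sup>2 = (\<Sum>s\<in>T. \<Sum>t\<in>T. u s * u t * of_bool (\<tau> (Suc i) \<le> min s t))"
      unfolding v_def power2_eq_square sum_product by (intro sum.cong refl) simp
    ultimately show "(v i)\<^sup>2 * (sqrt (\<tau> (Suc i) - \<tau> i))\<^sup>2 =
        (\<Sum>s\<in>T. \<Sum>t\<in>T. u s * u t * (of_bool (\<tau> (Suc i) \<le> min s t) * (\<tau> (Suc i) - \<tau> i)))"
      by (simp only: sum_distrib_right mult.assoc)
  qed
  also have "\<dots> = (\<Sum>s\<in>T. \<Sum>t\<in>T. \<Sum>i<m. u s * u t * (of_bool (\<tau> (Suc i) \<le> min s t) * (\<tau> (Suc i) - \<tau> i)))"
    by (subst sum.swap, intro sum.cong refl sum.swap)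
  also have "\<dots> = (\<Sum>s\<in>T. \<Sum>t\<in>T. u s * u t * min s t)"
    using telescope[of _ "\<lambda>t. t"]
    by (intro sum.cong refl) (simp add: sum_distrib_left[symmetric] min_def)
  finally show ?thesis .
qed

section \<open>Growth of covariance sums for autocovariances of order 1/h\<close>

text \<open>
Eventually the increments of \<open>a - L * b\<close> are at most \<open>e / 2\<close> times those of \<open>b\<close>; summing them telescopes, and the
initial value is negligible because \<open>b\<close> is unbounded.
\<close>

lemma stolz_cesaro:
  fixes a b :: "nat \<Rightarrow> real"
  assumes inc: "eventually (\<lambda>n. b n < b (Suc n)) sequentially"
    and b: "filterlim b at_top sequentially"
    and lim: "(\<lambda>n. (a (Suc n) - a n) / (b (Suc n) - b n)) \<longlonglongrightarrow> L"
  shows "(\<lambda>n. a n / b n) \<longlonglongrightarrow> L"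
proof (rule LIMSEQ_I)
  fix e :: real assume "0 < e"
  define d where "d n = a n - L * b n" for n
  have "eventually (\<lambda>n. \<bar>(a (Suc n) - a n) / (b (Suc n) - b n) - L\<bar> < e / 2) sequentially"
    using tendstoD[OF lim, of "e / 2"] \<open>0 < e\<close> by (simp add: dist_real_def)
  with inc have "eventually (\<lambda>n. \<bar>d (Suc n) - d n\<bar> \<le> e / 2 * (b (Suc n) - b n) \<and> b n < b (Suc n)) sequentially"
  proof eventually_elim
    case (elim n)
    define q where "q = b (Suc n) - b n"
    have "0 < q" using elim by (simp add: q_def)
    have "d (Suc n) - d n = ((a (Suc n) - a n) / q - L) * q"
      using \<open>0 < q\<close> by (simp add: d_def q_def field_simps)
    then have "\<bar>d (Suc n) - d n\<bar> = \<bar>(a (Suc n) - a n) / q - L\<bar> * q"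
      using \<open>0 < q\<close> by (simp add: abs_mult)
    also have "\<dots> \<le> e / 2 * q" using elim \<open>0 < q\<close> by (intro mult_right_mono) (auto simp: q_def)
    finally show ?case using elim by (simp add: q_def)
  qed
  moreover have "eventually (\<lambda>n. 0 < b n) sequentially"
    using b by (auto simp: filterlim_at_top_dense)
  ultimately obtain N where N: "\<And>n. n \<ge> N \<Longrightarrow> \<bar>d (Suc n) - d n\<bar> \<le> e / 2 * (b (Suc n) - b n)"
    "\<And>n. n \<ge> N \<Longrightarrow> b n < b (Suc n)" "\<And>n. n \<ge> N \<Longrightarrow> 0 < b n"
    unfolding eventually_sequentially by (metis max.boundedE)
  have d: "\<bar>d n\<bar> \<le> \<bar>d N\<bar> + e / 2 * (b n - b N)" if "n \<ge> N" for n
    using that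
  proof (induction n rule: dec_induct)
    case (step n)
    have "\<bar>d (Suc n)\<bar> \<le> \<bar>d n\<bar> + \<bar>d (Suc n) - d n\<bar>" by linarith
    moreover have "e / 2 * (b (Suc n) - b N) = e / 2 * (b (Suc n) - b n) + e / 2 * (b n - b N)"
    proof -
      have "x * (u - w) = x * (u - v) + x * (v - w)" for x u v w :: real
        by (simp add: algebra_simps)
      then show ?thesis .
    qed
    ultimately show ?case using N(1)[OF step.hyps(1)] step.IH by linarith
  qed simp
  have "eventually (\<lambda>n. 2 * \<bar>d N\<bar> / e < b n) sequentially"
    using b by (auto simp: filterlim_at_top_dense)
  then obtain N' where N': "\<And>n. n \<ge> N' \<Longrightarrow> 2 * \<bar>d N\<bar> / e < b n"
    by (auto simp: eventually_sequentially)
  show "\<exists>N. \<forall>n\<ge>N. norm (a n / b n - L) < e"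
  proof (intro exI[of _ "max N N'"] allI impI)
    fix n assume n: "max N N' \<le> n"
    then have pos: "0 < b n" using N(3) by simp
    have "\<bar>d N\<bar> < e / 2 * b n" using N'[of n] n \<open>0 < e\<close> by (simp add: field_simps)
    moreover have "0 \<le> e / 2 * b N" using N(3)[of N] \<open>0 < e\<close> by simp
    ultimately have "\<bar>d n\<bar> < e * b n"
    proof -
      have "e / 2 * (b n - b N) = e / 2 * b n - e / 2 * b N" by (rule right_diff_distrib)
      moreover have "e * b n = e / 2 * b n + e / 2 * b n" by simp
      ultimately show ?thesis
        using d[of n] n \<open>\<bar>d N\<bar> < e / 2 * b n\<close> \<open>0 \<le> e / 2 * b N\<close> by linarith
    qed
    moreover have "a n / b n - L = d n / b n" using pos by (simp add: d_def field_simps)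
    ultimately show "norm (a n / b n - L) < e" using pos by (simp add: field_simps)
  qed
qed

lemma integral_power_unit_interval:
  "set_integrable lborel {0<..<1} (\<lambda>x::real. x ^ h)" (is ?integrable)
  "(LBINT x:{0<..<1}. x ^ h :: real) = 1 / real (Suc h)" (is ?value)
proof -
  have "set_integrable lborel {0..1} (\<lambda>x::real. x ^ h)"
    by (intro borel_integrable_atLeastAtMost') (intro continuous_intros)
  then show *: ?integrable
    by (rule set_integrable_subset) auto
  have "(LBINT x:{0<..<1}. x ^ h :: real) = (LBINT x:{0..1}. x ^ h :: real)"
    unfolding set_lebesgue_integral_def
    by (intro integral_cong_AE) (use AE_lborel_singleton[of "0::real"] AE_lborel_singleton[of "1::real"] in
      \<open>auto elim!: eventually_elim2 simp: indicator_def\<close>)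
  also have "\<dots> = 1 / real (Suc h)"
    using integral_power[of 0 1 h] by (simp add: set_lebesgue_integral_def mult.commute)
  finally show ?value .
qed

lemma set_integrable_mult_power:
  assumes "set_integrable lborel {0<..<1} g"
  shows "set_integrable lborel {0<..<1} (\<lambda>x::real. g x * x ^ h :: real)"
proof -
  from assms have "(\<lambda>x. indicator {0<..<1} x * g x * x ^ h) \<in> borel_measurable lborel"
    unfolding set_integrable_def by (auto dest: borel_measurable_integrable)
  with assms show ?thesis
    unfolding set_integrable_def
    by (intro Bochner_Integration.integrable_bound[OF assms[unfolded set_integrable_def]])
      (auto simp: indicator_def mult.assoc abs_mult power_le_one intro!: AE_I2 mult_left_le)
qed

text \<open>
An Abelian theorem: \<open>(h + 1) * x ^ h\<close> is a probability density on the unit interval that concentrates at \<open>1\<close>, and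
only the behaviour of \<open>\<psi>\<close> near \<open>1\<close> matters, since away from \<open>1\<close> the powers decay geometrically.
\<close>

lemma moment_asymptotics:
  fixes \<psi> :: "real \<Rightarrow> real"
  assumes int: "set_integrable lborel {0<..<1} \<psi>" and lim: "(\<psi> \<longlongrightarrow> c) (at_left 1)"
  shows "(\<lambda>h. real h * (LBINT x:{0<..<1}. \<psi> x * x ^ h)) \<longlonglongrightarrow> c"
proof -
  define g where "g x = \<psi> x - c" for x
  have int_const: "set_integrable lborel {0<..<1::real} (\<lambda>_. c)"
    using integral_power_unit_interval(1)[of 0] by (auto simp: set_integrable_def)
  have g: "set_integrable lborel {0<..<1} g"
    unfolding g_def by (intro set_integral_diff int int_const)
  have split: "real h * (LBINT x:{0<..<1}. \<psi> x * x ^ h) =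
      c * (real h / real (Suc h)) + real h * (LBINT x:{0<..<1}. g x * x ^ h)" for h
  proof -
    have "(LBINT x:{0<..<1}. \<psi> x * x ^ h) = (LBINT x:{0<..<1}. g x * x ^ h + c * x ^ h)"
      by (simp add: g_def algebra_simps)
    also have "\<dots> = (LBINT x:{0<..<1}. g x * x ^ h) + c * (1 / real (Suc h))"
      using set_integrable_mult_power[OF g, of h] integral_power_unit_interval[of h]
      by (subst set_integral_add) auto
    finally show ?thesis by (simp add: field_simps)
  qed
  have "(\<lambda>h. real h * (LBINT x:{0<..<1}. g x * x ^ h)) \<longlonglongrightarrow> 0"
  proof (rule LIMSEQ_I)
    fix e :: real assume "0 < e"
    have "(g \<longlongrightarrow> 0) (at_left 1)" unfolding g_def using tendsto_diff[OF lim tendsto_const[of c]] by simp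
    then have "eventually (\<lambda>x. \<bar>g x\<bar> < e / 2) (at_left 1)"
      using tendstoD[of g 0 "at_left 1" "e / 2"] \<open>0 < e\<close> by (simp add: dist_real_def)
    then obtain y0 where y0: "y0 < 1" "\<And>x. y0 < x \<Longrightarrow> x < 1 \<Longrightarrow> \<bar>g x\<bar> < e / 2"
      by (auto simp: eventually_at_left_field)
    \<comment> \<open>The neighbourhood of 1 is cut off at 0 so that powers of its left endpoint bound powers of \<open>x\<close>.\<close>
    define y where "y = max y0 0"
    have y: "0 \<le> y" "y < 1" "\<And>x. y < x \<Longrightarrow> x < 1 \<Longrightarrow> \<bar>g x\<bar> \<le> e / 2"
      using y0 by (auto simp: y_def intro: less_imp_le)
    define G where "G = (LBINT x:{0<..<1}. \<bar>g x\<bar>)"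
    have absg: "set_integrable lborel {0<..<1} (\<lambda>x. \<bar>g x\<bar>)"
      using set_integrable_abs[OF g] .
    have bound: "\<bar>LBINT x:{0<..<1}. g x * x ^ h\<bar> \<le> e / 2 * (1 / real (Suc h)) + y ^ h * G" for h
    proof -
      have "\<bar>LBINT x:{0<..<1}. g x * x ^ h\<bar> \<le> (LBINT x:{0<..<1}. \<bar>g x * x ^ h\<bar>)"
        using set_integral_norm_bound[OF set_integrable_mult_power[OF g, of h]] by simp
      also have "\<dots> \<le> (LBINT x:{0<..<1}. e / 2 * x ^ h + y ^ h * \<bar>g x\<bar>)"
      proof (rule set_integral_mono)
        show "set_integrable lborel {0<..<1} (\<lambda>x. \<bar>g x * x ^ h\<bar>)"
          using set_integrable_abs[OF set_integrable_mult_power[OF g, of h]] .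
        show "set_integrable lborel {0<..<1} (\<lambda>x. e / 2 * x ^ h + y ^ h * \<bar>g x\<bar>)"
          using absg integral_power_unit_interval(1)[of h]
          by (intro set_integral_add set_integrable_mult_right) auto
        fix x :: real assume x: "x \<in> {0<..<1}"
        show "\<bar>g x * x ^ h\<bar> \<le> e / 2 * x ^ h + y ^ h * \<bar>g x\<bar>"
        proof (cases "y < x")
          case True
          then have "\<bar>g x\<bar> * x ^ h \<le> e / 2 * x ^ h" using x y(3) by (intro mult_right_mono) auto
          moreover have "0 \<le> y ^ h * \<bar>g x\<bar>" using y by simp
          moreover have "\<bar>g x * x ^ h\<bar> = \<bar>g x\<bar> * x ^ h" using x by (simp add: abs_mult)
          ultimately show ?thesis by linarith
        next
          case False
          then have "\<bar>g x\<bar> * x ^ h \<le> \<bar>g x\<bar> * y ^ h" using x by (intro mult_left_mono power_mono) auto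
          moreover have "0 \<le> e / 2 * x ^ h" using x \<open>0 < e\<close> by simp
          ultimately show ?thesis using x by (simp add: abs_mult mult.commute)
        qed
      qed
      also have "\<dots> = e / 2 * (1 / real (Suc h)) + y ^ h * G"
        using absg integral_power_unit_interval[of h]
        by (subst set_integral_add) (auto simp: G_def)
      finally show ?thesis .
    qed
    have "(\<lambda>h. real h * y ^ h) \<longlonglongrightarrow> 0"
      using powser_times_n_limit_0[of y] y by simp
    from tendsto_mult[OF this tendsto_const[of G]] have "(\<lambda>h. real h * y ^ h * G) \<longlonglongrightarrow> 0" by simp
    from LIMSEQ_D[OF this, of "e / 2"] \<open>0 < e\<close> obtain H where
      H: "\<And>h. h \<ge> H \<Longrightarrow> \<bar>real h * y ^ h * G\<bar> < e / 2" by auto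
    show "\<exists>H. \<forall>h\<ge>H. norm (real h * (LBINT x:{0<..<1}. g x * x ^ h) - 0) < e"
    proof (intro exI[of _ H] allI impI)
      fix h assume "H \<le> h"
      have "\<bar>real h * (LBINT x:{0<..<1}. g x * x ^ h)\<bar> \<le> real h * (e / 2 * (1 / real (Suc h)) + y ^ h * G)"
        unfolding abs_mult using bound[of h] by (intro mult_mono) auto
      also have "\<dots> = e / 2 * (real h / real (Suc h)) + real h * y ^ h * G" by (simp add: algebra_simps)
      also have "e / 2 * (real h / real (Suc h)) \<le> e / 2 * 1"
        using \<open>0 < e\<close> by (intro mult_left_mono) auto
      finally show "norm (real h * (LBINT x:{0<..<1}. g x * x ^ h) - 0) < e"
        using H[OF \<open>H \<le> h\<close>] by simp
    qed
  qed
  moreover have "(\<lambda>h. real h / real (Suc h)) \<longlonglongrightarrow> 1" by real_asymp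
  ultimately have "(\<lambda>h. c * (real h / real (Suc h)) + real h * (LBINT x:{0<..<1}. g x * x ^ h)) \<longlonglongrightarrow> c * 1 + 0"
    by (intro tendsto_intros)
  then show ?thesis by (simp add: split)
qed

text \<open>
The covariance of the sums of the first \<open>m\<close> and the first \<open>n\<close> terms of a stationary sequence with autocovariance
\<open>R\<close>; with truncated subtraction, \<open>(k - l) + (l - k)\<close> is the distance of \<open>k\<close> and \<open>l\<close>.
\<close>

definition cov_sum :: "(nat \<Rightarrow> real) \<Rightarrow> nat \<Rightarrow> nat \<Rightarrow> real" where
  "cov_sum R m n = (\<Sum>k=1..m. \<Sum>l=1..n. R ((k - l) + (l - k)))"

lemma cov_sum_commute: "cov_sum R m n = cov_sum R n m"
  unfolding cov_sum_def by (subst sum.swap) (simp add: add.commute)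

lemma cov_sum_0: "cov_sum R 0 n = 0" by (simp add: cov_sum_def)

lemma cov_sum_Suc_diag:
  "cov_sum R (Suc m) (Suc m) = cov_sum R m m + (R 0 + 2 * (\<Sum>h=1..m. R h))"
proof -
  have "(\<Sum>k=1..m. R ((k - Suc m) + (Suc m - k))) = (\<Sum>h=1..m. R h)"
    by (rule sum.reindex_bij_witness[where i = "\<lambda>h. Suc m - h" and j = "\<lambda>k. Suc m - k"]) auto
  moreover have "(\<Sum>l=1..m. R ((Suc m - l) + (l - Suc m))) = (\<Sum>h=1..m. R h)"
    by (rule sum.reindex_bij_witness[where i = "\<lambda>h. Suc m - h" and j = "\<lambda>k. Suc m - k"]) auto
  ultimately show ?thesis by (simp add: cov_sum_def sum.distrib)
qed

text \<open>
By stationarity the increment from \<open>m\<close> to \<open>n\<close> has the variance of the first \<open>n - m\<close> terms, so all covariances of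
partial sums are determined by their variances.
\<close>

lemma cov_sum_polarization:
  assumes "m \<le> n"
  shows "2 * cov_sum R m n = cov_sum R m m + cov_sum R n n - cov_sum R (n - m) (n - m)"
proof -
  define f where "f k l = R ((k - l) + (l - k))" for k l
  have sym: "f k l = f l k" for k l by (simp add: f_def add.commute)
  have split: "(\<Sum>k=1..n. g k) = (\<Sum>k=1..m. g k) + (\<Sum>k=Suc m..n. g k)" for g :: "nat \<Rightarrow> real"
    using sum.ub_add_nat[of 1 m g "n - m"] assms by simp
  have "(\<Sum>k=Suc m..n. \<Sum>l=Suc m..n. f k l) = cov_sum R (n - m) (n - m)"
  proof -
    have shift: "(\<Sum>k=Suc m..n. g k) = (\<Sum>k=1..n-m. g (k + m))" for g :: "nat \<Rightarrow> real"
      using sum.shift_bounds_cl_nat_ivl[of g 1 m "n - m"] assms by simp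
    show ?thesis by (simp add: shift cov_sum_def f_def)
  qed
  moreover have "(\<Sum>k=Suc m..n. \<Sum>l=1..m. f k l) = (\<Sum>k=1..m. \<Sum>l=Suc m..n. f k l)"
    by (subst sum.swap) (simp add: sym)
  ultimately show ?thesis
    by (simp only: cov_sum_def f_def[symmetric] split sum.distrib) simp
qed

text \<open>
An autocovariance decaying like \<open>c / h\<close> is just not summable, and this is where the logarithm comes from:
the increment of the variance at \<open>m\<close> is about \<open>2 * c * ln m\<close>. Stolz-Cesaro is used once for the harmonic sum and
once for the sum of its partial sums.
\<close>

lemma cov_sum_diag_asymptotics:
  assumes "(\<lambda>h. real h * R h) \<longlonglongrightarrow> c"
  shows "(\<lambda>m. cov_sum R m m / (real m * ln (real m))) \<longlonglongrightarrow> 2 * c"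
proof -
  have "(\<lambda>m. (\<Sum>h=1..m. R h) / ln (real m)) \<longlonglongrightarrow> c"
  proof (rule stolz_cesaro)
    show "eventually (\<lambda>m. ln (real m) < ln (real (Suc m))) sequentially" by real_asymp
    show "filterlim (\<lambda>m. ln (real m)) at_top sequentially" by real_asymp
    have "(\<lambda>m. real (Suc m) * R (Suc m) * (1 / (real (Suc m) * (ln (real (Suc m)) - ln (real m))))) \<longlonglongrightarrow> c * 1"
    proof (rule tendsto_mult)
      show "(\<lambda>m. real (Suc m) * R (Suc m)) \<longlonglongrightarrow> c" using assms by (rule LIMSEQ_Suc)
      show "(\<lambda>m. 1 / (real (Suc m) * (ln (real (Suc m)) - ln (real m)))) \<longlonglongrightarrow> 1" by real_asymp
    qed
    then show "(\<lambda>m. ((\<Sum>h=1..Suc m. R h) - (\<Sum>h=1..m. R h)) / (ln (real (Suc m)) - ln (real m))) \<longlonglongrightarrow> c"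
      by simp
  qed
  note inner = this
  show ?thesis
  proof (rule stolz_cesaro)
    show "eventually (\<lambda>m. real m * ln (real m) < real (Suc m) * ln (real (Suc m))) sequentially"
      by real_asymp
    show "filterlim (\<lambda>m. real m * ln (real m)) at_top sequentially" by real_asymp
    let ?d = "\<lambda>m. real (Suc m) * ln (real (Suc m)) - real m * ln (real m)"
    have "(\<lambda>m. R 0 * (1 / ?d m) + 2 * ((\<Sum>h=1..m. R h) / ln (real m)) * (ln (real m) / ?d m)) \<longlonglongrightarrow>
        R 0 * 0 + 2 * c * 1"
    proof (intro tendsto_add tendsto_mult tendsto_const inner)
      show "(\<lambda>m. 1 / ?d m) \<longlonglongrightarrow> 0" by real_asymp
      show "(\<lambda>m. ln (real m) / ?d m) \<longlonglongrightarrow> 1" by real_asymp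
    qed
    moreover have "eventually (\<lambda>m. R 0 * (1 / ?d m) + 2 * ((\<Sum>h=1..m. R h) / ln (real m)) * (ln (real m) / ?d m)
        = (cov_sum R (Suc m) (Suc m) - cov_sum R m m) / ?d m) sequentially"
    proof (rule eventually_sequentiallyI[of 2])
      fix m :: nat assume "2 \<le> m"
      then have "ln (real m) \<noteq> 0" by simp
      moreover have "A * (1 / d) + 2 * (S / n) * (n / d) = (A + 2 * S) / d" if "n \<noteq> 0" for A S n d :: real
        using that by (cases "d = 0") (simp_all add: field_simps)
      ultimately show "R 0 * (1 / ?d m) + 2 * ((\<Sum>h=1..m. R h) / ln (real m)) * (ln (real m) / ?d m)
        = (cov_sum R (Suc m) (Suc m) - cov_sum R m m) / ?d m"
        by (simp only: cov_sum_Suc_diag) simp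
    qed
    ultimately show "(\<lambda>m. (cov_sum R (Suc m) (Suc m) - cov_sum R m m) / ?d m) \<longlonglongrightarrow> 2 * c"
      by (auto elim: Lim_transform_eventually)
  qed
qed

text \<open>
The logarithm is slowly varying: \<open>ln (m n) / ln n\<close> tends to \<open>1\<close> whenever \<open>m n\<close> is of exact order \<open>n\<close>.
\<close>

lemma cov_sum_diag_scaled:
  assumes R: "(\<lambda>h. real h * R h) \<longlonglongrightarrow> c"
    and m: "(\<lambda>n. real (m n) / real n) \<longlonglongrightarrow> x" and "0 < x"
  shows "(\<lambda>n. cov_sum R (m n) (m n) / (real n * ln (real n))) \<longlonglongrightarrow> 2 * c * x"
proof -
  have "filterlim (\<lambda>n. real (m n) / real n * real n) at_top sequentially"
    by (rule filterlim_tendsto_pos_mult_at_top[OF m \<open>0 < x\<close> filterlim_real_sequentially])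
  moreover have "eventually (\<lambda>n. real (m n) / real n * real n = real (m n)) sequentially"
    by (intro eventually_sequentiallyI[of 1]) auto
  ultimately have mr: "filterlim (\<lambda>n. real (m n)) at_top sequentially"
    using filterlim_cong[OF refl refl] by (smt (verit) eventually_mono)
  then have "filterlim m at_top sequentially"
    by (simp add: filterlim_sequentially_iff_filterlim_real)
  from filterlim_compose[OF cov_sum_diag_asymptotics[OF R] this]
  have V: "(\<lambda>n. cov_sum R (m n) (m n) / (real (m n) * ln (real (m n)))) \<longlonglongrightarrow> 2 * c" .
  have "filterlim (\<lambda>n. ln (real n)) at_top sequentially" by real_asymp
  with tendsto_ln[OF m] \<open>0 < x\<close> have "(\<lambda>n. ln (real (m n) / real n) / ln (real n)) \<longlonglongrightarrow> 0"
    by (intro tendsto_divide_0) (auto intro: filterlim_at_top_imp_at_infinity)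
  from tendsto_mult[OF V tendsto_mult[OF m tendsto_add[OF tendsto_const[of 1] this]]]
  have "(\<lambda>n. cov_sum R (m n) (m n) / (real (m n) * ln (real (m n))) *
      (real (m n) / real n * (1 + ln (real (m n) / real n) / ln (real n)))) \<longlonglongrightarrow> 2 * c * x" by simp
  moreover have "eventually (\<lambda>n. cov_sum R (m n) (m n) / (real (m n) * ln (real (m n))) *
      (real (m n) / real n * (1 + ln (real (m n) / real n) / ln (real n))) =
      cov_sum R (m n) (m n) / (real n * ln (real n))) sequentially"
  proof -
    have "eventually (\<lambda>n. 1 < real (m n)) sequentially"
      using mr unfolding filterlim_at_top_dense by blast
    with eventually_gt_at_top[of 1] show ?thesis
    proof eventually_elim
      case (elim n)
      define p q where "p = ln (real (m n))" and "q = ln (real n)"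
      have "p \<noteq> 0" "q \<noteq> 0" using elim by (auto simp: p_def q_def)
      moreover have "ln (real (m n) / real n) = p - q" using elim by (simp add: p_def q_def ln_div)
      ultimately show ?case using elim unfolding p_def[symmetric] q_def[symmetric] by (simp add: field_simps)
    qed
  qed
  ultimately show ?thesis by (rule Lim_transform_eventually)
qed

lemma floor_scaling_limit:
  assumes "0 \<le> t" shows "(\<lambda>n. real (nat \<lfloor>real n * t\<rfloor>) / real n) \<longlonglongrightarrow> t"
proof -
  have "(\<lambda>n. real_of_int \<lfloor>real n * t\<rfloor> / real n) \<longlonglongrightarrow> t" by real_asymp
  then show ?thesis using assms by simp
qed

text \<open>
By polarization the limit is \<open>c * (s + t - \<bar>t - s\<bar>)\<close>.
\<close>

proposition cov_sum_scaled_limit: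
  assumes R: "(\<lambda>h. real h * R h) \<longlonglongrightarrow> c" and "0 \<le> s" "0 \<le> t"
  shows "(\<lambda>n. cov_sum R (nat \<lfloor>real n * s\<rfloor>) (nat \<lfloor>real n * t\<rfloor>) / (real n * ln (real n)))
    \<longlonglongrightarrow> 2 * c * min s t"
  using assms(2,3)
proof (induction s t rule: linorder_wlog)
  case (le s t)
  define m where "m t n = nat \<lfloor>real n * t\<rfloor>" for t n
  have diag: "(\<lambda>n. cov_sum R (m t n) (m t n) / (real n * ln (real n))) \<longlonglongrightarrow> 2 * c * t" if "0 \<le> t" for t
  proof (cases "t = 0")
    case True then show ?thesis by (simp add: m_def cov_sum_0)
  next
    case False
    with that floor_scaling_limit[OF that] show ?thesis
      unfolding m_def by (intro cov_sum_diag_scaled R) auto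
  qed
  have mono: "m s n \<le> m t n" for n
    unfolding m_def using le by (intro nat_mono floor_mono mult_left_mono) auto
  have diff: "(\<lambda>n. cov_sum R (m t n - m s n) (m t n - m s n) / (real n * ln (real n))) \<longlonglongrightarrow> 2 * c * (t - s)"
  proof (cases "s = t")
    case True then show ?thesis by (simp add: cov_sum_0)
  next
    case False
    show ?thesis
    proof (rule cov_sum_diag_scaled[OF R])
      show "(\<lambda>n. real (m t n - m s n) / real n) \<longlonglongrightarrow> t - s"
        using tendsto_diff[OF floor_scaling_limit[of t] floor_scaling_limit[of s]] le mono
        by (simp add: m_def[symmetric] of_nat_diff diff_divide_distrib)
    qed (use False le in simp)
  qed
  have "(\<lambda>n. (cov_sum R (m s n) (m s n) / (real n * ln (real n)) + cov_sum R (m t n) (m t n) / (real n * ln (real n))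
      - cov_sum R (m t n - m s n) (m t n - m s n) / (real n * ln (real n))) / 2) \<longlonglongrightarrow>
      (2 * c * s + 2 * c * t - 2 * c * (t - s)) / 2"
    using le by (intro tendsto_intros diag diff) auto
  moreover have "(A / d + B / d - C / d) / 2 = D / d" if "2 * D = A + B - C" for A B C D d :: real
  proof -
    have "(A / d + B / d - C / d) / 2 = (A + B - C) / d / 2"
      by (simp only: add_divide_distrib diff_divide_distrib)
    then show ?thesis unfolding that[symmetric] by simp
  qed
  then have "(cov_sum R (m s n) (m s n) / d + cov_sum R (m t n) (m t n) / d
      - cov_sum R (m t n - m s n) (m t n - m s n) / d) / 2 = cov_sum R (m s n) (m t n) / d" for n d
    using cov_sum_polarization[OF mono[of n], of R] by blast
  ultimately show ?case using le by (simp add: m_def algebra_simps)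
next
  case (sym s t)
  then show ?case by (simp add: cov_sum_commute[of R "nat \<lfloor>_ * s\<rfloor>"] min.commute)
qed

section \<open>Second moments of the INAR(1) process with fixed thinning parameter\<close>

text \<open>
The Stein-Chen identity. It yields the first two moments with \<open>f = 1\<close> and \<open>f n = n\<close>.
\<close>

lemma poisson_size_bias:
  assumes "0 < \<mu>"
  shows "(\<integral>\<^sup>+n. ennreal (real n) * f n \<partial>measure_pmf (poisson_pmf \<mu>)) =
    ennreal \<mu> * (\<integral>\<^sup>+n. f (Suc n) \<partial>measure_pmf (poisson_pmf \<mu>))"
proof -
  let ?g = "\<lambda>n. ennreal (pmf (poisson_pmf \<mu>) n) * (ennreal (real n) * f n)"
  have shift: "?g (Suc n) = ennreal \<mu> * (ennreal (pmf (poisson_pmf \<mu>) n) * f (Suc n))" for n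
  proof -
    have "pmf (poisson_pmf \<mu>) (Suc n) * real (Suc n) = \<mu> * pmf (poisson_pmf \<mu>) n"
      using assms by (simp add: field_simps del: of_nat_Suc)
    then show ?thesis using assms
      by (simp only: mult.assoc[symmetric] ennreal_mult[symmetric] pmf_nonneg of_nat_0_le_iff less_imp_le)
  qed
  have "(\<lambda>n. ?g (Suc n)) sums (\<Sum>n. ?g (Suc n))" by (rule summable_sums) simp
  then have "?g sums ((\<Sum>n. ?g (Suc n)) + ?g 0)" by (rule sums_Suc)
  then have "suminf ?g = (\<Sum>n. ?g (Suc n))" by (simp add: sums_unique[symmetric])
  also have "\<dots> = ennreal \<mu> * (\<Sum>n. ennreal (pmf (poisson_pmf \<mu>) n) * f (Suc n))"
    by (simp only: shift ennreal_suminf_cmult)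
  finally show ?thesis
    by (simp add: nn_integral_measure_pmf nn_integral_count_space_nat)
qed

lemma poisson_moments:
  assumes "0 < \<mu>"
  shows "(\<integral>\<^sup>+n. ennreal (real n) \<partial>measure_pmf (poisson_pmf \<mu>)) = ennreal \<mu>" (is ?first)
    and "(\<integral>\<^sup>+n. ennreal ((real n)\<^sup>2) \<partial>measure_pmf (poisson_pmf \<mu>)) = ennreal (\<mu> + \<mu>\<^sup>2)" (is ?second)
proof -
  show 1: ?first
    using poisson_size_bias[OF assms, of "\<lambda>_. 1"] by simp
  have "(\<integral>\<^sup>+n. ennreal ((real n)\<^sup>2) \<partial>measure_pmf (poisson_pmf \<mu>)) =
      (\<integral>\<^sup>+n. ennreal (real n) * ennreal (real n) \<partial>measure_pmf (poisson_pmf \<mu>))"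
    by (simp add: power2_eq_square ennreal_mult)
  also have "\<dots> = ennreal \<mu> * (\<integral>\<^sup>+n. 1 + ennreal (real n) \<partial>measure_pmf (poisson_pmf \<mu>))"
    by (simp add: poisson_size_bias[OF assms])
  also have "\<dots> = ennreal \<mu> * (1 + ennreal \<mu>)"
    by (subst nn_integral_add) (simp_all add: 1)
  also have "\<dots> = ennreal (\<mu> + \<mu>\<^sup>2)"
    using assms by (simp add: distrib_left power2_eq_square ennreal_mult)
  finally show ?second .
qed

text \<open>
Resampling one coordinate preserves a product measure, so a function that ignores this coordinate is independent
of it.
\<close>

lemma nn_integral_PiM_fresh_coordinate:
  fixes M :: "'i \<Rightarrow> 'b measure"
  assumes M: "\<And>i. i \<in> I \<Longrightarrow> prob_space (M i)" and c: "c \<in> I"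
    and F: "F \<in> borel_measurable (PiM I M)" and \<phi>: "\<phi> \<in> borel_measurable (M c)"
    and fresh: "\<And>x b. F (x(c := b)) = F x"
  shows "(\<integral>\<^sup>+x. F x * \<phi> (x c) \<partial>PiM I M) = (\<integral>\<^sup>+x. F x \<partial>PiM I M) * (\<integral>\<^sup>+b. \<phi> b \<partial>M c)"
proof -
  interpret I: prob_space "PiM I M" by (rule prob_space_PiM) (rule M)
  have ins: "insert c I = I" using c by auto
  have upd: "(\<lambda>(b, x). x(c := b)) \<in> measurable (M c \<Otimes>\<^sub>M PiM I M) (PiM I M)"
    using measurable_fun_upd[of I I c "\<lambda>(b, x). x" "M c \<Otimes>\<^sub>M PiM I M" M "\<lambda>(b, x). b"] c
    by (simp add: split_beta' ins)
  have comp: "(\<lambda>x. x c) \<in> measurable (PiM I M) (M c)" using c by measurable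
  have G: "(\<lambda>x. F x * \<phi> (x c)) \<in> borel_measurable (PiM I M)"
    using F measurable_compose[OF comp \<phi>] by measurable
  have "(\<integral>\<^sup>+x. F x * \<phi> (x c) \<partial>PiM I M) =
      (\<integral>\<^sup>+x. F x * \<phi> (x c) \<partial>distr (M c \<Otimes>\<^sub>M PiM I M) (PiM I M) (\<lambda>(b, x). x(c := b)))"
    using distr_pair_PiM_eq_PiM[of I M c] M c by (simp add: ins)
  also have "\<dots> = (\<integral>\<^sup>+z. F (snd z) * \<phi> (fst z) \<partial>(M c \<Otimes>\<^sub>M PiM I M))"
    by (subst nn_integral_distr[OF upd]) (simp_all add: G split_beta' fresh)
  also have "\<dots> = (\<integral>\<^sup>+b. \<integral>\<^sup>+x. F x * \<phi> b \<partial>PiM I M \<partial>M c)"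
    using F \<phi> by (subst I.nn_integral_fst[symmetric]) simp_all
  also have "\<dots> = (\<integral>\<^sup>+b. (\<integral>\<^sup>+x. F x \<partial>PiM I M) * \<phi> b \<partial>M c)"
    using F by (intro nn_integral_cong nn_integral_multc)
  also have "\<dots> = (\<integral>\<^sup>+x. F x \<partial>PiM I M) * (\<integral>\<^sup>+b. \<phi> b \<partial>M c)"
    using \<phi> by (rule nn_integral_cmult)
  finally show ?thesis .
qed

text \<open>
The INAR(1) recursion as a function of the driving variables, so that the process can be studied under a product
measure once the thinning parameter is fixed.
\<close>

fun inar_path :: "inar_input \<Rightarrow> nat \<Rightarrow> nat" where
  "inar_path z 0 = fst z"
| "inar_path z (Suc k) = (\<Sum>i=1..inar_path z k. fst (snd z) (Suc k, i)) + snd (snd z) (Suc k)"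

definition set_thinning :: "nat \<times> nat \<Rightarrow> nat \<Rightarrow> inar_input \<Rightarrow> inar_input" where
  "set_thinning c b z = (fst z, (fst (snd z))(c := b), snd (snd z))"

definition set_innovation :: "nat \<Rightarrow> nat \<Rightarrow> inar_input \<Rightarrow> inar_input" where
  "set_innovation k b z = (fst z, fst (snd z), (snd (snd z))(k := b))"

lemma fst_set [simp]:
  "fst (set_thinning c b z) = fst z" "fst (snd (set_thinning c b z)) = (fst (snd z))(c := b)"
  "snd (snd (set_thinning c b z)) = snd (snd z)" "fst (set_innovation k b z) = fst z"
  "fst (snd (set_innovation k b z)) = fst (snd z)"
  "snd (snd (set_innovation k b z)) = (snd (snd z))(k := b)"
  by (simp_all add: set_thinning_def set_innovation_def)

text \<open>
Adaptedness to the history up to time \<open>k\<close>, expressed without sigma-algebras: changing thinning variables or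
innovations of later steps has no effect.
\<close>

definition determined_upto :: "nat \<Rightarrow> (inar_input \<Rightarrow> 'b) \<Rightarrow> bool" where
  "determined_upto k F \<longleftrightarrow> (\<forall>j>k. \<forall>z b. F (set_innovation j b z) = F z \<and>
     (\<forall>i. F (set_thinning (j, i) b z) = F z))"

lemma determined_uptoD:
  assumes "determined_upto k F" "k < j"
  shows "F (set_innovation j b z) = F z" "F (set_thinning (j, i) b z) = F z"
  using assms unfolding determined_upto_def by blast+

lemma inar_path_determined: "j \<le> k \<Longrightarrow> determined_upto k (\<lambda>z. inar_path z j)"
proof (induction j)
  case (Suc j)
  then show ?case by (simp add: determined_upto_def)
qed (simp add: determined_upto_def)

lemma thinning_measurable:
  assumes "1 \<le> k" "1 \<le> i"
  shows "(\<lambda>z. fst (snd z) (k, i)) \<in> measurable inar_input_space (count_space UNIV)"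
proof -
  have "(\<lambda>x. x (k, i)) \<in> measurable (PiM ({1..} \<times> {1..}) (\<lambda>_. count_space UNIV)) (count_space (UNIV :: nat set))"
    using assms by (intro measurable_component_singleton) auto
  from measurable_compose[OF measurable_compose[OF measurable_snd measurable_fst] this]
  show ?thesis unfolding inar_input_space_def .
qed

lemma innovation_measurable:
  assumes "1 \<le> k"
  shows "(\<lambda>z. snd (snd z) k) \<in> measurable inar_input_space (count_space UNIV)"
proof -
  have "(\<lambda>x. x k) \<in> measurable (PiM {1..} (\<lambda>_. count_space UNIV)) (count_space (UNIV :: nat set))"
    using assms by (intro measurable_component_singleton) auto
  from measurable_compose[OF measurable_compose[OF measurable_snd measurable_snd] this]
  show ?thesis unfolding inar_input_space_def .
qed

lemma nat_sum_measurable: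
  assumes "\<And>i. i \<in> I \<Longrightarrow> f i \<in> measurable M (count_space (UNIV :: nat set))"
  shows "(\<lambda>z. \<Sum>i\<in>I. f i z :: nat) \<in> measurable M (count_space UNIV)"
  using assms
proof (induction I rule: infinite_finite_induct)
  case (insert i I)
  then have "f i \<in> measurable M (count_space UNIV)" "(\<lambda>z. \<Sum>i\<in>I. f i z) \<in> measurable M (count_space UNIV)"
    by auto
  then have "(\<lambda>z. f i z + (\<Sum>i\<in>I. f i z)) \<in> measurable M (count_space UNIV)" by measurable
  with insert.hyps show ?case by simp
qed simp_all

lemma inar_path_measurable: "(\<lambda>z. inar_path z k) \<in> measurable inar_input_space (count_space UNIV)"
proof (induction k)
  case 0
  show ?case unfolding inar_input_space_def by simp
next
  case (Suc k)
  have "(\<lambda>z. (\<Sum>i=1..m. fst (snd z) (Suc k, i)) + snd (snd z) (Suc k))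
      \<in> measurable inar_input_space (count_space UNIV)" for m
  proof -
    have "(\<lambda>z. \<Sum>i=1..m. fst (snd z) (Suc k, i)) \<in> measurable inar_input_space (count_space UNIV)"
      by (intro nat_sum_measurable thinning_measurable) auto
    moreover have "(\<lambda>z. snd (snd z) (Suc k)) \<in> measurable inar_input_space (count_space UNIV)"
      by (rule innovation_measurable) simp
    ultimately show ?thesis by measurable
  qed
  from measurable_compose_countable[OF this Suc] show ?case by simp
qed

lemma sets_inar_input_law: "sets (inar_input_law l a) = sets inar_input_space"
  unfolding inar_input_law_def inar_input_space_def
  by (intro sets_pair_measure_cong sets_PiM_cong) simp_all

locale fixed_thinning =
  fixes l a :: real
  assumes l_pos: "0 < l" and a_bounds: "0 < a" "a < 1"
begin

abbreviation "Q \<equiv> inar_input_law l a"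
abbreviation "Poi \<equiv> measure_pmf (poisson_pmf l)"
abbreviation "Ber \<equiv> measure_pmf (map_pmf of_bool (bernoulli_pmf a)) :: nat measure"
abbreviation "Thin \<equiv> PiM ({1..} \<times> {1..} :: (nat \<times> nat) set) (\<lambda>_. Ber)"
abbreviation "Inn \<equiv> PiM ({1..} :: nat set) (\<lambda>_. Poi)"
abbreviation "Start \<equiv> measure_pmf (poisson_pmf (l / (1 - a)))"
abbreviation "\<E> \<equiv> integral\<^sup>N Q"

lemma Q_eq: "Q = Start \<Otimes>\<^sub>M (Thin \<Otimes>\<^sub>M Inn)" by (simp add: inar_input_law_def)

lemma measurable_Q: "measurable Q N = measurable inar_input_space N"
  by (rule measurable_cong_sets) (simp_all add: sets_inar_input_law)

sublocale Thin: prob_space Thin by (intro prob_space_PiM) (rule prob_space_measure_pmf)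
sublocale Inn: prob_space Inn by (intro prob_space_PiM) (rule prob_space_measure_pmf)
sublocale TI: pair_prob_space Thin Inn ..
sublocale Start: prob_space Start by (rule prob_space_measure_pmf)
sublocale STI: pair_prob_space Start "Thin \<Otimes>\<^sub>M Inn" ..

sublocale Q: prob_space Q unfolding Q_eq by (rule STI.prob_space_axioms)

lemma nn_integral_Q:
  assumes f: "f \<in> borel_measurable inar_input_space"
  shows "\<E> f = (\<integral>\<^sup>+x. \<integral>\<^sup>+e. \<integral>\<^sup>+\<xi>. f (x, \<xi>, e) \<partial>Thin \<partial>Inn \<partial>Start)" (is ?thesis1)
    and "\<E> f = (\<integral>\<^sup>+x. \<integral>\<^sup>+\<xi>. \<integral>\<^sup>+e. f (x, \<xi>, e) \<partial>Inn \<partial>Thin \<partial>Start)" (is ?thesis2)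
proof -
  have f': "f \<in> borel_measurable (Start \<Otimes>\<^sub>M (Thin \<Otimes>\<^sub>M Inn))"
    using f by (simp only: measurable_Q[symmetric] Q_eq)
  then have fx: "(\<lambda>y. f (x, y)) \<in> borel_measurable (Thin \<Otimes>\<^sub>M Inn)" for x
    by (rule measurable_compose[OF measurable_Pair1' , rotated]) simp
  have 1: "\<E> f = (\<integral>\<^sup>+x. \<integral>\<^sup>+y. f (x, y) \<partial>(Thin \<Otimes>\<^sub>M Inn) \<partial>Start)"
    unfolding Q_eq by (rule TI.P.nn_integral_fst[symmetric, OF f'])
  show ?thesis1
    unfolding 1 by (intro nn_integral_cong TI.nn_integral_snd[symmetric] fx)
  show ?thesis2
    unfolding 1 by (intro nn_integral_cong Inn.nn_integral_fst[symmetric] fx)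
qed

lemma measurable_sections:
  assumes f: "f \<in> borel_measurable inar_input_space"
  shows "e \<in> space Inn \<Longrightarrow> (\<lambda>\<xi>. f (x, \<xi>, e)) \<in> borel_measurable Thin"
    and "\<xi> \<in> space Thin \<Longrightarrow> (\<lambda>e. f (x, \<xi>, e)) \<in> borel_measurable Inn"
proof -
  have f': "f \<in> borel_measurable (Start \<Otimes>\<^sub>M (Thin \<Otimes>\<^sub>M Inn))"
    using f by (simp only: measurable_Q[symmetric] Q_eq)
  show "(\<lambda>\<xi>. f (x, \<xi>, e)) \<in> borel_measurable Thin" if "e \<in> space Inn"
    using that by (intro measurable_compose[OF _ f']) simp
  show "(\<lambda>e. f (x, \<xi>, e)) \<in> borel_measurable Inn" if "\<xi> \<in> space Thin"
    using that by (intro measurable_compose[OF _ f']) simp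
qed

lemma nn_integral_fresh_thinning:
  assumes F: "F \<in> borel_measurable inar_input_space"
    and fresh: "\<And>z b. F (set_thinning (k, i) b z) = F z" and ki: "1 \<le> k" "1 \<le> i"
  shows "\<E> (\<lambda>z. F z * \<phi> (fst (snd z) (k, i))) = \<E> F * (\<integral>\<^sup>+b. \<phi> b \<partial>Ber)"
proof -
  have fresh': "F (x, \<xi>((k, i) := b), e) = F (x, \<xi>, e)" for x \<xi> e b
    using fresh[of b "(x, \<xi>, e)"] by (simp add: set_thinning_def)
  have G: "(\<lambda>z. F z * \<phi> (fst (snd z) (k, i))) \<in> borel_measurable inar_input_space"
    using F measurable_compose[OF thinning_measurable[OF ki], of \<phi> borel] by simp
  have F': "F \<in> borel_measurable (Start \<Otimes>\<^sub>M (Thin \<Otimes>\<^sub>M Inn))"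
    using F by (simp only: measurable_Q[symmetric] Q_eq)
  have meas: "(\<lambda>(x, e). \<integral>\<^sup>+\<xi>. F (x, \<xi>, e) \<partial>Thin) \<in> borel_measurable (Start \<Otimes>\<^sub>M Inn)"
    using F' by measurable
  have "\<E> (\<lambda>z. F z * \<phi> (fst (snd z) (k, i))) =
      (\<integral>\<^sup>+x. \<integral>\<^sup>+e. \<integral>\<^sup>+\<xi>. F (x, \<xi>, e) * \<phi> (\<xi> (k, i)) \<partial>Thin \<partial>Inn \<partial>Start)"
    by (subst nn_integral_Q(1)[OF G]) simp
  also have "\<dots> = (\<integral>\<^sup>+x. \<integral>\<^sup>+e. (\<integral>\<^sup>+\<xi>. F (x, \<xi>, e) \<partial>Thin) * (\<integral>\<^sup>+b. \<phi> b \<partial>Ber) \<partial>Inn \<partial>Start)"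
    using ki by (intro nn_integral_cong nn_integral_PiM_fresh_coordinate[where M = "\<lambda>_. Ber"]
        prob_space_measure_pmf measurable_sections[OF F] fresh') auto
  also have "\<dots> = \<E> F * (\<integral>\<^sup>+b. \<phi> b \<partial>Ber)"
    using meas by (simp add: nn_integral_multc nn_integral_Q(1)[OF F])
  finally show ?thesis .
qed

lemma nn_integral_fresh_innovation:
  assumes F: "F \<in> borel_measurable inar_input_space"
    and fresh: "\<And>z b. F (set_innovation k b z) = F z" and k: "1 \<le> k"
  shows "\<E> (\<lambda>z. F z * \<phi> (snd (snd z) k)) = \<E> F * (\<integral>\<^sup>+b. \<phi> b \<partial>Poi)"
proof -
  have fresh': "F (x, \<xi>, e(k := b)) = F (x, \<xi>, e)" for x \<xi> e b
    using fresh[of b "(x, \<xi>, e)"] by (simp add: set_innovation_def)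
  have G: "(\<lambda>z. F z * \<phi> (snd (snd z) k)) \<in> borel_measurable inar_input_space"
    using F measurable_compose[OF innovation_measurable[OF k], of \<phi> borel] by simp
  have F': "F \<in> borel_measurable (Start \<Otimes>\<^sub>M (Thin \<Otimes>\<^sub>M Inn))"
    using F by (simp only: measurable_Q[symmetric] Q_eq)
  have meas: "(\<lambda>(x, \<xi>). \<integral>\<^sup>+e. F (x, \<xi>, e) \<partial>Inn) \<in> borel_measurable (Start \<Otimes>\<^sub>M Thin)"
    using F' by measurable
  have "\<E> (\<lambda>z. F z * \<phi> (snd (snd z) k)) =
      (\<integral>\<^sup>+x. \<integral>\<^sup>+\<xi>. \<integral>\<^sup>+e. F (x, \<xi>, e) * \<phi> (e k) \<partial>Inn \<partial>Thin \<partial>Start)"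
    by (subst nn_integral_Q(2)[OF G]) simp
  also have "\<dots> = (\<integral>\<^sup>+x. \<integral>\<^sup>+\<xi>. (\<integral>\<^sup>+e. F (x, \<xi>, e) \<partial>Inn) * (\<integral>\<^sup>+b. \<phi> b \<partial>Poi) \<partial>Thin \<partial>Start)"
    using k by (intro nn_integral_cong nn_integral_PiM_fresh_coordinate[where M = "\<lambda>_. Poi"]
        prob_space_measure_pmf measurable_sections[OF F] fresh') auto
  also have "\<dots> = \<E> F * (\<integral>\<^sup>+b. \<phi> b \<partial>Poi)"
    using meas by (simp add: nn_integral_multc nn_integral_Q(2)[OF F])
  finally show ?thesis .
qed


lemma bernoulli_moments:
  "(\<integral>\<^sup>+b. ennreal (real b) \<partial>Ber) = ennreal a" "(\<integral>\<^sup>+b. ennreal ((real b)\<^sup>2) \<partial>Ber) = ennreal a"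
  using a_bounds by simp_all

text \<open>
The weight \<open>F\<close> plays the role of conditioning on the past: \<open>t1\<close> and \<open>t2\<close> are the conditional moments of \<open>T\<close>.
\<close>

lemma add_independent_moments:
  fixes F :: "inar_input \<Rightarrow> ennreal" and T \<eta> :: "inar_input \<Rightarrow> nat" and R :: "nat measure"
  assumes F: "F \<in> borel_measurable inar_input_space"
    and T: "T \<in> measurable inar_input_space (count_space UNIV)"
    and \<eta>: "\<eta> \<in> measurable inar_input_space (count_space UNIV)"
    and indep: "\<And>g h :: nat \<Rightarrow> real. \<E> (\<lambda>z. F z * ennreal (g (T z)) * ennreal (h (\<eta> z))) =
      \<E> (\<lambda>z. F z * ennreal (g (T z))) * (\<integral>\<^sup>+b. ennreal (h b) \<partial>R)"
    and R1: "(\<integral>\<^sup>+b. ennreal (real b) \<partial>R) = ennreal e1"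
    and R2: "(\<integral>\<^sup>+b. ennreal ((real b)\<^sup>2) \<partial>R) = ennreal e2"
    and T1: "\<E> (\<lambda>z. F z * ennreal (real (T z))) = \<E> F * ennreal t1"
    and T2: "\<E> (\<lambda>z. F z * ennreal ((real (T z))\<^sup>2)) = \<E> F * ennreal t2"
    and nonneg: "0 \<le> e1" "0 \<le> e2" "0 \<le> t1" "0 \<le> t2"
  shows "\<E> (\<lambda>z. F z * ennreal (real (T z + \<eta> z))) = \<E> F * ennreal (t1 + e1)" (is ?first)
    and "\<E> (\<lambda>z. F z * ennreal ((real (T z + \<eta> z))\<^sup>2)) =
      \<E> F * ennreal (t2 + 2 * t1 * e1 + e2)" (is ?second)
proof -
  have FT: "(\<lambda>z. F z * ennreal (g (T z))) \<in> borel_measurable Q" for g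
    using F measurable_compose[OF T, of "\<lambda>n. ennreal (g n)" borel] by (simp add: measurable_Q)
  have FT\<eta>: "(\<lambda>z. F z * ennreal (g (T z)) * ennreal (h (\<eta> z))) \<in> borel_measurable Q" for g h
    using FT measurable_compose[OF \<eta>, of "\<lambda>n. ennreal (h n)" borel] by (simp add: measurable_Q)
  have "\<E> (\<lambda>z. F z * ennreal (real (T z + \<eta> z))) =
      \<E> (\<lambda>z. F z * ennreal (real (T z)) + F z * ennreal 1 * ennreal (real (\<eta> z)))"
    by (simp add: distrib_left)
  also have "\<dots> = \<E> F * ennreal t1 + \<E> F * ennreal e1"
    using FT[of real] FT\<eta>[of "\<lambda>_. 1" real] indep[of "\<lambda>_. 1" real, unfolded R1]
    by (subst nn_integral_add) (simp_all add: T1)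
  finally show ?first
    using nonneg by (simp add: distrib_left)
  have "F z * ennreal ((real (T z + \<eta> z))\<^sup>2) = F z * ennreal ((real (T z))\<^sup>2) +
      (F z * ennreal (2 * real (T z)) * ennreal (real (\<eta> z)) + F z * ennreal 1 * ennreal ((real (\<eta> z))\<^sup>2))" for z
  proof -
    have "ennreal ((real (T z + \<eta> z))\<^sup>2) = ennreal ((real (T z))\<^sup>2) +
      (ennreal (2 * real (T z)) * ennreal (real (\<eta> z)) + ennreal ((real (\<eta> z))\<^sup>2))"
      by (simp add: power2_sum ennreal_mult[symmetric] ennreal_plus[symmetric] algebra_simps del: ennreal_plus)
    then show ?thesis by (simp add: distrib_left mult.assoc)
  qed
  then have "\<E> (\<lambda>z. F z * ennreal ((real (T z + \<eta> z))\<^sup>2)) = \<E> (\<lambda>z. F z * ennreal ((real (T z))\<^sup>2)) +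
      (\<E> (\<lambda>z. F z * ennreal (2 * real (T z)) * ennreal (real (\<eta> z))) +
       \<E> (\<lambda>z. F z * ennreal 1 * ennreal ((real (\<eta> z))\<^sup>2)))"
    using FT[of "\<lambda>n. (real n)\<^sup>2"] FT\<eta>[of "\<lambda>n. 2 * real n" real] FT\<eta>[of "\<lambda>_. 1" "\<lambda>n. (real n)\<^sup>2"]
    by (simp add: nn_integral_add)
  also have "\<E> (\<lambda>z. F z * ennreal (2 * real (T z)) * ennreal (real (\<eta> z))) =
      \<E> (\<lambda>z. F z * ennreal (real (T z)) * 2) * ennreal e1"
    unfolding indep[of "\<lambda>n. 2 * real n" real] R1 by (simp add: ennreal_mult mult_ac)
  also have "\<E> (\<lambda>z. F z * ennreal (real (T z)) * 2) = \<E> F * ennreal t1 * ennreal 2"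
    using FT[of real] by (simp add: nn_integral_multc T1)
  also have "\<E> (\<lambda>z. F z * ennreal 1 * ennreal ((real (\<eta> z))\<^sup>2)) = \<E> F * ennreal e2"
    unfolding indep[of "\<lambda>_. 1" "\<lambda>n. (real n)\<^sup>2"] R2 by simp
  also have "\<E> (\<lambda>z. F z * ennreal ((real (T z))\<^sup>2)) + (\<E> F * ennreal t1 * ennreal 2 * ennreal e1
      + \<E> F * ennreal e2) =
      \<E> F * (ennreal t2 + (ennreal t1 * ennreal 2 * ennreal e1 + ennreal e2))"
    unfolding T2 by (simp only: distrib_left mult.assoc)
  also have "ennreal t2 + (ennreal t1 * ennreal 2 * ennreal e1 + ennreal e2) = ennreal (t2 + 2 * t1 * e1 + e2)"
    using nonneg by (simp only: ennreal_mult[symmetric] ennreal_plus[symmetric] mult_nonneg_nonneg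
        add_nonneg_nonneg zero_le_numeral mult.commute[of t1 2] add.assoc)
  finally show ?second .
qed

lemma thinned_sum_measurable:
  "(\<lambda>z. \<Sum>i=1..m. fst (snd z) (Suc k, i)) \<in> measurable inar_input_space (count_space UNIV)"
  by (intro nat_sum_measurable thinning_measurable) auto

text \<open>
The sum of \<open>m\<close> fresh thinning variables has the first two moments of a binomial variable even when weighted by a
function \<open>F\<close> of the past. Adding one variable at a time, the second moment grows by twice the cross term and by \<open>a\<close>.
\<close>

lemma thinned_sum_moments:
  fixes F :: "inar_input \<Rightarrow> ennreal"
  assumes F: "F \<in> borel_measurable inar_input_space" and det: "determined_upto k F"
  defines "T \<equiv> \<lambda>m z. \<Sum>i=1..m. fst (snd z) (Suc k, i)"
  shows "\<E> (\<lambda>z. F z * ennreal (real (T m z))) = \<E> F * ennreal (real m * a)"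
    and "\<E> (\<lambda>z. F z * ennreal ((real (T m z))\<^sup>2)) =
      \<E> F * ennreal (real m * a * (1 - a) + (real m * a)\<^sup>2)"
proof (induction m)
  case 0
  show "\<E> (\<lambda>z. F z * ennreal (real (T 0 z))) = \<E> F * ennreal (real 0 * a)"
    "\<E> (\<lambda>z. F z * ennreal ((real (T 0 z))\<^sup>2)) =
      \<E> F * ennreal (real 0 * a * (1 - a) + (real 0 * a)\<^sup>2)"
    by (simp_all add: T_def)
next
  case (Suc m)
  let ?\<xi> = "\<lambda>z. fst (snd z) (Suc k, Suc m) :: nat"
  have T_Suc: "T (Suc m) z = T m z + ?\<xi> z" for z by (simp add: T_def)
  have T_meas: "T m \<in> measurable inar_input_space (count_space UNIV)"
    unfolding T_def by (rule thinned_sum_measurable)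
  have \<xi>_meas: "?\<xi> \<in> measurable inar_input_space (count_space UNIV)"
    by (rule thinning_measurable) simp_all
  have T_fresh: "T m (set_thinning (Suc k, Suc m) b z) = T m z" for b z
    unfolding T_def by (intro sum.cong) auto
  have FT: "(\<lambda>z. F z * ennreal (g (T m z))) \<in> borel_measurable inar_input_space" for g
    using F measurable_compose[OF T_meas, of "\<lambda>n. ennreal (g n)" borel] by simp
  have indep: "\<E> (\<lambda>z. F z * ennreal (g (T m z)) * ennreal (h (?\<xi> z))) =
      \<E> (\<lambda>z. F z * ennreal (g (T m z))) * (\<integral>\<^sup>+b. ennreal (h b) \<partial>Ber)" for g h :: "nat \<Rightarrow> real"
    using FT[of g] determined_uptoD(2)[OF det]
    by (intro nn_integral_fresh_thinning) (simp_all add: T_fresh)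
  have nonneg: "0 \<le> a" "0 \<le> real m * a" "0 \<le> real m * a * (1 - a) + (real m * a)\<^sup>2"
    using a_bounds by simp_all
  note step = add_independent_moments[OF F T_meas \<xi>_meas indep bernoulli_moments Suc.IH nonneg(1,1,2,3)]
  have "real m * a + a = real (Suc m) * a" by (simp add: algebra_simps)
  with step(1) show "\<E> (\<lambda>z. F z * ennreal (real (T (Suc m) z))) =
      \<E> F * ennreal (real (Suc m) * a)"
    by (simp only: T_Suc)
  have "real m * a * (1 - a) + (real m * a)\<^sup>2 + 2 * (real m * a) * a + a =
      real (Suc m) * a * (1 - a) + (real (Suc m) * a)\<^sup>2"
    by (simp add: algebra_simps power2_eq_square)
  with step(2) show "\<E> (\<lambda>z. F z * ennreal ((real (T (Suc m) z))\<^sup>2)) =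
      \<E> F * ennreal (real (Suc m) * a * (1 - a) + (real (Suc m) * a)\<^sup>2)"
    by (simp only: T_Suc)
qed

text \<open>
The Markov property for moments: decomposing by the value \<open>m\<close> of the process at time \<open>k\<close> makes the number of
summands in the recursion deterministic.
\<close>

lemma markov_step:
  fixes H :: "inar_input \<Rightarrow> ennreal" and g c :: "nat \<Rightarrow> real"
  assumes H: "H \<in> borel_measurable inar_input_space" "determined_upto k H"
    and step: "\<And>F m. F \<in> borel_measurable inar_input_space \<Longrightarrow> determined_upto k F \<Longrightarrow>
      \<E> (\<lambda>z. F z * ennreal (g ((\<Sum>i=1..m. fst (snd z) (Suc k, i)) + snd (snd z) (Suc k))))
        = \<E> F * ennreal (c m)"
  shows "\<E> (\<lambda>z. H z * ennreal (g (inar_path z (Suc k)))) =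
    \<E> (\<lambda>z. H z * ennreal (c (inar_path z k)))"
proof -
  define F where "F m z = H z * indicator {m} (inar_path z k)" for m z
  have F: "F m \<in> borel_measurable inar_input_space" for m
    unfolding F_def using H(1) measurable_compose[OF inar_path_measurable, of "indicator {m} :: nat \<Rightarrow> ennreal" borel k] by simp
  have det: "determined_upto k (F m)" for m
    using H(2) inar_path_determined[of k k] unfolding F_def determined_upto_def by simp
  have decomp: "H z * w (inar_path z k) z = (\<Sum>m. F m z * w m z)" for z and w :: "nat \<Rightarrow> inar_input \<Rightarrow> ennreal"
    by (subst suminf_finite[where N = "{inar_path z k}"]) (auto simp: F_def)
  let ?Y = "\<lambda>m z. (\<Sum>i=1..m. fst (snd z) (Suc k, i)) + snd (snd z) (Suc k) :: nat"
  have Y: "?Y m \<in> measurable inar_input_space (count_space UNIV)" for m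
  proof -
    have "(\<lambda>z. \<Sum>i=1..m. fst (snd z) (Suc k, i)) \<in> measurable inar_input_space (count_space UNIV)"
      by (rule thinned_sum_measurable)
    moreover have "(\<lambda>z. snd (snd z) (Suc k)) \<in> measurable inar_input_space (count_space UNIV)"
      by (rule innovation_measurable) simp
    ultimately show ?thesis by measurable
  qed
  have FY: "(\<lambda>z. F m z * ennreal (g (?Y m z))) \<in> borel_measurable Q" for m
    using F[of m] measurable_compose[OF Y[of m], of "\<lambda>n. ennreal (g n)" borel] by (simp add: measurable_Q)
  have "\<E> (\<lambda>z. H z * ennreal (g (inar_path z (Suc k)))) = \<E> (\<lambda>z. (\<Sum>m. F m z * ennreal (g (?Y m z))))"
    using decomp[of _ "\<lambda>m z. ennreal (g (?Y m z))"] by simp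
  also have "\<dots> = (\<Sum>m. \<E> (\<lambda>z. F m z * ennreal (g (?Y m z))))"
    by (rule nn_integral_suminf) (rule FY)
  also have "\<dots> = (\<Sum>m. \<E> (\<lambda>z. F m z * ennreal (c m)))"
    using F by (simp only: step[OF F det]) (simp add: nn_integral_multc measurable_Q)
  also have "\<dots> = \<E> (\<lambda>z. (\<Sum>m. F m z * ennreal (c m)))"
    using F by (intro nn_integral_suminf[symmetric]) (simp add: measurable_Q)
  also have "\<dots> = \<E> (\<lambda>z. H z * ennreal (c (inar_path z k)))"
    using decomp[of _ "\<lambda>m z. ennreal (c m)"] by simp
  finally show ?thesis .
qed

lemma thinned_sum_plus_innovation_moments:
  fixes F :: "inar_input \<Rightarrow> ennreal"
  assumes F: "F \<in> borel_measurable inar_input_space" and det: "determined_upto k F"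
  defines "Y \<equiv> \<lambda>m z. (\<Sum>i=1..m. fst (snd z) (Suc k, i)) + snd (snd z) (Suc k)"
  shows "\<E> (\<lambda>z. F z * ennreal (real (Y m z))) = \<E> F * ennreal (a * real m + l)" (is ?first)
    and "\<E> (\<lambda>z. F z * ennreal ((real (Y m z))\<^sup>2)) =
      \<E> F * ennreal (a * (1 - a) * real m + l + (a * real m + l)\<^sup>2)" (is ?second)
proof -
  define T where "T z = (\<Sum>i=1..m. fst (snd z) (Suc k, i))" for z :: inar_input
  let ?\<epsilon> = "\<lambda>z. snd (snd z) (Suc k) :: nat"
  have Y: "Y m z = T z + ?\<epsilon> z" for z by (simp add: Y_def T_def)
  have T_meas: "T \<in> measurable inar_input_space (count_space UNIV)"
    unfolding T_def by (rule thinned_sum_measurable)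
  have \<epsilon>_meas: "?\<epsilon> \<in> measurable inar_input_space (count_space UNIV)"
    by (rule innovation_measurable) simp
  have FT: "(\<lambda>z. F z * ennreal (g (T z))) \<in> borel_measurable inar_input_space" for g
    using F measurable_compose[OF T_meas, of "\<lambda>n. ennreal (g n)" borel] by simp
  have indep: "\<E> (\<lambda>z. F z * ennreal (g (T z)) * ennreal (h (?\<epsilon> z))) =
      \<E> (\<lambda>z. F z * ennreal (g (T z))) * (\<integral>\<^sup>+b. ennreal (h b) \<partial>Poi)" for g h :: "nat \<Rightarrow> real"
    using FT[of g] determined_uptoD(1)[OF det]
    by (intro nn_integral_fresh_innovation) (simp_all add: T_def)
  have nonneg: "0 \<le> l" "0 \<le> l + l\<^sup>2" "0 \<le> real m * a" "0 \<le> real m * a * (1 - a) + (real m * a)\<^sup>2"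
    using a_bounds l_pos by simp_all
  note step = add_independent_moments[OF F T_meas \<epsilon>_meas indep poisson_moments[OF l_pos]
      thinned_sum_moments[OF F det, of m, folded T_def] nonneg]
  show ?first
    using step(1) by (simp only: Y mult.commute[of "real m"])
  have "real m * a * (1 - a) + (real m * a)\<^sup>2 + 2 * (real m * a) * l + (l + l\<^sup>2) =
      a * (1 - a) * real m + l + (a * real m + l)\<^sup>2"
    by (simp add: algebra_simps power2_eq_square)
  with step(2) show ?second
    by (simp only: Y)
qed

lemma markov_mean_step:
  assumes H: "H \<in> borel_measurable inar_input_space" "determined_upto k H"
  shows "\<E> (\<lambda>z. H z * ennreal (real (inar_path z (Suc k)))) =
    \<E> (\<lambda>z. H z * ennreal (a * real (inar_path z k) + l))"
proof (rule markov_step[OF H, where c = "\<lambda>m. a * real m + l"])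
  fix F :: "inar_input \<Rightarrow> ennreal" and m assume F: "F \<in> borel_measurable inar_input_space" "determined_upto k F"
  show "\<E> (\<lambda>z. F z * ennreal (real ((\<Sum>i=1..m. fst (snd z) (Suc k, i)) + snd (snd z) (Suc k)))) =
      \<E> F * ennreal (a * real m + l)"
    by (rule thinned_sum_plus_innovation_moments(1)[OF F])
qed

lemma markov_square_step:
  assumes H: "H \<in> borel_measurable inar_input_space" "determined_upto k H"
  shows "\<E> (\<lambda>z. H z * ennreal ((real (inar_path z (Suc k)))\<^sup>2)) =
    \<E> (\<lambda>z. H z * ennreal (a * (1 - a) * real (inar_path z k) + l + (a * real (inar_path z k) + l)\<^sup>2))"
proof (rule markov_step[OF H, where g = "\<lambda>n. (real n)\<^sup>2"
      and c = "\<lambda>m. a * (1 - a) * real m + l + (a * real m + l)\<^sup>2"])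
  fix F :: "inar_input \<Rightarrow> ennreal" and m assume F: "F \<in> borel_measurable inar_input_space" "determined_upto k F"
  show "\<E> (\<lambda>z. F z * ennreal ((real ((\<Sum>i=1..m. fst (snd z) (Suc k, i)) + snd (snd z) (Suc k)))\<^sup>2)) =
      \<E> F * ennreal (a * (1 - a) * real m + l + (a * real m + l)\<^sup>2)"
    by (rule thinned_sum_plus_innovation_moments(2)[OF F])
qed

lemma determined_upto_const: "determined_upto k (\<lambda>_. c)"
  by (simp add: determined_upto_def)

abbreviation "\<mu> \<equiv> l / (1 - a)"

lemma \<mu>_pos: "0 < \<mu>" and \<mu>_fixpoint: "a * \<mu> + l = \<mu>"
  using l_pos a_bounds by (simp_all add: field_simps)

lemma path_ennreal_measurable: "(\<lambda>z. ennreal (g (inar_path z k))) \<in> borel_measurable Q"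
  using measurable_compose[OF inar_path_measurable, of "\<lambda>n. ennreal (g n)" borel] by (simp add: measurable_Q)

lemma nn_integral_Q_start: "\<E> (\<lambda>z. ennreal (g (fst z))) = (\<integral>\<^sup>+n. ennreal (g n) \<partial>Start)"
proof -
  have "(\<lambda>z. ennreal (g (fst z))) \<in> borel_measurable inar_input_space"
    using path_ennreal_measurable[of g 0] by (simp add: measurable_Q)
  from nn_integral_Q(1)[OF this] show ?thesis
    by (simp add: Thin.emeasure_space_1 Inn.emeasure_space_1 del: One_nat_def)
qed

lemma path_mean: "\<E> (\<lambda>z. ennreal (real (inar_path z k))) = ennreal \<mu>"
proof (induction k)
  case 0
  then show ?case using nn_integral_Q_start[of real] poisson_moments(1)[OF \<mu>_pos] by simp
next
  case (Suc k)
  have "\<E> (\<lambda>z. ennreal (real (inar_path z (Suc k)))) = \<E> (\<lambda>z. 1 * ennreal (a * real (inar_path z k) + l))"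
    using markov_mean_step[OF _ determined_upto_const[of k 1]] by (simp del: inar_path.simps)
  also have "\<dots> = \<E> (\<lambda>z. ennreal a * ennreal (real (inar_path z k)) + ennreal l)"
    using a_bounds l_pos by (simp add: ennreal_mult)
  also have "\<dots> = ennreal a * ennreal \<mu> + ennreal l"
    using path_ennreal_measurable[of real k]
    by (simp add: nn_integral_add nn_integral_cmult Suc Q.emeasure_space_1)
  also have "\<dots> = ennreal (a * \<mu> + l)"
    using a_bounds l_pos \<mu>_pos
    by (simp only: ennreal_mult[symmetric] ennreal_plus[symmetric] mult_nonneg_nonneg less_imp_le)
  finally show ?case by (simp only: \<mu>_fixpoint)
qed

text \<open>
The mean and the second moment of the Poisson stationary law are reproduced by one step of the recursion; this is
all the stationarity that second-order properties need.
\<close>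

lemma path_second_moment: "\<E> (\<lambda>z. ennreal ((real (inar_path z k))\<^sup>2)) = ennreal (\<mu> + \<mu>\<^sup>2)"
proof (induction k)
  case 0
  then show ?case using nn_integral_Q_start[of "\<lambda>n. (real n)\<^sup>2"] poisson_moments(2)[OF \<mu>_pos] by simp
next
  case (Suc k)
  have "\<E> (\<lambda>z. ennreal ((real (inar_path z (Suc k)))\<^sup>2)) =
      \<E> (\<lambda>z. 1 * ennreal (a * (1 - a) * real (inar_path z k) + l + (a * real (inar_path z k) + l)\<^sup>2))"
    using markov_square_step[OF _ determined_upto_const[of k 1]] by (simp del: inar_path.simps)
  also have "\<dots> = \<E> (\<lambda>z. ennreal (a * (1 - a) + 2 * a * l) * ennreal (real (inar_path z k)) +
      (ennreal (a\<^sup>2) * ennreal ((real (inar_path z k))\<^sup>2) + ennreal (l + l\<^sup>2)))"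
  proof (rule nn_integral_cong)
    fix z
    \<comment> \<open>Regrouped with nonnegative coefficients only, as extended nonnegative arithmetic has no subtraction.\<close>
    have "a * (1 - a) * x + l + (a * x + l)\<^sup>2 = (a * (1 - a) + 2 * a * l) * x + (a\<^sup>2 * x\<^sup>2 + (l + l\<^sup>2))" for x
      by (simp add: power2_eq_square algebra_simps)
    then show "1 * ennreal (a * (1 - a) * real (inar_path z k) + l + (a * real (inar_path z k) + l)\<^sup>2) =
        ennreal (a * (1 - a) + 2 * a * l) * ennreal (real (inar_path z k)) +
        (ennreal (a\<^sup>2) * ennreal ((real (inar_path z k))\<^sup>2) + ennreal (l + l\<^sup>2))"
      using a_bounds l_pos
      by (simp only: ennreal_mult[symmetric] ennreal_plus[symmetric] mult_nonneg_nonneg add_nonneg_nonneg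
          of_nat_0_le_iff zero_le_power2 less_imp_le zero_le_numeral diff_ge_0_iff_ge mult_1)
  qed
  also have "\<dots> = ennreal (a * (1 - a) + 2 * a * l) * ennreal \<mu> + (ennreal (a\<^sup>2) * ennreal (\<mu> + \<mu>\<^sup>2) + ennreal (l + l\<^sup>2))"
    using path_ennreal_measurable[of real k] path_ennreal_measurable[of "\<lambda>n. (real n)\<^sup>2" k]
    by (simp add: nn_integral_add nn_integral_cmult Suc path_mean Q.emeasure_space_1 del: ennreal_plus)
  also have "\<dots> = ennreal ((a * (1 - a) + 2 * a * l) * \<mu> + (a\<^sup>2 * (\<mu> + \<mu>\<^sup>2) + (l + l\<^sup>2)))"
    using a_bounds l_pos \<mu>_pos
    by (simp only: ennreal_mult[symmetric] ennreal_plus[symmetric] mult_nonneg_nonneg add_nonneg_nonneg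
        of_nat_0_le_iff zero_le_power2 less_imp_le zero_le_numeral diff_ge_0_iff_ge)
  also have "(a * (1 - a) + 2 * a * l) * \<mu> + (a\<^sup>2 * (\<mu> + \<mu>\<^sup>2) + (l + l\<^sup>2)) = (a * \<mu> + l) + (a * \<mu> + l)\<^sup>2"
    by (simp add: power2_eq_square algebra_simps del: times_divide_eq_right times_divide_eq_left)
  also have "\<dots> = \<mu> + \<mu>\<^sup>2" by (simp only: \<mu>_fixpoint)
  finally show ?case .
qed

text \<open>
Each step multiplies the covariance with \<open>X k\<close> by the thinning parameter.
\<close>

proposition path_product_moment:
  "\<E> (\<lambda>z. ennreal (real (inar_path z k)) * ennreal (real (inar_path z (k + h)))) = ennreal (a ^ h * \<mu> + \<mu>\<^sup>2)"
proof (induction h)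
  case 0
  then show ?case using path_second_moment[of k] by (simp add: power2_eq_square ennreal_mult)
next
  case (Suc h)
  have "\<E> (\<lambda>z. ennreal (real (inar_path z k)) * ennreal (real (inar_path z (k + Suc h)))) =
      \<E> (\<lambda>z. ennreal (real (inar_path z k)) * ennreal (a * real (inar_path z (k + h)) + l))"
  proof -
    have "determined_upto (k + h) (\<lambda>z. ennreal (real (inar_path z k)))"
      using inar_path_determined[of k "k + h"] by (simp add: determined_upto_def)
    from markov_mean_step[OF _ this] show ?thesis
      using path_ennreal_measurable[of real k] by (simp add: measurable_Q del: inar_path.simps)
  qed
  also have "\<dots> = \<E> (\<lambda>z. ennreal a * (ennreal (real (inar_path z k)) * ennreal (real (inar_path z (k + h)))) +
      ennreal l * ennreal (real (inar_path z k)))"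
    using a_bounds l_pos by (simp add: ennreal_mult distrib_left mult_ac)
  also have "\<dots> = ennreal a * ennreal (a ^ h * \<mu> + \<mu>\<^sup>2) + ennreal l * ennreal \<mu>"
    using path_ennreal_measurable[of real k] path_ennreal_measurable[of real "k + h"]
    by (simp add: nn_integral_add nn_integral_cmult Suc path_mean del: ennreal_plus)
  also have "\<dots> = ennreal (a * (a ^ h * \<mu> + \<mu>\<^sup>2) + l * \<mu>)"
    using a_bounds l_pos \<mu>_pos
    by (simp only: ennreal_mult[symmetric] ennreal_plus[symmetric] mult_nonneg_nonneg add_nonneg_nonneg
        zero_le_power zero_le_power2 less_imp_le)
  also have "a * (a ^ h * \<mu> + \<mu>\<^sup>2) + l * \<mu> = a ^ Suc h * \<mu> + \<mu> * (a * \<mu> + l)"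
    by (simp add: power2_eq_square algebra_simps del: times_divide_eq_right times_divide_eq_left)
  also have "\<dots> = a ^ Suc h * \<mu> + \<mu>\<^sup>2" by (simp only: \<mu>_fixpoint power2_eq_square)
  finally show ?case .
qed

end

section \<open>Conditioning on the random thinning parameter\<close>

lemma measurable_pmf_kernel:
  fixes p :: "'a \<Rightarrow> nat pmf"
  assumes "\<And>n. (\<lambda>x. pmf (p x) n) \<in> borel_measurable N"
  shows "(\<lambda>x. measure_pmf (p x)) \<in> measurable N (subprob_algebra (count_space UNIV))"
proof (rule measurable_subprob_algebra)
  fix A :: "nat set"
  have "(\<lambda>x. \<Sum>n. ennreal (pmf (p x) n) * indicator A n) \<in> borel_measurable N"
    using assms by measurable
  moreover have "emeasure (measure_pmf (p x)) A = (\<Sum>n. ennreal (pmf (p x) n) * indicator A n)" for x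
    by (simp add: nn_integral_indicator[symmetric] nn_integral_measure_pmf nn_integral_count_space_nat
        del: nn_integral_indicator)
  ultimately show "(\<lambda>x. emeasure (measure_pmf (p x)) A) \<in> borel_measurable N" by simp
qed (simp_all add: prob_space_imp_subprob_space prob_space_measure_pmf)

text \<open>
On the generating cylinder sets the product measure is a finite product of measurable functions of the parameter.
\<close>

lemma measurable_PiM_kernel:
  assumes K: "\<And>i. i \<in> I \<Longrightarrow> K i \<in> measurable N (subprob_algebra (M i))"
    and prob: "\<And>i x. i \<in> I \<Longrightarrow> x \<in> space N \<Longrightarrow> prob_space (K i x)"
  shows "(\<lambda>x. PiM I (\<lambda>i. K i x)) \<in> measurable N (subprob_algebra (PiM I M))"
proof -
  have sets_K: "sets (K i x) = sets (M i)" if "i \<in> I" "x \<in> space N" for i x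
    using K[OF that(1)] that(2) by (rule sets_kernel)
  have space_K: "space (K i x) = space (M i)" if "i \<in> I" "x \<in> space N" for i x
    using sets_K[OF that] by (rule sets_eq_imp_space_eq)
  show ?thesis
  proof (rule measurable_subprob_algebra_generated[OF sets_PiM Int_stable_prod_algebra prod_algebra_sets_into_space])
    fix x assume x: "x \<in> space N"
    have "prob_space (PiM I (\<lambda>i. K i x))" using prob x by (intro prob_space_PiM) auto
    then show "subprob_space (PiM I (\<lambda>i. K i x))" by (rule prob_space_imp_subprob_space)
    show "sets (PiM I (\<lambda>i. K i x)) = sets (PiM I M)" using sets_K x by (intro sets_PiM_cong) auto
  next
    fix A assume "A \<in> prod_algebra I M"
    from prod_algebraE[OF this] obtain J E where A: "A = prod_emb I M J (Pi\<^sub>E J E)" "finite J"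
      "J \<noteq> {} \<or> I = {}" "J \<subseteq> I" and E: "\<And>i. i \<in> J \<Longrightarrow> E i \<in> sets (M i)" by blast
    have "emeasure (PiM I (\<lambda>i. K i x)) A = (\<Prod>i\<in>J. emeasure (K i x) (E i))" if x: "x \<in> space N" for x
    proof -
      have J: "i \<in> I" if "i \<in> J" for i using A(4) that by blast
      have "prod_emb I M J (Pi\<^sub>E J E) = prod_emb I (\<lambda>i. K i x) J (Pi\<^sub>E J E)"
        unfolding prod_emb_def using space_K x by (auto simp: PiE_iff space_PiM)
      then have "emeasure (PiM I (\<lambda>i. K i x)) A =
          emeasure (PiM I (\<lambda>i. K i x)) (prod_emb I (\<lambda>i. K i x) J (Pi\<^sub>E J E))"
        unfolding A(1) by (rule arg_cong)
      also have "\<dots> = (\<Prod>i\<in>J. emeasure (K i x) (E i))"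
        using A(2,4) E by (intro emeasure_PiM_emb prob x) (simp_all add: sets_K[OF J x])
      finally show ?thesis .
    qed
    moreover have "(\<lambda>x. \<Prod>i\<in>J. emeasure (K i x) (E i)) \<in> borel_measurable N"
    proof (rule borel_measurable_prod_ennreal)
      fix i assume "i \<in> J"
      then show "(\<lambda>x. emeasure (K i x) (E i)) \<in> borel_measurable N"
        using A(4) by (intro measurable_compose[OF K measurable_emeasure_subprob_algebra[OF E]]) blast
    qed
    ultimately show "(\<lambda>x. emeasure (PiM I (\<lambda>i. K i x)) A) \<in> borel_measurable N"
      by (simp cong: measurable_cong)
  next
    have "emeasure (PiM I (\<lambda>i. K i x)) (\<Pi>\<^sub>E i\<in>I. space (M i)) = 1" if x: "x \<in> space N" for x
    proof -
      interpret prob_space "PiM I (\<lambda>i. K i x)" using prob x by (intro prob_space_PiM) auto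
      have "(\<Pi>\<^sub>E i\<in>I. space (M i)) = space (PiM I (\<lambda>i. K i x))"
        using space_K x by (auto simp: space_PiM PiE_iff)
      then show ?thesis using emeasure_space_1 by simp
    qed
    then show "(\<lambda>x. emeasure (PiM I (\<lambda>i. K i x)) (\<Pi>\<^sub>E i\<in>I. space (M i))) \<in> borel_measurable N"
      by (simp cong: measurable_cong)
  qed
qed

text \<open>
Outside the unit interval the input law is not a meaningful object (the Poisson rate may be negative), so it is
replaced there by the law for an arbitrary admissible parameter to get a kernel on the whole real line.
\<close>

definition inar_kernel :: "real \<Rightarrow> real \<Rightarrow> inar_input measure" where
  "inar_kernel l a = inar_input_law l (if 0 < a \<and> a < 1 then a else 1 / 2)"

lemma inar_kernel_measurable:
  assumes "0 < l"
  shows "inar_kernel l \<in> measurable borel (subprob_algebra inar_input_space)"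
proof -
  define c where "c a = (if 0 < a \<and> a < 1 then a else 1 / 2)" for a :: real
  have c01: "0 < c a \<and> c a < 1" for a by (simp add: c_def)
  have c: "0 < c a" "c a < 1" "0 \<le> c a" "c a \<le> 1" "0 < l / (1 - c a)" for a
    using c01[of a] assms by simp_all
  have c_meas [measurable]: "c \<in> borel_measurable borel" unfolding c_def by measurable
  have start: "(\<lambda>a. measure_pmf (poisson_pmf (l / (1 - c a)))) \<in> measurable borel (subprob_algebra (count_space UNIV))"
  proof (rule measurable_pmf_kernel)
    fix n
    have "(\<lambda>a. (l / (1 - c a)) ^ n / fact n * exp (- (l / (1 - c a)))) \<in> borel_measurable borel"
      by measurable
    then show "(\<lambda>a. pmf (poisson_pmf (l / (1 - c a))) n) \<in> borel_measurable borel"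
      by (simp only: pmf_poisson[OF c(5)])
  qed
  have "(\<lambda>a. measure_pmf (map_pmf of_bool (bernoulli_pmf (c a)) :: nat pmf)) \<in> measurable borel (subprob_algebra (count_space UNIV))"
  proof (rule measurable_pmf_kernel)
    fix n :: nat
    have "pmf (map_pmf of_bool (bernoulli_pmf (c a))) n = (if n = 0 then 1 - c a else if n = 1 then c a else 0)" for a
    proof -
      have "(of_bool -` {n} :: bool set) = (if n = 0 then {False} else if n = 1 then {True} else {})"
      proof (rule set_eqI)
        fix b show "b \<in> of_bool -` {n} \<longleftrightarrow> b \<in> (if n = 0 then {False} else if n = 1 then {True} else {})"
          by (cases b) simp_all
      qed
      then show ?thesis using c[of a] by (simp add: pmf_map measure_pmf_single)
    qed
    then show "(\<lambda>a. pmf (map_pmf of_bool (bernoulli_pmf (c a))) n) \<in> borel_measurable borel" by simp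
  qed
  note ber = this
  have thin: "(\<lambda>a. PiM ({1..} \<times> {1..} :: (nat \<times> nat) set) (\<lambda>_. measure_pmf (map_pmf of_bool (bernoulli_pmf (c a))) :: nat measure))
      \<in> measurable borel (subprob_algebra (PiM ({1..} \<times> {1..}) (\<lambda>_. count_space UNIV)))"
    by (rule measurable_PiM_kernel[OF ber prob_space_measure_pmf])
  have inn: "(\<lambda>a :: real. PiM ({1..} :: nat set) (\<lambda>_. measure_pmf (poisson_pmf l)))
      \<in> measurable borel (subprob_algebra (PiM {1..} (\<lambda>_. count_space UNIV)))"
    by (rule measurable_PiM_kernel[OF measurable_pmf_kernel prob_space_measure_pmf]) simp
  have "inar_kernel l = (\<lambda>a. inar_input_law l (c a))" by (simp add: inar_kernel_def c_def fun_eq_iff)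
  then show ?thesis
    unfolding inar_input_law_def inar_input_space_def
    by (simp only: measurable_pair_measure[OF start measurable_pair_measure[OF thin inn]])
qed

lemma subalgebra_sigma_rv:
  assumes a: "a \<in> borel_measurable M" shows "subalgebra M (sigma_rv M a)"
  unfolding subalgebra_def
proof (intro conjI subsetI)
  fix A assume "A \<in> sets (sigma_rv M a)"
  then obtain C where "C \<in> sets borel" "A = a -` C \<inter> space M"
    by (auto simp: sets_vimage_algebra2)
  then show "A \<in> sets M" using measurable_sets[OF a] by simp
qed simp

text \<open>
The definition of a regular conditional distribution fixes the joint law of \<open>(a, Z)\<close> on measurable rectangles,
and rectangles form an intersection-stable generator.
\<close>

lemma conditional_law_nn_integral:
  fixes K :: "real \<Rightarrow> 'b measure" and F :: "real \<times> 'b \<Rightarrow> ennreal"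
  assumes "prob_space M" and a: "a \<in> borel_measurable M"
    and K: "K \<in> measurable borel (subprob_algebra N)" and prob_K: "\<And>x. prob_space (K x)"
    and cond: "cond_distribution M a N Z (\<lambda>x. K x)"
    and F: "F \<in> borel_measurable (borel \<Otimes>\<^sub>M N)"
  shows "(\<integral>\<^sup>+\<omega>. F (a \<omega>, Z \<omega>) \<partial>M) = (\<integral>\<^sup>+\<omega>. \<integral>\<^sup>+z. F (a \<omega>, z) \<partial>K (a \<omega>) \<partial>M)"
proof -
  interpret prob_space M by fact
  have Z: "Z \<in> measurable M N" using cond by (simp add: cond_distribution_def)
  have sets_K: "sets (K x) = sets N" for x using K by (rule sets_kernel) simp
  interpret S: finite_measure_subalgebra M "sigma_rv M a" by unfold_locales (rule subalgebra_sigma_rv[OF a])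
  let ?P = "\<lambda>x. distr (K x) (borel \<Otimes>\<^sub>M N) (Pair x)"
  have P: "?P \<in> measurable borel (subprob_algebra (borel \<Otimes>\<^sub>M N))"
    by (rule measurable_distr2[OF _ K]) simp
  have Pair: "Pair x \<in> measurable (K x) (borel \<Otimes>\<^sub>M N)" for x
    using sets_K by (simp cong: measurable_cong_sets)
  have aZ: "(\<lambda>\<omega>. (a \<omega>, Z \<omega>)) \<in> measurable M (borel \<Otimes>\<^sub>M N)" using a Z by simp
  have rect: "emeasure M ((\<lambda>\<omega>. (a \<omega>, Z \<omega>)) -` (C \<times> E) \<inter> space M) =
      (\<integral>\<^sup>+\<omega>. emeasure (?P (a \<omega>)) (C \<times> E) \<partial>M)" if C: "C \<in> sets borel" and E: "E \<in> sets N" for C E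
  proof -
    let ?A = "a -` C \<inter> space M" and ?B = "Z -` E \<inter> space M"
    have A: "?A \<in> sets (sigma_rv M a)" using C by (rule in_vimage_algebra)
    have AM: "?A \<in> sets M" using measurable_sets[OF a C] .
    have BM: "?B \<in> sets M" using measurable_sets[OF Z E] .
    have Kmeas: "(\<lambda>\<omega>. measure (K (a \<omega>)) E) \<in> borel_measurable M"
      by (rule measurable_compose[OF a]) (rule measurable_compose[OF K measurable_measure_subprob_algebra[OF E]])
    have "measure M (?A \<inter> ?B) = (\<integral>\<omega>\<in>?A. indicator ?B \<omega> \<partial>M)"
    proof -
      have "(\<integral>\<omega>\<in>?A. indicator ?B \<omega> \<partial>M) = (\<integral>\<omega>. indicator (?A \<inter> ?B) \<omega> \<partial>M)"
        unfolding set_lebesgue_integral_def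
        by (rule Bochner_Integration.integral_cong) (simp_all add: indicator_def)
      also have "\<dots> = measure M (?A \<inter> ?B)"
        using AM BM by simp
      finally show ?thesis ..
    qed
    also have "\<dots> = (\<integral>\<omega>\<in>?A. real_cond_exp M (sigma_rv M a) (indicator ?B) \<omega> \<partial>M)"
      using A BM by (intro S.real_cond_exp_intA) (simp_all add: emeasure_eq_measure)
    also have "\<dots> = (\<integral>\<omega>\<in>?A. measure (K (a \<omega>)) E \<partial>M)"
    proof -
      have "AE \<omega> in M. real_cond_exp M (sigma_rv M a) (indicator ?B) \<omega> = measure (K (a \<omega>)) E"
        using cond E unfolding cond_distribution_def by blast
      then have "AE \<omega> in M. indicator ?A \<omega> *\<^sub>R real_cond_exp M (sigma_rv M a) (indicator ?B) \<omega> =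
          indicator ?A \<omega> *\<^sub>R measure (K (a \<omega>)) E"
        by eventually_elim simp
      with AM Kmeas show ?thesis
        unfolding set_lebesgue_integral_def by (intro integral_cong_AE) simp_all
    qed
    finally have measure_eq: "measure M (?A \<inter> ?B) = (\<integral>\<omega>. indicator ?A \<omega> * measure (K (a \<omega>)) E \<partial>M)"
      by (simp add: set_lebesgue_integral_def)
    have P_rect: "emeasure (?P x) (C \<times> E) = ennreal (indicator C x * measure (K x) E)" for x
    proof -
      interpret K: prob_space "K x" by (rule prob_K)
      have "Pair x -` (C \<times> E) \<inter> space (K x) = (if x \<in> C then E else {})"
        using sets.sets_into_space[OF E] sets_eq_imp_space_eq[OF sets_K[of x]] by auto
      then show ?thesis
        using C E Pair[of x] by (simp add: emeasure_distr K.emeasure_eq_measure)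
    qed
    have int: "integrable M (\<lambda>\<omega>. indicator ?A \<omega> * measure (K (a \<omega>)) E)"
    proof (rule integrable_const_bound[where B = 1])
      have "measure (K x) E \<le> 1" for x
        using prob_space.prob_le_1[OF prob_K[of x]] .
      then show "AE \<omega> in M. norm (indicator ?A \<omega> * measure (K (a \<omega>)) E) \<le> 1"
        by (auto simp: indicator_def)
      show "(\<lambda>\<omega>. indicator ?A \<omega> * measure (K (a \<omega>)) E) \<in> borel_measurable M"
        using AM Kmeas by simp
    qed
    have "(\<lambda>\<omega>. (a \<omega>, Z \<omega>)) -` (C \<times> E) \<inter> space M = ?A \<inter> ?B" by auto
    then have "emeasure M ((\<lambda>\<omega>. (a \<omega>, Z \<omega>)) -` (C \<times> E) \<inter> space M) = ennreal (measure M (?A \<inter> ?B))"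
      by (simp add: emeasure_eq_measure)
    also have "\<dots> = (\<integral>\<^sup>+\<omega>. ennreal (indicator ?A \<omega> * measure (K (a \<omega>)) E) \<partial>M)"
      unfolding measure_eq by (rule nn_integral_eq_integral[symmetric, OF int]) simp
    also have "\<dots> = (\<integral>\<^sup>+\<omega>. emeasure (?P (a \<omega>)) (C \<times> E) \<partial>M)"
      by (intro nn_integral_cong) (simp add: P_rect indicator_def)
    finally show ?thesis .
  qed
  let ?D = "distr M borel a" and ?J = "distr M (borel \<Otimes>\<^sub>M N) (\<lambda>\<omega>. (a \<omega>, Z \<omega>))"
  let ?G = "{A \<times> B |A B. A \<in> sets (borel :: real measure) \<and> B \<in> sets N}"
  have bind: "?J = ?D \<bind> ?P"
  proof (rule measure_eqI_generator_eq[OF Int_stable_pair_measure_generator[of borel N],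
        where A = "\<lambda>_. space borel \<times> space N"])
    let ?\<Omega> = "space borel \<times> space N :: (real \<times> 'b) set"
    show "?G \<subseteq> Pow ?\<Omega>"
      by (rule pair_measure_closed)
    show "sets (?J) = sigma_sets ?\<Omega> ?G"
      by (simp add: sets_pair_measure)
    show "sets (?D \<bind> ?P) = sigma_sets ?\<Omega> ?G"
      by (subst sets_bind[where N = "borel \<Otimes>\<^sub>M N"]) (simp_all add: sets_pair_measure)
    fix X assume "X \<in> ?G"
    then obtain C E where X: "X = C \<times> E" "C \<in> sets borel" "E \<in> sets N" by auto
    have PX: "(\<lambda>x. emeasure (?P x) X) \<in> borel_measurable borel"
      by (rule measurable_compose[OF P measurable_emeasure_subprob_algebra]) (simp add: X)
    have "emeasure (?D \<bind> ?P) X = (\<integral>\<^sup>+x. emeasure (?P x) X \<partial>?D)"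
      using P X by (intro emeasure_bind[where N = "borel \<Otimes>\<^sub>M N"]) simp_all
    also have "\<dots> = (\<integral>\<^sup>+\<omega>. emeasure (?P (a \<omega>)) X \<partial>M)"
      using a PX by (intro nn_integral_distr) simp_all
    also have "\<dots> = emeasure M ((\<lambda>\<omega>. (a \<omega>, Z \<omega>)) -` X \<inter> space M)"
      unfolding X(1) by (rule rect[symmetric]) (use X in simp_all)
    also have "\<dots> = emeasure (?J) X"
      using aZ X by (simp add: emeasure_distr)
    finally show "emeasure (?J) X = emeasure (?D \<bind> ?P) X" ..
  next
    show "range (\<lambda>_::nat. space borel \<times> space N) \<subseteq> ?G"
      by blast
    show "(\<Union>i::nat. space borel \<times> space N) = space (borel :: real measure) \<times> space N" by simp
    interpret D: prob_space "?J" by (rule prob_space_distr[OF aZ])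
    show "emeasure (?J) (space borel \<times> space N) \<noteq> \<infinity>" for i :: nat
      by simp
  qed
  have FP: "(\<lambda>x. \<integral>\<^sup>+y. F y \<partial>?P x) \<in> borel_measurable borel"
    by (rule measurable_compose[OF P nn_integral_measurable_subprob_algebra[OF F]])
  have "(\<integral>\<^sup>+\<omega>. F (a \<omega>, Z \<omega>) \<partial>M) = (\<integral>\<^sup>+y. F y \<partial>(?D \<bind> ?P))"
    unfolding bind[symmetric] by (rule nn_integral_distr[symmetric]) (use aZ F in simp_all)
  also have "\<dots> = (\<integral>\<^sup>+x. \<integral>\<^sup>+y. F y \<partial>?P x \<partial>?D)"
    using P by (intro nn_integral_bind[OF F]) simp
  also have "\<dots> = (\<integral>\<^sup>+\<omega>. \<integral>\<^sup>+y. F y \<partial>?P (a \<omega>) \<partial>M)"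
    using a FP by (intro nn_integral_distr) simp_all
  also have "\<dots> = (\<integral>\<^sup>+\<omega>. \<integral>\<^sup>+z. F (a \<omega>, z) \<partial>K (a \<omega>) \<partial>M)"
    using Pair F by (intro nn_integral_cong nn_integral_distr) simp_all
  finally show ?thesis .
qed

section \<open>Covariances of the randomized process\<close>

lemma integrable_integral_eqI:
  fixes f :: "'a \<Rightarrow> real"
  assumes "f \<in> borel_measurable M" "AE x in M. 0 \<le> f x" "0 \<le> c" "(\<integral>\<^sup>+x. ennreal (f x) \<partial>M) = ennreal c"
  shows "integrable M f" "(\<integral>x. f x \<partial>M) = c"
  using nn_integral_eq_integrable[of f M c] assms by simp_all

context fixed_thinning begin

lemma path_moments:
  "integrable Q (\<lambda>z. real (inar_path z k))" (is ?int1) "(\<integral>z. real (inar_path z k) \<partial>Q) = \<mu>" (is ?mom1)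
  "integrable Q (\<lambda>z. real (inar_path z k) * real (inar_path z (k + h)))" (is ?int2)
  "(\<integral>z. real (inar_path z k) * real (inar_path z (k + h)) \<partial>Q) = a ^ h * \<mu> + \<mu>\<^sup>2" (is ?mom2)
proof -
  have [measurable]: "(\<lambda>z. real (inar_path z k)) \<in> borel_measurable Q" for k
    using measurable_compose[OF inar_path_measurable, of real borel] by (simp add: measurable_Q)
  show ?int1 ?mom1
    using path_mean[of k] \<mu>_pos by (intro integrable_integral_eqI; simp)+
  have "\<E> (\<lambda>z. ennreal (real (inar_path z k) * real (inar_path z (k + h)))) = ennreal (a ^ h * \<mu> + \<mu>\<^sup>2)"
    using path_product_moment[of k h] by (simp add: ennreal_mult)
  moreover have "0 \<le> a ^ h * \<mu> + \<mu>\<^sup>2"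
    using \<mu>_pos a_bounds by (intro add_nonneg_nonneg mult_nonneg_nonneg) simp_all
  ultimately show ?int2
    ?mom2
    by (intro integrable_integral_eqI; simp)+
qed

text \<open>
The conditional covariance structure in quadratic form. Squares are used because nonnegative integrands can be
conditioned on the thinning parameter before integrability is known.
\<close>

lemma centred_square_moment:
  "\<E> (\<lambda>z. ennreal ((v * (real (inar_path z k) - \<mu>) + w * (real (inar_path z (k + h)) - \<mu>))\<^sup>2)) =
    ennreal ((v\<^sup>2 + w\<^sup>2 + 2 * v * w * a ^ h) * \<mu>)"
proof -
  let ?x = "\<lambda>z. real (inar_path z k)" and ?y = "\<lambda>z. real (inar_path z (k + h))"
  have expand: "(v * (?x z - \<mu>) + w * (?y z - \<mu>))\<^sup>2 = v\<^sup>2 * (?x z * ?x z) + w\<^sup>2 * (?y z * ?y z) +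
      2 * v * w * (?x z * ?y z) - 2 * \<mu> * (v + w) * v * ?x z - 2 * \<mu> * (v + w) * w * ?y z + \<mu>\<^sup>2 * (v + w)\<^sup>2" for z
  proof -
    have "(v * (x - m) + w * (y - m))\<^sup>2 = v\<^sup>2 * (x * x) + w\<^sup>2 * (y * y) + 2 * v * w * (x * y)
        - 2 * m * (v + w) * v * x - 2 * m * (v + w) * w * y + m\<^sup>2 * (v + w)\<^sup>2" for x y m :: real
      by (simp add: power2_eq_square algebra_simps)
    then show ?thesis .
  qed
  have xx: "integrable Q (\<lambda>z. ?x z * ?x z)" "(\<integral>z. ?x z * ?x z \<partial>Q) = \<mu> + \<mu>\<^sup>2"
    using path_moments(3,4)[of k 0] by simp_all
  have yy: "integrable Q (\<lambda>z. ?y z * ?y z)" "(\<integral>z. ?y z * ?y z \<partial>Q) = \<mu> + \<mu>\<^sup>2"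
    using path_moments(3,4)[of "k + h" 0] by simp_all
  note ints = xx(1) yy(1) path_moments(1)[of k] path_moments(1)[of "k + h"] path_moments(3)[of k h]
  have int: "integrable Q (\<lambda>z. (v * (?x z - \<mu>) + w * (?y z - \<mu>))\<^sup>2)"
    unfolding expand using ints
    by (intro Bochner_Integration.integrable_add Bochner_Integration.integrable_diff integrable_mult_right) simp_all
  have "(\<integral>z. (v * (?x z - \<mu>) + w * (?y z - \<mu>))\<^sup>2 \<partial>Q) =
      v\<^sup>2 * (\<mu> + \<mu>\<^sup>2) + w\<^sup>2 * (\<mu> + \<mu>\<^sup>2) + 2 * v * w * (a ^ h * \<mu> + \<mu>\<^sup>2) - 2 * \<mu> * (v + w) * v * \<mu>
      - 2 * \<mu> * (v + w) * w * \<mu> + \<mu>\<^sup>2 * (v + w)\<^sup>2"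
    unfolding expand using ints
    by (simp add: xx yy path_moments(2) path_moments(4) Q.prob_space del: times_divide_eq_right times_divide_eq_left)
  also have "\<dots> = (v\<^sup>2 + w\<^sup>2 + 2 * v * w * a ^ h) * \<mu>"
    by (simp only: power2_eq_square) (simp add: algebra_simps del: times_divide_eq_right times_divide_eq_left)
  finally show ?thesis
    using nn_integral_eq_integral[OF int] by simp
qed

end

lemma pair_path_components [measurable]:
  "(\<lambda>p. fst p) \<in> borel_measurable pair_path_space"
  "(\<lambda>p. real (snd p k)) \<in> borel_measurable pair_path_space"
proof -
  show "(\<lambda>p. fst p) \<in> borel_measurable pair_path_space" unfolding pair_path_space_def by simp
  have "(\<lambda>x. x k) \<in> measurable (PiM UNIV (\<lambda>_. count_space (UNIV :: nat set))) (count_space UNIV)"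
    by (intro measurable_component_singleton) simp
  from measurable_compose[OF measurable_compose[OF measurable_snd this], of real borel]
  show "(\<lambda>p. real (snd p k)) \<in> borel_measurable pair_path_space"
    unfolding pair_path_space_def by simp
qed

text \<open>
Centring by the conditional mean happens before averaging over the thinning parameter, and this is essential: \<open>X k\<close>
itself has infinite variance when \<open>(1 - \<alpha>) powr -2\<close> is not integrable, whereas the deviation has conditional
variance \<open>l / (1 - \<alpha>)\<close>, which is integrable.
\<close>

definition deviation :: "real \<Rightarrow> nat \<Rightarrow> real \<times> (nat \<Rightarrow> nat) \<Rightarrow> real" where
  "deviation l k p = real (snd p k) - l / (1 - fst p)"

lemma deviation_measurable [measurable]: "deviation l k \<in> borel_measurable pair_path_space"
  unfolding deviation_def by measurable

locale randomized_inar = prob_space M for M :: "'a measure" +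
  fixes l :: real and \<psi> :: "real \<Rightarrow> real" and \<alpha> :: "'a \<Rightarrow> real"
    and \<xi> :: "nat \<Rightarrow> nat \<Rightarrow> 'a \<Rightarrow> nat" and \<epsilon> X :: "nat \<Rightarrow> 'a \<Rightarrow> nat"
  assumes l_pos: "0 < l"
    and \<psi>_int: "set_integrable lborel {0<..<1} \<psi>"
    and \<psi>_nonneg: "AE x in lborel. 0 < x \<and> x < 1 \<longrightarrow> 0 \<le> \<psi> x"
    and density: "distributed M lborel \<alpha> (\<lambda>x. ennreal (indicator {0<..<1} x * (\<psi> x * (1 - x))))"
    and inar: "randomized_INAR1 M l \<alpha> \<xi> \<epsilon> X"
begin

text \<open>
The autocovariance of the deviations: the mean of \<open>\<alpha> ^ h * l / (1 - \<alpha>)\<close>, in which the factor \<open>1 - x\<close> of the density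
cancels.
\<close>

definition r :: "nat \<Rightarrow> real" where "r h = l * (LBINT x:{0<..<1}. \<psi> x * x ^ h)"

definition pair :: "'a \<Rightarrow> real \<times> (nat \<Rightarrow> nat)" where "pair \<omega> = (\<alpha> \<omega>, \<lambda>k. X k \<omega>)"

abbreviation "Y k \<omega> \<equiv> deviation l k (pair \<omega>)"

definition Z :: "'a \<Rightarrow> inar_input" where
  "Z \<omega> = (X 0 \<omega>, (\<lambda>(k, i)\<in>{1..} \<times> {1..}. \<xi> k i \<omega>), (\<lambda>k\<in>{1..}. \<epsilon> k \<omega>))"

lemma \<alpha>_measurable [measurable]: "\<alpha> \<in> borel_measurable M"
  and \<alpha>_bounds: "\<omega> \<in> space M \<Longrightarrow> 0 < \<alpha> \<omega> \<and> \<alpha> \<omega> < 1"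
  using inar by (auto simp: randomized_INAR1_def)

lemma X_eq_path: "\<omega> \<in> space M \<Longrightarrow> X k \<omega> = inar_path (Z \<omega>) k"
proof (induction k)
  case 0 then show ?case by (simp add: Z_def)
next
  case (Suc k)
  have "X (Suc k) \<omega> = (\<Sum>i=1..X k \<omega>. \<xi> (Suc k) i \<omega>) + \<epsilon> (Suc k) \<omega>"
    using inar Suc.prems by (simp add: randomized_INAR1_def)
  also have "(\<Sum>i=1..X k \<omega>. \<xi> (Suc k) i \<omega>) = (\<Sum>i=1..inar_path (Z \<omega>) k. fst (snd (Z \<omega>)) (Suc k, i))"
    by (intro sum.cong) (simp_all add: Suc Z_def)
  also have "\<epsilon> (Suc k) \<omega> = snd (snd (Z \<omega>)) (Suc k)" by (simp add: Z_def)
  finally show ?case by simp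
qed

lemma Z_measurable: "Z \<in> measurable M inar_input_space"
  using inar unfolding randomized_INAR1_def cond_distribution_def Z_def[abs_def] by blast

lemma nn_integral_conditioning:
  assumes "F \<in> borel_measurable (borel \<Otimes>\<^sub>M inar_input_space)"
  shows "(\<integral>\<^sup>+\<omega>. F (\<alpha> \<omega>, Z \<omega>) \<partial>M) = (\<integral>\<^sup>+\<omega>. \<integral>\<^sup>+z. F (\<alpha> \<omega>, z) \<partial>inar_input_law l (\<alpha> \<omega>) \<partial>M)"
proof -
  have kernel: "inar_kernel l (\<alpha> \<omega>) = inar_input_law l (\<alpha> \<omega>)" if "\<omega> \<in> space M" for \<omega>
    using \<alpha>_bounds[OF that] by (simp add: inar_kernel_def)
  have prob: "prob_space (inar_kernel l x)" for x
  proof -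
    interpret fixed_thinning l "if 0 < x \<and> x < 1 then x else 1 / 2"
      by unfold_locales (use l_pos in \<open>simp_all\<close>)
    show ?thesis unfolding inar_kernel_def by (rule Q.prob_space_axioms)
  qed
  have cond: "cond_distribution M \<alpha> inar_input_space Z (inar_input_law l)"
    using inar unfolding randomized_INAR1_def Z_def[abs_def] by blast
  have "cond_distribution M \<alpha> inar_input_space Z (inar_kernel l)"
    unfolding cond_distribution_def
  proof (intro conjI ballI)
    show "Z \<in> measurable M inar_input_space" by (rule Z_measurable)
    fix E assume "E \<in> sets inar_input_space"
    with cond have "AE \<omega> in M. real_cond_exp M (sigma_rv M \<alpha>) (indicator (Z -` E \<inter> space M)) \<omega> =
        measure (inar_input_law l (\<alpha> \<omega>)) E"
      unfolding cond_distribution_def by blast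
    with AE_space show "AE \<omega> in M. real_cond_exp M (sigma_rv M \<alpha>) (indicator (Z -` E \<inter> space M)) \<omega> =
        measure (inar_kernel l (\<alpha> \<omega>)) E"
      by eventually_elim (simp add: kernel)
  qed
  from conditional_law_nn_integral[OF prob_space_axioms \<alpha>_measurable inar_kernel_measurable[OF l_pos] prob this assms]
  have "(\<integral>\<^sup>+\<omega>. F (\<alpha> \<omega>, Z \<omega>) \<partial>M) = (\<integral>\<^sup>+\<omega>. \<integral>\<^sup>+z. F (\<alpha> \<omega>, z) \<partial>inar_kernel l (\<alpha> \<omega>) \<partial>M)" .
  also have "\<dots> = (\<integral>\<^sup>+\<omega>. \<integral>\<^sup>+z. F (\<alpha> \<omega>, z) \<partial>inar_input_law l (\<alpha> \<omega>) \<partial>M)"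
    by (rule nn_integral_cong) (simp only: kernel)
  finally show ?thesis .
qed

lemma conditioning_measurable:
  "(\<lambda>p. real (inar_path (snd p) k)) \<in> borel_measurable (borel \<Otimes>\<^sub>M inar_input_space)"
  using measurable_compose[OF measurable_snd measurable_compose[OF inar_path_measurable, of real borel]] by simp

lemma nn_integral_X_given_\<alpha>:
  assumes C: "C \<in> sets borel"
  shows "(\<integral>\<^sup>+\<omega>. indicator C (\<alpha> \<omega>) * ennreal (real (X k \<omega>)) \<partial>M) =
    (\<integral>\<^sup>+\<omega>. indicator C (\<alpha> \<omega>) * ennreal (l / (1 - \<alpha> \<omega>)) \<partial>M)" (is "?lhs = ?rhs")
proof -
  let ?F = "\<lambda>p. indicator C (fst p) * ennreal (real (inar_path (snd p) k))"
  have "(\<lambda>p. indicator C (fst p) :: ennreal) \<in> borel_measurable (borel \<Otimes>\<^sub>M inar_input_space)"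
    by (rule measurable_compose[OF measurable_fst borel_measurable_indicator[OF C]])
  with conditioning_measurable[of k] have F: "?F \<in> borel_measurable (borel \<Otimes>\<^sub>M inar_input_space)"
    by measurable
  have "?lhs = (\<integral>\<^sup>+\<omega>. ?F (\<alpha> \<omega>, Z \<omega>) \<partial>M)"
    by (intro nn_integral_cong) (simp add: X_eq_path)
  also have "\<dots> = (\<integral>\<^sup>+\<omega>. \<integral>\<^sup>+z. ?F (\<alpha> \<omega>, z) \<partial>inar_input_law l (\<alpha> \<omega>) \<partial>M)"
    by (rule nn_integral_conditioning[OF F])
  also have "\<dots> = ?rhs"
  proof (rule nn_integral_cong)
    fix \<omega> assume "\<omega> \<in> space M"
    then interpret fixed_thinning l "\<alpha> \<omega>" by unfold_locales (use l_pos \<alpha>_bounds in auto)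
    show "\<E> (\<lambda>z. ?F (\<alpha> \<omega>, z)) = indicator C (\<alpha> \<omega>) * ennreal \<mu>"
      using path_ennreal_measurable[of real k] by (simp add: nn_integral_cmult path_mean)
  qed
  finally show ?thesis .
qed

lemma nn_integral_deviation_square:
  "(\<integral>\<^sup>+\<omega>. ennreal ((v * Y k \<omega> + w * Y (k + h) \<omega>)\<^sup>2) \<partial>M) =
    (\<integral>\<^sup>+\<omega>. ennreal ((v\<^sup>2 + w\<^sup>2 + 2 * v * w * \<alpha> \<omega> ^ h) * (l / (1 - \<alpha> \<omega>))) \<partial>M)" (is "?lhs = ?rhs")
proof -
  let ?F = "\<lambda>p. ennreal ((v * (real (inar_path (snd p) k) - l / (1 - fst p)) +
      w * (real (inar_path (snd p) (k + h)) - l / (1 - fst p)))\<^sup>2)"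
  have "(\<lambda>p. l / (1 - fst p)) \<in> borel_measurable (borel \<Otimes>\<^sub>M inar_input_space)" by measurable
  then have F: "?F \<in> borel_measurable (borel \<Otimes>\<^sub>M inar_input_space)"
    using conditioning_measurable by measurable
  have "?lhs = (\<integral>\<^sup>+\<omega>. ?F (\<alpha> \<omega>, Z \<omega>) \<partial>M)"
    by (intro nn_integral_cong) (simp add: X_eq_path pair_def deviation_def)
  also have "\<dots> = (\<integral>\<^sup>+\<omega>. \<integral>\<^sup>+z. ?F (\<alpha> \<omega>, z) \<partial>inar_input_law l (\<alpha> \<omega>) \<partial>M)"
    by (rule nn_integral_conditioning[OF F])
  also have "\<dots> = ?rhs"
  proof (rule nn_integral_cong)
    fix \<omega> assume "\<omega> \<in> space M"
    then interpret fixed_thinning l "\<alpha> \<omega>" by unfold_locales (use l_pos \<alpha>_bounds in auto)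
    show "\<E> (\<lambda>z. ?F (\<alpha> \<omega>, z)) = ennreal ((v\<^sup>2 + w\<^sup>2 + 2 * v * w * \<alpha> \<omega> ^ h) * \<mu>)"
      unfolding fst_conv snd_conv by (rule centred_square_moment)
  qed
  finally show ?thesis .
qed

lemma mixing_moment:
  "integrable M (\<lambda>\<omega>. \<alpha> \<omega> ^ h * (l / (1 - \<alpha> \<omega>)))" (is ?integrable) "(\<integral>\<omega>. \<alpha> \<omega> ^ h * (l / (1 - \<alpha> \<omega>)) \<partial>M) = r h" (is ?value)
proof -
  let ?d = "\<lambda>x. ennreal (indicator {0<..<1} x * (\<psi> x * (1 - x)))"
  let ?g = "\<lambda>x. ennreal (x ^ h * (l / (1 - x)))"
  have int: "integrable lborel (\<lambda>x. indicator {0<..<1} x * (l * (\<psi> x * x ^ h)))"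
    using set_integrable_mult_right[of l, OF set_integrable_mult_power[OF \<psi>_int, of h]]
    by (simp add: set_integrable_def)
  have nonneg: "AE x in lborel. 0 \<le> indicator {0<..<1} x * (l * (\<psi> x * x ^ h))"
    using \<psi>_nonneg by eventually_elim (use l_pos in \<open>auto simp: indicator_def\<close>)
  have r_eq: "(\<integral>x. indicator {0<..<1} x * (l * (\<psi> x * x ^ h)) \<partial>lborel) = r h"
  proof -
    have "indicator {0<..<1} x * (l * (\<psi> x * x ^ h)) = l * (indicator {0<..<1} x *\<^sub>R (\<psi> x * x ^ h))" for x
      by simp
    then show ?thesis by (simp only: r_def set_lebesgue_integral_def integral_mult_right_zero)
  qed
  have "(\<integral>\<^sup>+\<omega>. ?g (\<alpha> \<omega>) \<partial>M) = (\<integral>\<^sup>+x. ?d x * ?g x \<partial>lborel)"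
    by (rule distributed_nn_integral[symmetric, OF density]) measurable
  also have "\<dots> = (\<integral>\<^sup>+x. ennreal (indicator {0<..<1} x * (l * (\<psi> x * x ^ h))) \<partial>lborel)"
  proof (rule nn_integral_cong_AE)
    show "AE x in lborel. ?d x * ?g x = ennreal (indicator {0<..<1} x * (l * (\<psi> x * x ^ h)))"
      using \<psi>_nonneg
    proof eventually_elim
      case (elim x)
      show ?case
      proof (cases "x \<in> {0<..<1}")
        case True
        then have "?d x * ?g x = ennreal (\<psi> x * (1 - x) * (x ^ h * (l / (1 - x))))"
        proof -
          have "?d x = ennreal (\<psi> x * (1 - x))" using True by simp
          moreover have "0 \<le> \<psi> x * (1 - x)" "0 \<le> x ^ h * (l / (1 - x))"
            using elim l_pos True by simp_all
          ultimately show ?thesis by (simp only: ennreal_mult)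
        qed
        also have "\<psi> x * (1 - x) * (x ^ h * (l / (1 - x))) = l * (\<psi> x * x ^ h)"
          using True by simp
        finally show ?thesis using True by simp
      qed simp
    qed
  qed
  also have "\<dots> = ennreal (r h)"
    unfolding r_eq[symmetric] by (rule nn_integral_eq_integral[OF int nonneg])
  finally have nn: "(\<integral>\<^sup>+\<omega>. ?g (\<alpha> \<omega>) \<partial>M) = ennreal (r h)" .
  have "0 \<le> r h" unfolding r_eq[symmetric] by (rule integral_nonneg_AE[OF nonneg])
  moreover have "AE \<omega> in M. 0 \<le> \<alpha> \<omega> ^ h * (l / (1 - \<alpha> \<omega>))"
    using \<alpha>_bounds l_pos by (intro AE_I2) (simp add: less_imp_le)
  ultimately show ?integrable ?value
    using nn by (intro integrable_integral_eqI; simp)+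
qed

lemma pair_measurable: "pair \<in> measurable M pair_path_space"
proof -
  have "X k \<in> measurable M (count_space UNIV)" for k
  proof -
    have "(\<lambda>\<omega>. inar_path (Z \<omega>) k) \<in> measurable M (count_space UNIV)"
      by (rule measurable_compose[OF Z_measurable inar_path_measurable])
    then show ?thesis by (simp add: X_eq_path cong: measurable_cong)
  qed
  then have "(\<lambda>\<omega> k. X k \<omega>) \<in> measurable M (PiM UNIV (\<lambda>_. count_space UNIV))"
    by (intro measurable_PiM_single') auto
  then show ?thesis unfolding pair_def[abs_def] pair_path_space_def by simp
qed

lemma X_integral: "integrable M (\<lambda>\<omega>. real (X k \<omega>))" (is ?integrable) "(\<integral>\<omega>. real (X k \<omega>) \<partial>M) = r 0" (is ?value)
proof -
  have [measurable]: "(\<lambda>\<omega>. real (X k \<omega>)) \<in> borel_measurable M"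
    using measurable_compose[OF pair_measurable pair_path_components(2)[of k]] by (simp add: pair_def)
  have nonneg: "AE \<omega> in M. 0 \<le> l / (1 - \<alpha> \<omega>)"
    using \<alpha>_bounds l_pos by (intro AE_I2) (simp add: less_imp_le)
  have "(\<integral>\<^sup>+\<omega>. ennreal (real (X k \<omega>)) \<partial>M) = (\<integral>\<^sup>+\<omega>. ennreal (l / (1 - \<alpha> \<omega>)) \<partial>M)"
    using nn_integral_X_given_\<alpha>[of UNIV k] by simp
  also have "\<dots> = ennreal (r 0)"
    using mixing_moment[of 0] nonneg by (simp add: nn_integral_eq_integral)
  finally have "(\<integral>\<^sup>+\<omega>. ennreal (real (X k \<omega>)) \<partial>M) = ennreal (r 0)" .
  moreover have "0 \<le> r 0" using mixing_moment(2)[of 0] integral_nonneg_AE[OF nonneg] by simp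
  ultimately show ?integrable ?value
    by (intro integrable_integral_eqI; simp)+
qed

lemma deviation_integral:
  "integrable M (\<lambda>\<omega>. Y k \<omega>)" "(\<integral>\<omega>. Y k \<omega> \<partial>M) = 0"
  using X_integral[of k] mixing_moment[of 0] by (simp_all add: deviation_def pair_def)

text \<open>
By polarization from the squares, whose conditional means are integrable in the thinning parameter.
\<close>

proposition deviation_covariance:
  "integrable M (\<lambda>\<omega>. Y k \<omega> * Y j \<omega>)" (is "?int k j")
  "(\<integral>\<omega>. Y k \<omega> * Y j \<omega> \<partial>M) = r ((k - j) + (j - k))" (is "?eq k j")
proof -
  have [measurable]: "Y k \<in> borel_measurable M" for k
    by (rule measurable_compose[OF pair_measurable deviation_measurable])
  have square: "integrable M (\<lambda>\<omega>. (v * Y k \<omega> + w * Y (k + h) \<omega>)\<^sup>2) \<and>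
      (\<integral>\<omega>. (v * Y k \<omega> + w * Y (k + h) \<omega>)\<^sup>2 \<partial>M) = (v\<^sup>2 + w\<^sup>2) * r 0 + 2 * v * w * r h"
    if vw: "0 \<le> v" "0 \<le> w" for v w k h
  proof -
    let ?m = "\<lambda>\<omega>. (v\<^sup>2 + w\<^sup>2 + 2 * v * w * \<alpha> \<omega> ^ h) * (l / (1 - \<alpha> \<omega>))"
    have m_eq: "?m \<omega> = (v\<^sup>2 + w\<^sup>2) * (\<alpha> \<omega> ^ 0 * (l / (1 - \<alpha> \<omega>))) + 2 * v * w * (\<alpha> \<omega> ^ h * (l / (1 - \<alpha> \<omega>)))" for \<omega>
      by (simp only: distrib_right power_0 mult_1 mult.assoc)
    have int: "integrable M ?m" "(\<integral>\<omega>. ?m \<omega> \<partial>M) = (v\<^sup>2 + w\<^sup>2) * r 0 + 2 * v * w * r h"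
      unfolding m_eq using mixing_moment[of 0] mixing_moment[of h]
      by (simp_all only: Bochner_Integration.integral_add integrable_mult_right integral_mult_right_zero
          Bochner_Integration.integrable_add)
    have nonneg: "AE \<omega> in M. 0 \<le> ?m \<omega>"
      using \<alpha>_bounds l_pos vw by (intro AE_I2 mult_nonneg_nonneg add_nonneg_nonneg) (simp_all add: less_imp_le)
    have "(\<integral>\<^sup>+\<omega>. ennreal ((v * Y k \<omega> + w * Y (k + h) \<omega>)\<^sup>2) \<partial>M) = ennreal ((v\<^sup>2 + w\<^sup>2) * r 0 + 2 * v * w * r h)"
      unfolding nn_integral_deviation_square int(2)[symmetric] by (rule nn_integral_eq_integral[OF int(1) nonneg])
    moreover have "0 \<le> (v\<^sup>2 + w\<^sup>2) * r 0 + 2 * v * w * r h"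
      unfolding int(2)[symmetric] by (rule integral_nonneg_AE[OF nonneg])
    ultimately show ?thesis by (subst nn_integral_eq_integrable[symmetric]) simp_all
  qed
  have product: "?int k (k + h) \<and> (\<integral>\<omega>. Y k \<omega> * Y (k + h) \<omega> \<partial>M) = r h" for k h
  proof -
    have polar: "Y k \<omega> * Y (k + h) \<omega> =
        ((1 * Y k \<omega> + 1 * Y (k + h) \<omega>)\<^sup>2 - (1 * Y k \<omega> + 0 * Y (k + h) \<omega>)\<^sup>2 - (0 * Y k \<omega> + 1 * Y (k + h) \<omega>)\<^sup>2) / 2" for \<omega>
      by (simp add: power2_sum)
    show ?thesis
      unfolding polar using square[of 1 1 k h] square[of 1 0 k h] square[of 0 1 k h]
      by (simp del: mult_1 mult_zero_left)
  qed
  have "?int k j \<and> ?eq k j"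
  proof (cases "k \<le> j")
    case True
    then show ?thesis using product[of k "j - k"] by simp
  next
    case False
    then show ?thesis using product[of j "k - j"] by (simp add: mult.commute)
  qed
  then show "?int k j" "?eq k j" by simp_all
qed

end

section \<open>The central limit theorem for independent copies\<close>

lemma (in prob_space) indep_vars_reindex_Suc:
  assumes "indep_vars (\<lambda>_. N) X {1..}"
  shows "indep_vars (\<lambda>_. N) (\<lambda>j. X (Suc j)) UNIV"
  unfolding indep_vars_def2 indep_sets_def
proof (intro conjI ballI allI impI)
  let ?F = "\<lambda>j. {X j -` B \<inter> space M |B. B \<in> sets N}"
  have rv: "\<forall>j\<in>{1..}. random_variable N (X j)" and sub: "\<forall>j\<in>{1..}. ?F j \<subseteq> events"
    and ind: "\<forall>J\<subseteq>{1..}. J \<noteq> {} \<longrightarrow> finite J \<longrightarrow> (\<forall>A\<in>Pi J ?F. prob (\<Inter>j\<in>J. A j) = (\<Prod>j\<in>J. prob (A j)))"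
    using assms unfolding indep_vars_def2 indep_sets_def by blast+
  show "random_variable N (X (Suc j))" for j using rv by simp
  show "?F (Suc j) \<subseteq> events" for j using sub by simp
  fix J :: "nat set" and A assume J: "J \<noteq> {}" "finite J" and A: "A \<in> Pi J (\<lambda>j. ?F (Suc j))"
  define A' where "A' i = A (i - 1)" for i
  have "A' \<in> Pi (Suc ` J) ?F" using A by (auto simp: A'_def Pi_iff)
  with ind[rule_format, of "Suc ` J" A'] J
  have "prob (\<Inter>j\<in>Suc ` J. A' j) = (\<Prod>j\<in>Suc ` J. prob (A' j))" by auto
  then show "prob (\<Inter>j\<in>J. A j) = (\<Prod>j\<in>J. prob (A j))"
    by (simp add: A'_def prod.reindex)
qed

text \<open>
At \<open>0\<close> both sides are \<open>0\<close> by the conventions for \<open>powr\<close> and division.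
\<close>

lemma powr_minus_half: "0 \<le> x \<Longrightarrow> x powr (- 1 / 2) = 1 / sqrt x" for x :: real
  using powr_minus_divide[of x "1 / 2"] by (simp add: powr_half_sqrt)

text \<open>
The central limit theorem for characteristic functions. The degenerate case is split off because the classical
theorem normalises by the standard deviation; it does occur, for instance for sums evaluated at time \<open>0\<close>.
\<close>

proposition iid_sum_char_limit:
  assumes "prob_space M"
    and indep: "prob_space.indep_vars M (\<lambda>_. borel) V UNIV"
    and mean: "\<And>j :: nat. (\<integral>\<omega>. V j \<omega> \<partial>M) = 0"
    and square: "\<And>j. integrable M (\<lambda>\<omega>. (V j \<omega>)\<^sup>2)" "\<And>j. (\<integral>\<omega>. (V j \<omega>)\<^sup>2 \<partial>M) = s"
    and distr: "\<And>j. distr M borel (V j) = D"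
  shows "(\<lambda>N. \<integral>\<omega>. iexp (real N powr (- 1 / 2) * (\<Sum>j<N. V j \<omega>)) \<partial>M) \<longlonglongrightarrow> complex_of_real (exp (- s / 2))"
proof -
  interpret prob_space M by fact
  have V [measurable]: "V j \<in> borel_measurable M" for j
    using indep by (simp add: indep_vars_def)
  have s_eq: "s = (sqrt s)\<^sup>2" and "0 \<le> s"
  proof -
    have "0 \<le> (\<integral>\<omega>. (V 0 \<omega>)\<^sup>2 \<partial>M)" by (rule integral_nonneg_AE) simp
    then show "0 \<le> s" by (simp only: square(2))
    then show "s = (sqrt s)\<^sup>2" by simp
  qed
  let ?T = "\<lambda>N \<omega>. real N powr (- 1 / 2) * (\<Sum>j<N. V j \<omega>)"
  show ?thesis
  proof (cases "s = 0")
    case True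
    have "AE \<omega> in M. V j \<omega> = 0" for j
    proof -
      have "AE \<omega> in M. (V j \<omega>)\<^sup>2 = 0"
        using square[of j] True by (subst integral_nonneg_eq_0_iff_AE[symmetric]) simp_all
      then show ?thesis by simp
    qed
    then have "AE \<omega> in M. \<forall>j. V j \<omega> = 0" by (simp add: AE_all_countable)
    then have "AE \<omega> in M. iexp (?T N \<omega>) = 1" for N
      by eventually_elim simp
    then have "(\<integral>\<omega>. iexp (?T N \<omega>) \<partial>M) = (\<integral>\<omega>. 1 \<partial>M)" for N
      by (intro integral_cong_AE) simp_all
    then show ?thesis using True by (simp add: prob_space)
  next
    case False
    then have pos: "0 < sqrt s" using \<open>0 \<le> s\<close> by simp
    let ?S = "\<lambda>N \<omega>. (\<Sum>j<N. V j \<omega>) / sqrt (real N * (sqrt s)\<^sup>2)"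
    have "weak_conv_m (\<lambda>N. distr M borel (?S N)) std_normal_distribution"
      by (rule central_limit_theorem_zero_mean[OF indep mean pos square(1) _ distr])
        (use mean square(2) s_eq in simp_all)
    then have "(\<lambda>N. char (distr M borel (?S N)) (sqrt s)) \<longlonglongrightarrow> char std_normal_distribution (sqrt s)"
      by (intro levy_continuity1 real_dist_normal_dist prob_space.real_distribution_distr prob_space_axioms) simp_all
    moreover have "char (distr M borel (?S N)) (sqrt s) =
        (\<integral>\<omega>. iexp (?T N \<omega>) \<partial>M)" for N
    proof -
      have "sqrt s * ?S N \<omega> = real N powr (- 1 / 2) * (\<Sum>j<N. V j \<omega>)" for \<omega>
      proof -
        have "sqrt (real N * (sqrt s)\<^sup>2) = sqrt (real N) * sqrt s" using \<open>0 \<le> s\<close> by (simp add: real_sqrt_mult)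
        moreover have "real N powr (- 1 / 2) = 1 / sqrt (real N)" by (rule powr_minus_half) simp
        ultimately show ?thesis using pos by (simp only:) simp
      qed
      moreover have "char (distr M borel (?S N)) (sqrt s) = (\<integral>\<omega>. iexp (sqrt s * ?S N \<omega>) \<partial>M)"
        unfolding char_def by (rule integral_distr) simp_all
      ultimately show ?thesis by (simp only:)
    qed
    ultimately show ?thesis using s_eq by (simp add: char_std_normal_distribution)
  qed
qed

text \<open>
A linear combination of partial sums, written as a single weighted sum over a fixed range of indices. The same
weights describe the process and its Gaussian limit.
\<close>

lemma partial_sum_regroup:
  fixes u :: "'t \<Rightarrow> real" and g :: "nat \<Rightarrow> real"
  assumes "\<And>t. t \<in> T \<Longrightarrow> n t < m"
  shows "(\<Sum>t\<in>T. u t * (b * (\<Sum>k=1..n t. g k))) = (\<Sum>k<m. (b * (\<Sum>t\<in>T. u t * of_bool (1 \<le> k \<and> k \<le> n t))) * g k)"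
proof -
  have inner: "(\<Sum>k=1..n t. g k) = (\<Sum>k<m. of_bool (1 \<le> k \<and> k \<le> n t) * g k)" if "t \<in> T" for t
    using assms[OF that] by (intro sum.mono_neutral_cong_left) auto
  have "(\<Sum>t\<in>T. u t * (b * (\<Sum>k=1..n t. g k))) = (\<Sum>t\<in>T. \<Sum>k<m. b * (u t * of_bool (1 \<le> k \<and> k \<le> n t)) * g k)"
    by (intro sum.cong refl) (simp only: inner sum_distrib_left mult_ac)
  also have "\<dots> = (\<Sum>k<m. \<Sum>t\<in>T. b * (u t * of_bool (1 \<le> k \<and> k \<le> n t)) * g k)" by (rule sum.swap)
  also have "\<dots> = (\<Sum>k<m. (b * (\<Sum>t\<in>T. u t * of_bool (1 \<le> k \<and> k \<le> n t))) * g k)"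
    by (simp only: sum_distrib_left sum_distrib_right)
  finally show ?thesis .
qed

context randomized_inar begin

lemma weighted_deviation_moments:
  "integrable M (\<lambda>\<omega>. (\<Sum>k<m. v k * Y k \<omega>)\<^sup>2)" (is ?integrable)
  "(\<integral>\<omega>. (\<Sum>k<m. v k * Y k \<omega>)\<^sup>2 \<partial>M) = (\<Sum>k<m. \<Sum>j<m. v k * v j * r ((k - j) + (j - k)))" (is ?variance)
  "(\<integral>\<omega>. (\<Sum>k<m. v k * Y k \<omega>) \<partial>M) = 0" (is ?mean)
proof -
  have expand: "(\<Sum>k<m. v k * Y k \<omega>)\<^sup>2 =
      (\<Sum>k<m. \<Sum>j<m. v k * v j * (Y k \<omega> * Y j \<omega>))" for \<omega>
    by (simp add: power2_eq_square sum_product mult_ac)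
  show ?integrable
    unfolding expand by (intro Bochner_Integration.integrable_sum integrable_mult_right deviation_covariance(1))
  show ?variance
    unfolding expand by (simp add: deviation_covariance)
  show ?mean
    by (simp add: deviation_integral)
qed

lemma pos_semidef_covariance: "pos_semidef (\<lambda>k j. r ((k - j) + (j - k)))"
  unfolding pos_semidef_def
proof (intro conjI allI)
  fix m v
  have "0 \<le> (\<integral>\<omega>. (\<Sum>k<m. v k * Y k \<omega>)\<^sup>2 \<partial>M)" by (rule integral_nonneg_AE) simp
  then show "0 \<le> (\<Sum>k<m. \<Sum>j<m. v k * v j * r ((k - j) + (j - k)))"
    by (simp only: weighted_deviation_moments)
qed (simp add: add.commute)

lemma integral_X_given_\<alpha>:
  assumes C: "C \<in> sets borel"
  shows "(\<integral>\<omega>. indicator C (\<alpha> \<omega>) * real (X k \<omega>) \<partial>M) = (\<integral>\<omega>. indicator C (\<alpha> \<omega>) * (l / (1 - \<alpha> \<omega>)) \<partial>M)"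
proof -
  have ind: "(\<lambda>\<omega>. indicator C (\<alpha> \<omega>) :: real) \<in> borel_measurable M"
    by (rule measurable_compose[OF \<alpha>_measurable borel_measurable_indicator[OF C]])
  have X: "(\<lambda>\<omega>. real (X k \<omega>)) \<in> borel_measurable M" using X_integral(1) by (rule borel_measurable_integrable)
  have "(\<integral>\<omega>. indicator C (\<alpha> \<omega>) * real (X k \<omega>) \<partial>M) = enn2real (\<integral>\<^sup>+\<omega>. ennreal (indicator C (\<alpha> \<omega>) * real (X k \<omega>)) \<partial>M)"
    using ind X by (intro integral_eq_nn_integral) simp_all
  also have "(\<integral>\<^sup>+\<omega>. ennreal (indicator C (\<alpha> \<omega>) * real (X k \<omega>)) \<partial>M) = (\<integral>\<^sup>+\<omega>. indicator C (\<alpha> \<omega>) * ennreal (real (X k \<omega>)) \<partial>M)"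
    by (intro nn_integral_cong) (simp add: indicator_def)
  also have "\<dots> = (\<integral>\<^sup>+\<omega>. indicator C (\<alpha> \<omega>) * ennreal (l / (1 - \<alpha> \<omega>)) \<partial>M)"
    by (rule nn_integral_X_given_\<alpha>[OF C])
  also have "\<dots> = (\<integral>\<^sup>+\<omega>. ennreal (indicator C (\<alpha> \<omega>) * (l / (1 - \<alpha> \<omega>))) \<partial>M)"
    by (intro nn_integral_cong) (simp add: indicator_def)
  also have "enn2real \<dots> = (\<integral>\<omega>. indicator C (\<alpha> \<omega>) * (l / (1 - \<alpha> \<omega>)) \<partial>M)"
  proof (rule integral_eq_nn_integral[symmetric])
    show "(\<lambda>\<omega>. indicator C (\<alpha> \<omega>) * (l / (1 - \<alpha> \<omega>))) \<in> borel_measurable M" using ind by measurable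
    show "AE \<omega> in M. 0 \<le> indicator C (\<alpha> \<omega>) * (l / (1 - \<alpha> \<omega>))"
      using \<alpha>_bounds l_pos by (intro AE_I2 mult_nonneg_nonneg) (simp_all add: less_imp_le)
  qed
  finally show ?thesis .
qed

end

text \<open>
The copies may live on another probability space, so every statement about them is read off from the common law of
the pair of thinning parameter and path.
\<close>

locale inar_copies = R: randomized_inar M0 l \<psi> \<alpha> \<xi> \<epsilon> X0 + prob_space M
  for M0 :: "'a measure" and l \<psi> \<alpha> \<xi> \<epsilon> X0 and M :: "'b measure" +
  fixes A :: "nat \<Rightarrow> 'b \<Rightarrow> real" and X :: "nat \<Rightarrow> nat \<Rightarrow> 'b \<Rightarrow> nat"
  assumes copies: "independent_copies M A X M0 \<alpha> X0"
begin

definition copy :: "nat \<Rightarrow> 'b \<Rightarrow> real \<times> (nat \<Rightarrow> nat)" where "copy j \<omega> = (A j \<omega>, \<lambda>k. X j k \<omega>)"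

lemma copy_indep: "indep_vars (\<lambda>_. pair_path_space) copy {1..}"
  and copy_distr: "1 \<le> j \<Longrightarrow> distr M pair_path_space (copy j) = distr M0 pair_path_space R.pair"
  using copies by (simp_all add: independent_copies_def copy_def[abs_def] R.pair_def[abs_def])

lemma copy_measurable: "1 \<le> j \<Longrightarrow> copy j \<in> measurable M pair_path_space"
  using copy_indep by (simp add: indep_vars_def)

lemma copy_transfer:
  fixes G :: "real \<times> (nat \<Rightarrow> nat) \<Rightarrow> real"
  assumes "1 \<le> j" "G \<in> borel_measurable pair_path_space"
  shows "(\<integral>\<omega>. G (copy j \<omega>) \<partial>M) = (\<integral>\<omega>. G (R.pair \<omega>) \<partial>M0)"
    and "integrable M (\<lambda>\<omega>. G (copy j \<omega>)) \<longleftrightarrow> integrable M0 (\<lambda>\<omega>. G (R.pair \<omega>))"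
  using integral_distr[OF copy_measurable[OF assms(1)] assms(2)] integral_distr[OF R.pair_measurable assms(2)]
    integrable_distr_eq[OF copy_measurable[OF assms(1)] assms(2)] integrable_distr_eq[OF R.pair_measurable assms(2)]
  by (simp_all add: copy_distr[OF assms(1)])

lemma A_measurable: "1 \<le> j \<Longrightarrow> A j \<in> borel_measurable M"
  using measurable_compose[OF copy_measurable pair_path_components(1)] by (simp add: copy_def)

lemma X_measurable: "1 \<le> j \<Longrightarrow> (\<lambda>\<omega>. real (X j k \<omega>)) \<in> borel_measurable M"
  using measurable_compose[OF copy_measurable pair_path_components(2)] by (simp add: copy_def)

text \<open>
The conditional expectation is determined by integrals over events of the form \<open>A j \<in> C\<close>, and these only
involve the law of the pair.
\<close>

lemma cond_exp_copy:
  assumes j: "1 \<le> j"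
  shows "AE \<omega> in M. real_cond_exp M (sigma_rv M (A j)) (\<lambda>\<omega>. real (X j k \<omega>)) \<omega> = l / (1 - A j \<omega>)"
proof -
  interpret S: finite_measure_subalgebra M "sigma_rv M (A j)"
    by unfold_locales (rule subalgebra_sigma_rv[OF A_measurable[OF j]])
  have mean_meas: "(\<lambda>p. l / (1 - fst p)) \<in> borel_measurable pair_path_space" by measurable
  show ?thesis
  proof (rule S.real_cond_exp_charact)
    show "integrable M (\<lambda>\<omega>. real (X j k \<omega>))"
      using copy_transfer(2)[OF j pair_path_components(2)[of k]] R.X_integral(1)[of k]
      by (simp add: copy_def R.pair_def)
    show "integrable M (\<lambda>\<omega>. l / (1 - A j \<omega>))"
      using copy_transfer(2)[OF j mean_meas] R.mixing_moment(1)[of 0]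
      by (simp add: copy_def R.pair_def)
    have "A j \<in> measurable (sigma_rv M (A j)) borel" by (rule measurable_vimage_algebra1) simp
    then show "(\<lambda>\<omega>. l / (1 - A j \<omega>)) \<in> borel_measurable (sigma_rv M (A j))" by measurable
    fix B assume "B \<in> sets (sigma_rv M (A j))"
    then obtain C where C: "C \<in> sets borel" "B = A j -` C \<inter> space M"
      by (auto simp: sets_vimage_algebra2)
    let ?L = "\<integral>\<omega>\<in>B. real (X j k \<omega>) \<partial>M" and ?R = "\<integral>\<omega>\<in>B. l / (1 - A j \<omega>) \<partial>M"
    have ind: "(\<lambda>p. indicator C (fst p) :: real) \<in> borel_measurable pair_path_space"
      by (rule measurable_compose[OF pair_path_components(1) borel_measurable_indicator[OF C(1)]])
    have "?L = (\<integral>\<omega>. indicator C (fst (copy j \<omega>)) * real (snd (copy j \<omega>) k) \<partial>M)"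
      unfolding set_lebesgue_integral_def
      by (intro Bochner_Integration.integral_cong) (simp_all add: C(2) copy_def indicator_def)
    also have "\<dots> = (\<integral>\<omega>. indicator C (fst (R.pair \<omega>)) * real (snd (R.pair \<omega>) k) \<partial>M0)"
      by (rule copy_transfer(1)[OF j]) (use ind in measurable)
    also have "\<dots> = (\<integral>\<omega>. indicator C (fst (R.pair \<omega>)) * (l / (1 - fst (R.pair \<omega>))) \<partial>M0)"
      using R.integral_X_given_\<alpha>[OF C(1)] by (simp add: R.pair_def)
    also have "\<dots> = (\<integral>\<omega>. indicator C (fst (copy j \<omega>)) * (l / (1 - fst (copy j \<omega>))) \<partial>M)"
      by (rule copy_transfer(1)[OF j, symmetric]) (use ind mean_meas in measurable)
    also have "\<dots> = ?R"
      unfolding set_lebesgue_integral_def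
      by (intro Bochner_Integration.integral_cong) (simp_all add: C(2) copy_def indicator_def)
    finally show "?L = ?R" .
  qed
qed

lemma S_tilde_measurable: "S_tilde M A X N n t \<in> borel_measurable M"
  unfolding S_tilde_def using X_measurable by (intro borel_measurable_sum borel_measurable_diff) auto

lemma S_tilde_eq_deviations:
  "AE \<omega> in M. \<forall>t. S_tilde M A X N n t \<omega> = (\<Sum>j<N. \<Sum>k=1..nat \<lfloor>real n * t\<rfloor>. deviation l k (copy (Suc j) \<omega>))"
proof -
  have "AE \<omega> in M. \<forall>j k. 1 \<le> j \<longrightarrow> real_cond_exp M (sigma_rv M (A j)) (\<lambda>\<omega>. real (X j k \<omega>)) \<omega> = l / (1 - A j \<omega>)"
    using cond_exp_copy by (simp add: AE_all_countable)
  then show ?thesis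
  proof eventually_elim
    case (elim \<omega>)
    show ?case
    proof
      fix t
      have "S_tilde M A X N n t \<omega> = (\<Sum>j=1..N. \<Sum>k=1..nat \<lfloor>real n * t\<rfloor>. deviation l k (copy j \<omega>))"
        unfolding S_tilde_def using elim by (intro sum.cong refl) (simp add: deviation_def copy_def)
      also have "\<dots> = (\<Sum>j<N. \<Sum>k=1..nat \<lfloor>real n * t\<rfloor>. deviation l k (copy (Suc j) \<omega>))"
        by (rule sum.reindex_bij_witness[where i = Suc and j = "\<lambda>j. j - 1"]) auto
      finally show "S_tilde M A X N n t \<omega> = (\<Sum>j<N. \<Sum>k=1..nat \<lfloor>real n * t\<rfloor>. deviation l k (copy (Suc j) \<omega>))" .
    qed
  qed
qed

lemma aggregated_char_limit:
  fixes v :: "nat \<Rightarrow> real"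
  shows "(\<lambda>N. \<integral>\<omega>. iexp (real N powr (- 1 / 2) * (\<Sum>j<N. \<Sum>k<m. v k * deviation l k (copy (Suc j) \<omega>))) \<partial>M)
    \<longlonglongrightarrow> complex_of_real (exp (- (\<Sum>k<m. \<Sum>i<m. v k * v i * R.r ((k - i) + (i - k))) / 2))"
proof -
  define \<Phi> where "\<Phi> p = (\<Sum>k<m. v k * deviation l k p)" for p
  have \<Phi>: "\<Phi> \<in> borel_measurable pair_path_space" unfolding \<Phi>_def by measurable
  have "(\<lambda>N. \<integral>\<omega>. iexp (real N powr (- 1 / 2) * (\<Sum>j<N. \<Phi> (copy (Suc j) \<omega>))) \<partial>M)
    \<longlonglongrightarrow> complex_of_real (exp (- (\<Sum>k<m. \<Sum>i<m. v k * v i * R.r ((k - i) + (i - k))) / 2))"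
  proof (rule iid_sum_char_limit[OF prob_space_axioms])
    show "indep_vars (\<lambda>_. borel) (\<lambda>j \<omega>. \<Phi> (copy (Suc j) \<omega>)) UNIV"
      using indep_vars_compose2[OF indep_vars_reindex_Suc[OF copy_indep], of "\<lambda>_. \<Phi>" "\<lambda>_. borel"] \<Phi> by simp
    fix j
    have \<Phi>2: "(\<lambda>p. (\<Phi> p)\<^sup>2) \<in> borel_measurable pair_path_space" using \<Phi> by measurable
    show "(\<integral>\<omega>. \<Phi> (copy (Suc j) \<omega>) \<partial>M) = 0"
      using copy_transfer(1)[OF _ \<Phi>, of "Suc j"] R.weighted_deviation_moments(3)[of v m] by (simp add: \<Phi>_def)
    show "integrable M (\<lambda>\<omega>. (\<Phi> (copy (Suc j) \<omega>))\<^sup>2)"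
      using copy_transfer(2)[OF _ \<Phi>2, of "Suc j"] R.weighted_deviation_moments(1)[of v m] by (simp add: \<Phi>_def)
    show "(\<integral>\<omega>. (\<Phi> (copy (Suc j) \<omega>))\<^sup>2 \<partial>M) = (\<Sum>k<m. \<Sum>i<m. v k * v i * R.r ((k - i) + (i - k)))"
      using copy_transfer(1)[OF _ \<Phi>2, of "Suc j"] R.weighted_deviation_moments(2)[of v m] by (simp add: \<Phi>_def)
    have "distr M borel (\<lambda>\<omega>. \<Phi> (copy (Suc j) \<omega>)) = distr (distr M pair_path_space (copy (Suc j))) borel \<Phi>"
      using copy_measurable[of "Suc j"] \<Phi> by (simp add: distr_distr comp_def)
    then show "distr M borel (\<lambda>\<omega>. \<Phi> (copy (Suc j) \<omega>)) = distr (distr M0 pair_path_space R.pair) borel \<Phi>"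
      by (simp add: copy_distr)
  qed
  then show ?thesis by (simp add: \<Phi>_def)
qed

end

section \<open>The iterated limit\<close>

theorem theorem2p3:
  fixes l \<beta> \<psi>1 :: real
    and \<psi> :: "real \<Rightarrow> real"
    and M0 :: "'a measure" and \<alpha> :: "'a \<Rightarrow> real"
    and \<xi> :: "nat \<Rightarrow> nat \<Rightarrow> 'a \<Rightarrow> nat" and \<epsilon> :: "nat \<Rightarrow> 'a \<Rightarrow> nat" and X0 :: "nat \<Rightarrow> 'a \<Rightarrow> nat"
    and M :: "'b measure" and A :: "nat \<Rightarrow> 'b \<Rightarrow> real" and X :: "nat \<Rightarrow> nat \<Rightarrow> 'b \<Rightarrow> nat"
    and W :: "'c measure" and B :: "real \<Rightarrow> 'c \<Rightarrow> real"
  assumes "0 < l"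
    and "set_integrable lborel {0<..<1} \<psi>"
    and "AE x in lborel. 0 < x \<and> x < 1 \<longrightarrow> 0 \<le> \<psi> x"
    and "(\<psi> \<longlongrightarrow> \<psi>1) (at_left 1)" and "0 < \<psi>1"
    and "prob_space M0"
    and "distributed M0 lborel \<alpha> (\<lambda>x. ennreal (indicator {0<..<1} x * (\<psi> x * (1 - x) powr \<beta>)))"
    and "randomized_INAR1 M0 l \<alpha> \<xi> \<epsilon> X0"
    and "prob_space M"
    and "independent_copies M A X M0 \<alpha> X0"
    and "standard_wiener W B"
    and "\<beta> = 1"
  shows "\<exists>L :: nat \<Rightarrow> (real \<Rightarrow> real) measure.
    (\<forall>n. prob_space (L n) \<and> sets (L n) = sets (PiM {0..} (\<lambda>_. borel))) \<and>
    (\<forall>n\<ge>2. fdd_converges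
       (\<lambda>_. M)
       (\<lambda>N t \<omega>. (real n * ln (real n)) powr (- 1 / 2) * real N powr (- 1 / 2) * S_tilde M A X N n t \<omega>)
       (L n) (\<lambda>t x. x t)) \<and>
    fdd_converges L (\<lambda>_ t x. x t) W (\<lambda>t \<omega>. sqrt (2 * l * \<psi>1) * B t \<omega>)"
proof -
  have dens: "(\<lambda>x. ennreal (indicator {0<..<1} x * (\<psi> x * (1 - x) powr \<beta>))) =
      (\<lambda>x. ennreal (indicator {0<..<1} x * (\<psi> x * (1 - x))))"
    using \<open>\<beta> = 1\<close> by (auto simp: fun_eq_iff indicator_def)
  interpret M0: prob_space M0 by fact
  interpret M: prob_space M by fact
  interpret inar_copies M0 l \<psi> \<alpha> \<xi> \<epsilon> X0 M A X
    by unfold_locales (use assms dens in \<open>simp_all\<close>)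
  interpret W: prob_space W using assms(11) by (simp add: standard_wiener_def)
  define b where "b n = (real n * ln (real n)) powr (- 1 / 2)" for n :: nat
  define m where "m n t = nat \<lfloor>real n * t\<rfloor>" for n :: nat and t :: real
  obtain P :: "(nat \<Rightarrow> real) measure" and G where P: "prob_space P" and G: "\<And>k. G k \<in> borel_measurable P"
    and G_char: "\<And>q v. (\<integral>\<omega>. iexp (\<Sum>k<q. v k * G k \<omega>) \<partial>P) =
       complex_of_real (exp (- (\<Sum>k<q. \<Sum>j<q. v k * v j * R.r ((k - j) + (j - k))) / 2))"
    using gaussian_sequence_exists[OF R.pos_semidef_covariance] by blast
  \<comment> \<open>The candidate for the limit as \<open>N\<close> grows: the normalised partial sums of a Gaussian sequence with the autocovariance of the deviations.\<close>
  define S where "S n \<omega> = (\<lambda>t\<in>{0..}. b n * (\<Sum>k=1..m n t. G k \<omega>))" for n \<omega>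
  define L where "L n = distr P (PiM {0..} (\<lambda>_. borel)) (S n)" for n
  have S_meas: "S n \<in> measurable P (PiM {0..} (\<lambda>_. borel))" for n
    unfolding S_def using G
    by (intro measurable_restrict borel_measurable_times borel_measurable_const borel_measurable_sum) auto
  have L_prob: "prob_space (L n)" for n
    unfolding L_def using P S_meas by (rule prob_space.prob_space_distr)
  have L_sets: "sets (L n) = sets (PiM {0..} (\<lambda>_. borel))" for n by (simp add: L_def)
  have L_coord: "(\<lambda>x. x t) \<in> borel_measurable (L n)" if "0 \<le> t" for n and t :: real
  proof -
    have "(\<lambda>x. x t) \<in> borel_measurable (PiM {0..} (\<lambda>_. borel :: real measure))"
      using that by (intro measurable_component_singleton) auto
    then show ?thesis by (simp cong: measurable_cong_sets add: L_sets)
  qed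
  define coef where "coef n T u k = b n * (\<Sum>t\<in>T. u t * of_bool (1 \<le> k \<and> k \<le> m n t))"
    for n T and u :: "real \<Rightarrow> real" and k
  have regroup: "(\<Sum>t\<in>T. u t * (b n * (\<Sum>k=1..m n t. g k))) = (\<Sum>k<Suc (\<Sum>t\<in>T. m n t). coef n T u k * g k)"
    if "finite T" for n T u g
    unfolding coef_def by (intro partial_sum_regroup le_imp_less_Suc member_le_sum) (use that in simp_all)
  \<comment> \<open>The variance of the linear combination with weights \<open>u\<close>, for one copy as well as for the Gaussian limit.\<close>
  define V where "V n T u = (\<Sum>k<Suc (\<Sum>t\<in>T. m n t). \<Sum>j<Suc (\<Sum>t\<in>T. m n t).
    coef n T u k * coef n T u j * R.r ((k - j) + (j - k)))" for n T u
  have L_char: "(\<integral>x. iexp (\<Sum>t\<in>T. u t * x t) \<partial>L n) = complex_of_real (exp (- V n T u / 2))"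
    if T: "finite T" "T \<subseteq> {0..}" for n T u
  proof -
    have "(\<lambda>x. \<Sum>t\<in>T. u t * x t) \<in> borel_measurable (PiM {0..} (\<lambda>_. borel :: real measure))"
      using T by (intro borel_measurable_sum borel_measurable_times borel_measurable_const
          measurable_component_singleton) auto
    then have "(\<integral>x. iexp (\<Sum>t\<in>T. u t * x t) \<partial>L n) = (\<integral>\<omega>. iexp (\<Sum>t\<in>T. u t * S n \<omega> t) \<partial>P)"
      unfolding L_def by (intro integral_distr S_meas iexp_measurable)
    also have "(\<lambda>\<omega>. \<Sum>t\<in>T. u t * S n \<omega> t) = (\<lambda>\<omega>. \<Sum>k<Suc (\<Sum>t\<in>T. m n t). coef n T u k * G k \<omega>)"
      unfolding regroup[OF T(1), symmetric] S_def using T(2)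
      by (intro ext sum.cong refl) auto
    finally show ?thesis unfolding V_def G_char .
  qed
  have inner: "fdd_converges (\<lambda>_. M)
      (\<lambda>N t \<omega>. b n * real N powr (- 1 / 2) * S_tilde M A X N n t \<omega>) (L n) (\<lambda>t x. x t)" for n
  proof (rule fdd_converges_charI)
    show "(\<lambda>\<omega>. b n * real N powr (- 1 / 2) * S_tilde M A X N n t \<omega>) \<in> borel_measurable M" for N t
      using S_tilde_measurable by (intro borel_measurable_times borel_measurable_const)
    fix T :: "real set" and u :: "real \<Rightarrow> real" assume T: "finite T" "T \<subseteq> {0..}"
    let ?q = "Suc (\<Sum>t\<in>T. m n t)"
    let ?v = "coef n T u"
    let ?lhs = "\<lambda>N \<omega>. \<Sum>t\<in>T. u t * (b n * real N powr (- 1 / 2) * S_tilde M A X N n t \<omega>)"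
    let ?rhs = "\<lambda>N \<omega>. real N powr (- 1 / 2) * (\<Sum>j<N. \<Sum>k<?q. ?v k * deviation l k (copy (Suc j) \<omega>))"
    have "(\<integral>\<omega>. iexp (?lhs N \<omega>) \<partial>M) =
        (\<integral>\<omega>. iexp (?rhs N \<omega>) \<partial>M)" for N
    proof (rule integral_cong_AE)
      have "?lhs N \<in> borel_measurable M"
        using S_tilde_measurable by (intro borel_measurable_sum borel_measurable_times borel_measurable_const)
      then show "(\<lambda>\<omega>. iexp (?lhs N \<omega>)) \<in> borel_measurable M"
        by (rule iexp_measurable)
      have "?rhs N \<in> borel_measurable M"
        by (intro borel_measurable_sum borel_measurable_times borel_measurable_const
            measurable_compose[OF copy_measurable deviation_measurable]) simp
      then show "(\<lambda>\<omega>. iexp (?rhs N \<omega>)) \<in> borel_measurable M"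
        by (rule iexp_measurable)
      show "AE \<omega> in M. iexp (?lhs N \<omega>) =
          iexp (?rhs N \<omega>)"
        using S_tilde_eq_deviations[of N n]
      proof eventually_elim
        case (elim \<omega>)
        have "(\<Sum>t\<in>T. u t * (b n * c * S_tilde M A X N n t \<omega>)) =
            c * (\<Sum>j<N. \<Sum>k<?q. ?v k * deviation l k (copy (Suc j) \<omega>))" for c
        proof -
          have "(\<Sum>t\<in>T. u t * (b n * c * S_tilde M A X N n t \<omega>)) =
              (\<Sum>t\<in>T. \<Sum>j<N. c * (u t * (b n * (\<Sum>k=1..m n t. deviation l k (copy (Suc j) \<omega>)))))"
            by (intro sum.cong refl) (simp only: elim m_def sum_distrib_left mult_ac)
          also have "\<dots> = (\<Sum>j<N. \<Sum>t\<in>T. c * (u t * (b n * (\<Sum>k=1..m n t. deviation l k (copy (Suc j) \<omega>)))))"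
            by (rule sum.swap)
          also have "\<dots> = c * (\<Sum>j<N. \<Sum>k<?q. ?v k * deviation l k (copy (Suc j) \<omega>))"
            by (simp only: sum_distrib_left[symmetric] regroup[OF T(1)])
          finally show ?thesis .
        qed
        then show ?case by simp
      qed
    qed
    then show "(\<lambda>N. \<integral>\<omega>. iexp (?lhs N \<omega>) \<partial>M)
        \<longlonglongrightarrow> (\<integral>x. iexp (\<Sum>t\<in>T. u t * x t) \<partial>L n)"
      unfolding L_char[OF T] V_def by (simp only: aggregated_char_limit)
  qed (use L_prob L_coord M.prob_space_axioms in auto)
  have "(\<lambda>h. l * (real h * (LBINT x:{0<..<1}. \<psi> x * x ^ h))) \<longlonglongrightarrow> l * \<psi>1"
    by (intro tendsto_mult_left moment_asymptotics assms)
  then have r_asymp: "(\<lambda>h. real h * R.r h) \<longlonglongrightarrow> l * \<psi>1"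
    by (simp add: R.r_def mult_ac)
  have V_eq: "V n T u = (\<Sum>s\<in>T. \<Sum>t\<in>T. u s * u t * (cov_sum R.r (m n s) (m n t) / (real n * ln (real n))))"
    if "finite T" for n T u
  proof -
    let ?q = "Suc (\<Sum>t\<in>T. m n t)"
    let ?v = "coef n T u"
    \<comment> \<open>For \<open>n\<close> equal to 0 or 1 both sides are 0, since division by zero gives zero.\<close>
    have b2: "b n * b n = 1 / (real n * ln (real n))"
    proof -
      have nonneg: "0 \<le> real n * ln (real n)" by (cases n) simp_all
      have "b n = 1 / sqrt (real n * ln (real n))" unfolding b_def by (rule powr_minus_half[OF nonneg])
      then show ?thesis using nonneg by simp
    qed
    have "V n T u = (\<Sum>k<?q. ?v k * (\<Sum>j<?q. ?v j * R.r ((k - j) + (j - k))))"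
      unfolding V_def by (simp only: sum_distrib_left mult.assoc)
    also have "\<dots> = (\<Sum>s\<in>T. u s * (b n * (\<Sum>k=1..m n s. \<Sum>t\<in>T. u t * (b n * (\<Sum>j=1..m n t. R.r ((k - j) + (j - k)))))))"
      by (simp only: regroup[OF that])
    also have "\<dots> = (\<Sum>s\<in>T. \<Sum>t\<in>T. u s * u t * (b n * b n * cov_sum R.r (m n s) (m n t)))"
    proof (intro sum.cong refl)
      fix s
      have "(\<Sum>k=1..m n s. \<Sum>t\<in>T. u t * (b n * (\<Sum>j=1..m n t. R.r ((k - j) + (j - k))))) =
          (\<Sum>t\<in>T. \<Sum>k=1..m n s. u t * (b n * (\<Sum>j=1..m n t. R.r ((k - j) + (j - k)))))"
        by (rule sum.swap)
      also have "\<dots> = (\<Sum>t\<in>T. u t * (b n * cov_sum R.r (m n s) (m n t)))"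
        by (simp only: sum_distrib_left[symmetric] cov_sum_def)
      finally show "u s * (b n * (\<Sum>k=1..m n s. \<Sum>t\<in>T. u t * (b n * (\<Sum>j=1..m n t. R.r ((k - j) + (j - k)))))) =
          (\<Sum>t\<in>T. u s * u t * (b n * b n * cov_sum R.r (m n s) (m n t)))"
        by (simp only: sum_distrib_left mult_ac)
    qed
    also have "\<dots> = (\<Sum>s\<in>T. \<Sum>t\<in>T. u s * u t * (cov_sum R.r (m n s) (m n t) / (real n * ln (real n))))"
      by (simp add: b2)
    finally show ?thesis .
  qed
  have outer: "fdd_converges L (\<lambda>_ t x. x t) W (\<lambda>t \<omega>. sqrt (2 * l * \<psi>1) * B t \<omega>)"
  proof (rule fdd_converges_charI[OF L_prob W.prob_space_axioms L_coord])
    show "(\<lambda>\<omega>. sqrt (2 * l * \<psi>1) * B t \<omega>) \<in> borel_measurable W" if "0 \<le> t" for t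
    proof -
      have "B t \<in> borel_measurable W" using assms(11) that unfolding standard_wiener_def by blast
      then show ?thesis by (rule borel_measurable_times[OF borel_measurable_const])
    qed
    fix T :: "real set" and u :: "real \<Rightarrow> real" assume T: "finite T" "T \<subseteq> {0..}"
    have "(\<lambda>n. V n T u) \<longlonglongrightarrow> (\<Sum>s\<in>T. \<Sum>t\<in>T. u s * u t * (2 * (l * \<psi>1) * min s t))"
      unfolding V_eq[OF T(1)] m_def using T(2)
      by (intro tendsto_sum tendsto_mult_left cov_sum_scaled_limit[OF r_asymp]) auto
    then have "(\<lambda>n. complex_of_real (exp (- V n T u / 2))) \<longlonglongrightarrow>
        complex_of_real (exp (- (\<Sum>s\<in>T. \<Sum>t\<in>T. u s * u t * (2 * (l * \<psi>1) * min s t)) / 2))"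
      by (intro tendsto_intros) simp_all
    moreover have "(\<integral>\<omega>. iexp (\<Sum>t\<in>T. u t * (sqrt (2 * l * \<psi>1) * B t \<omega>)) \<partial>W) =
        complex_of_real (exp (- (\<Sum>s\<in>T. \<Sum>t\<in>T. u s * u t * (2 * (l * \<psi>1) * min s t)) / 2))"
    proof -
      let ?c = "sqrt (2 * l * \<psi>1)"
      have c2: "?c * ?c = 2 * (l * \<psi>1)" using assms(1,5) by simp
      have "(\<integral>\<omega>. iexp (\<Sum>t\<in>T. u t * (?c * B t \<omega>)) \<partial>W) = (\<integral>\<omega>. iexp (\<Sum>t\<in>T. (u t * ?c) * B t \<omega>) \<partial>W)"
        by (simp only: mult.assoc)
      also have "\<dots> = complex_of_real (exp (- (\<Sum>s\<in>T. \<Sum>t\<in>T. (u s * ?c) * (u t * ?c) * min s t) / 2))"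
        by (rule wiener_char[OF assms(11) T])
      finally have char: "(\<integral>\<omega>. iexp (\<Sum>t\<in>T. u t * (?c * B t \<omega>)) \<partial>W) =
          complex_of_real (exp (- (\<Sum>s\<in>T. \<Sum>t\<in>T. (u s * ?c) * (u t * ?c) * min s t) / 2))" .
      have "(u s * ?c) * (u t * ?c) * min s t = u s * u t * (2 * (l * \<psi>1) * min s t)" for s t
        unfolding c2[symmetric] by (simp only: mult_ac)
      with char show ?thesis by (simp only:)
    qed
    ultimately show "(\<lambda>n. \<integral>x. iexp (\<Sum>t\<in>T. u t * x t) \<partial>L n) \<longlonglongrightarrow>
        (\<integral>\<omega>. iexp (\<Sum>t\<in>T. u t * (sqrt (2 * l * \<psi>1) * B t \<omega>)) \<partial>W)"
      by (simp only: L_char[OF T])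
  qed
  show ?thesis
    using L_prob L_sets inner outer unfolding b_def by (intro exI[of _ L]) simp
qed

end
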